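(* Suppose that the linear automorphism $A:=A_1\times A_2$ of the torus $\mathbb{T}^4=\mathbb{T}^2\times\mathbb{T}^2$ is a direct product of two linear hyperbolic automorphisms $A_1,A_2$ of $\mathbb{T}^2$. If $\mu_i$, $i=1,2$, are $A_i$-invariant ergodic probability measures with positive entropy, then the $A$-invariant ergodic probability measure $\mu:=\mu_1\times\mu_2$ satisfies $$\lim_{r\to0}\frac{\tau(B(x,r))}{-\log r}=\frac{1}{\lambda^u}-\frac{1}{\lambda^s}$$ for $\mu$-almost every $x$.
   Context: $B(x,r)$ is the ball of radius $r$ around $x$ in $\mathbb{T}^4$ for the usual (flat) metric; the limit depends only on the equivalence class of the metric. For a set $E\subset\mathbb{T}^4$, $\tau(E):=\min\{k>0: A^k(E)\cap E\neq\emptyset\}$ is the first return time of the set $E$ to itself under $A$. $\lambda^u$ is the smallest positive Lyapunov exponent of $A$ and $\lambda^s$ is the largest (i.e. closest to $0$) negative Lyapunov exponent of $A$, with respect to $\mu$; since $A$ is linear, the Lyapunov exponents are the logarithms of the moduli of the eigenvalues of $A$.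
   Formalization: The product μ1×μ2 need not be ergodic (μ1=μ2 ergodic of positive entropy with eigenvalue −1 is a counterexample), so ergodicity of μ is neither assumed nor asserted; the limit formula is proved in all cases, with μ shown to be an A-invariant probability measure. *)

theory Defs
  imports "HOL-Analysis.Analysis" "HOL-Probability.Probability"
begin

section \<open>The flat torus\<close>

definition int_vec :: "real^'n \<Rightarrow> bool" where
  "int_vec z \<longleftrightarrow> (\<forall>i. z $ i \<in> \<int>)"

lemma int_vec_0 [simp]: "int_vec 0"
  by (simp add: int_vec_def)

lemma int_vec_add: "int_vec a \<Longrightarrow> int_vec b \<Longrightarrow> int_vec (a + b)"
  by (simp add: int_vec_def)

lemma int_vec_minus: "int_vec a \<Longrightarrow> int_vec (- a)"
  by (simp add: int_vec_def)

lemma int_vec_norm_less_1: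
  assumes "int_vec z" "norm z < 1"
  shows "z = 0"
proof -
  have "z $ i = 0" for i
  proof -
    have "\<bar>z $ i\<bar> < 1"
      using component_le_norm_cart[of z i] assms(2) by linarith
    moreover have "z $ i \<in> \<int>"
      using assms(1) by (simp add: int_vec_def)
    ultimately show ?thesis
      by (auto elim!: Ints_cases)
  qed
  then show ?thesis
    by (simp add: vec_eq_iff)
qed

definition torus_rel :: "real^'n \<Rightarrow> real^'n \<Rightarrow> bool" where
  "torus_rel a b \<longleftrightarrow> int_vec (a - b)"

quotient_type (overloaded) 'n torus = "real^'n::finite" / torus_rel
proof (rule equivpI)
  show "reflp (torus_rel :: real^'n \<Rightarrow> _)"
    by (simp add: reflp_def torus_rel_def)
  show "symp (torus_rel :: real^'n \<Rightarrow> _)"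
    unfolding symp_def torus_rel_def by (metis int_vec_minus minus_diff_eq)
  show "transp (torus_rel :: real^'n \<Rightarrow> _)"
  proof (rule transpI)
    fix x y z :: "real^'n"
    assume "torus_rel x y" "torus_rel y z"
    then have "int_vec ((x - y) + (y - z))"
      unfolding torus_rel_def by (rule int_vec_add)
    then show "torus_rel x z"
      by (simp add: torus_rel_def)
  qed
qed

lemma abs_torus_eq_iff: "abs_torus a = abs_torus b \<longleftrightarrow> int_vec (a - b)"
  by (simp add: torus.abs_eq_iff torus_rel_def)

lemma abs_torus_cases: obtains a where "x = abs_torus a"
proof -
  have "x = abs_torus (rep_torus x)"
    by (simp add: Quotient_abs_rep[OF Quotient_torus])
  then show thesis by (rule that)
qed

instantiation torus :: (finite) metric_space
begin

definition dist_torus :: "'a torus \<Rightarrow> 'a torus \<Rightarrow> real" where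
  "dist x y = Inf {dist a b | a b. abs_torus a = x \<and> abs_torus b = y}"

definition uniformity_torus :: "('a torus \<times> 'a torus) filter" where
  "uniformity = (INF e\<in>{0<..}. principal {(x::'a torus, y). dist x y < e})"

definition open_torus :: "'a torus set \<Rightarrow> bool" where
  "open (U :: 'a torus set) \<longleftrightarrow> (\<forall>x\<in>U. \<forall>\<^sub>F (x', y) in uniformity. x' = x \<longrightarrow> y \<in> U)"

lemma dist_torus_le: "dist (abs_torus a) (abs_torus b) \<le> dist a b"
  unfolding dist_torus_def by (rule cInf_lower) (auto intro!: bdd_belowI[of _ 0])

lemma dist_torus_lessD:
  assumes "dist (abs_torus a) y < e"
  obtains b where "abs_torus b = y" "dist a b < e"
proof -
  obtain b0 where b0: "y = abs_torus b0" by (rule abs_torus_cases)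
  let ?S = "{dist a' b | a' b. abs_torus a' = abs_torus a \<and> abs_torus b = y}"
  have "?S \<noteq> {}" using b0 by auto
  moreover have "Inf ?S < e" using assms by (simp add: dist_torus_def)
  ultimately have "\<exists>s\<in>?S. s < e"
    by (rule cInf_lessD)
  then obtain s where "s \<in> ?S" "s < e"
    by (rule bexE)
  then obtain a' b where ab: "abs_torus a' = abs_torus a" "abs_torus b = y" "dist a' b < e"
    by auto
  have "abs_torus (b + (a - a')) = abs_torus b"
    using ab(1) int_vec_minus[of "a' - a"] by (simp add: abs_torus_eq_iff)
  moreover have "dist a (b + (a - a')) = dist a' b"
    by (simp add: dist_norm algebra_simps)
  ultimately show ?thesis
    using that[of "b + (a - a')"] ab by simp
qed

lemma dist_torus_nonneg: "0 \<le> dist x (y::'a torus)"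
proof -
  obtain a where a: "x = abs_torus a" by (rule abs_torus_cases)
  obtain b where b: "y = abs_torus b" by (rule abs_torus_cases)
  from a b show ?thesis
    unfolding dist_torus_def by (intro cInf_greatest) auto
qed

lemma dist_torus_sym: "dist x y = dist y (x::'a torus)"
proof -
  have "{dist a b | a b. abs_torus a = x \<and> abs_torus b = y} =
      {dist a b | a b. abs_torus a = y \<and> abs_torus b = x}"
    using dist_commute by blast
  then show ?thesis
    by (simp add: dist_torus_def)
qed

instance
proof
  fix x y z :: "'a torus"
  obtain a where a: "x = abs_torus a" by (rule abs_torus_cases)
  obtain c where c: "z = abs_torus c" by (rule abs_torus_cases)
  show "dist x y = 0 \<longleftrightarrow> x = y"
  proof
    assume "x = y"
    then have "dist x y \<le> 0"
      using dist_torus_le[of a a] a by simp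
    then show "dist x y = 0"
      using dist_torus_nonneg[of x y] by linarith
  next
    assume d0: "dist x y = 0"
    obtain b where b: "abs_torus b = y" "dist a b < 1/2"
      using d0 a dist_torus_lessD[of a y "1/2"] by auto
    have "dist a b = 0"
    proof (rule ccontr)
      assume "dist a b \<noteq> 0"
      then have pos: "0 < dist a b" by simp
      with d0 a obtain b' where b': "abs_torus b' = y" "dist a b' < dist a b"
        using dist_torus_lessD[of a y "dist a b"] by auto
      have "dist b b' < 1"
        using b b' dist_triangle[of b b' a] by (simp add: dist_commute)
      moreover have "int_vec (b - b')"
        using b b' by (metis abs_torus_eq_iff)
      ultimately have "b = b'"
        using int_vec_norm_less_1[of "b - b'"] by (simp add: dist_norm)
      with b' show False by simp
    qed
    with a b show "x = y" by simp
  qed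
  show "dist x y \<le> dist x z + dist y z"
  proof (rule field_le_epsilon)
    fix e :: real
    assume "0 < e"
    have sym: "dist y z = dist z y"
      by (rule dist_torus_sym)
    obtain a' where a': "abs_torus a' = x" "dist c a' < dist z x + e/2"
      using dist_torus_lessD[of c x "dist z x + e/2"] c \<open>0 < e\<close> by auto
    obtain b' where b': "abs_torus b' = y" "dist c b' < dist z y + e/2"
      using dist_torus_lessD[of c y "dist z y + e/2"] c \<open>0 < e\<close> by auto
    have sym': "dist x z = dist z x"
      by (rule dist_torus_sym)
    have "dist x y \<le> dist a' b'"
      using dist_torus_le[of a' b'] a' b' by simp
    also have "\<dots> \<le> dist c a' + dist c b'"
      using dist_triangle[of a' b' c] by (simp add: dist_commute)
    finally show "dist x y \<le> dist x z + dist y z + e"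
      using a' b' sym sym' by linarith
  qed
qed (simp_all add: uniformity_torus_def open_torus_def)

end

section \<open>Linear automorphisms of the torus\<close>

definition linear_part :: "int^'n^'n \<Rightarrow> real^'n \<Rightarrow> real^'n" where
  "linear_part M v = map_matrix of_int M *v v"

lemma int_vec_linear_part: "int_vec z \<Longrightarrow> int_vec (linear_part M z)"
  by (auto simp: int_vec_def linear_part_def matrix_vector_mult_def intro!: Ints_sum Ints_mult)

lift_definition toral_map :: "int^'n^'n \<Rightarrow> 'n::finite torus \<Rightarrow> 'n torus" is linear_part
proof -
  fix M :: "int^'n^'n" and a b :: "real^'n"
  assume "torus_rel a b"
  then have "int_vec (linear_part M (a - b))"
    unfolding torus_rel_def by (rule int_vec_linear_part)
  then show "torus_rel (linear_part M a) (linear_part M b)"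
    by (simp add: torus_rel_def linear_part_def matrix_vector_mult_diff_distrib)
qed

text \<open>
  The linear automorphisms of the torus are the maps \<^term>\<open>toral_map M\<close> with \<^term>\<open>M\<close> invertible
  over the integers.
\<close>

definition hyperbolic_automorphism :: "int^'n^'n \<Rightarrow> bool" where
  "hyperbolic_automorphism M \<longleftrightarrow> invertible M \<and>
    (\<forall>(c::complex) v. v \<noteq> 0 \<and> map_matrix of_int M *v v = c *s v \<longrightarrow> cmod c \<noteq> 1)"

section \<open>Invariant measures and entropy\<close>

definition invariant_measure :: "('a \<Rightarrow> 'a) \<Rightarrow> 'a measure \<Rightarrow> bool" where
  "invariant_measure f M \<longleftrightarrow> f \<in> measurable M M \<and> distr M M f = M"

definition ergodic_prob :: "('a \<Rightarrow> 'a) \<Rightarrow> 'a measure \<Rightarrow> bool" where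
  "ergodic_prob f M \<longleftrightarrow> prob_space M \<and> invariant_measure f M \<and>
    (\<forall>E\<in>sets M. f -` E \<inter> space M = E \<longrightarrow> measure M E = 0 \<or> measure M E = 1)"

text \<open>
  A finite measurable partition is given by a simple function \<open>p\<close>, its elements being the level
  sets of \<open>p\<close>; the common refinement of the first \<open>n\<close> preimages of \<open>p\<close> under \<open>f\<close> is then given by
  the itinerary map. Every finite partition can be labelled by natural numbers.
\<close>

definition partition_entropy :: "'a measure \<Rightarrow> ('a \<Rightarrow> 'b) \<Rightarrow> real" where
  "partition_entropy M p = prob_space.entropy M (exp 1) (count_space (p ` space M)) p"

definition itinerary :: "('a \<Rightarrow> 'a) \<Rightarrow> ('a \<Rightarrow> 'b) \<Rightarrow> nat \<Rightarrow> 'a \<Rightarrow> 'b list" where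
  "itinerary f p n x = map (\<lambda>i. p ((f ^^ i) x)) [0..<n]"

definition entropy_wrt_partition :: "('a \<Rightarrow> 'a) \<Rightarrow> 'a measure \<Rightarrow> ('a \<Rightarrow> 'b) \<Rightarrow> real" where
  "entropy_wrt_partition f M p = lim (\<lambda>n. partition_entropy M (itinerary f p n) / real n)"

definition ks_entropy :: "('a \<Rightarrow> 'a) \<Rightarrow> 'a measure \<Rightarrow> ereal" where
  "ks_entropy f M =
    (SUP p\<in>{p :: 'a \<Rightarrow> nat. simple_function M p}. ereal (entropy_wrt_partition f M p))"

section \<open>Lyapunov exponents\<close>

text \<open>
  For a map \<open>f\<close> with derivative \<open>D x\<close> at \<open>x\<close>, the chain rule gives \<^term>\<open>deriv_cocycle f D n x\<close>
  as the derivative of the \<open>n\<close>-th iterate at \<open>x\<close>. The exponents with respect to \<open>M\<close> are the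
  exponential growth rates of tangent vectors realised at almost every point. For the hyperbolic
  product automorphisms below they form a finite set containing positive and negative elements, so
  the minimum and the maximum exist.
\<close>

primrec deriv_cocycle :: "('a \<Rightarrow> 'a) \<Rightarrow> ('a \<Rightarrow> 'v \<Rightarrow> 'v) \<Rightarrow> nat \<Rightarrow> 'a \<Rightarrow> 'v \<Rightarrow> 'v" where
  "deriv_cocycle f D 0 x v = v"
| "deriv_cocycle f D (Suc n) x v = D ((f ^^ n) x) (deriv_cocycle f D n x v)"

definition lyapunov_exponents ::
  "('a \<Rightarrow> 'a) \<Rightarrow> ('a \<Rightarrow> 'v \<Rightarrow> 'v::real_normed_vector) \<Rightarrow> 'a measure \<Rightarrow> real set" where
  "lyapunov_exponents f D M =
    {l. AE x in M. \<exists>v. v \<noteq> 0 \<and>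
      (\<lambda>n. ln (norm (deriv_cocycle f D n x v)) / real n) \<longlonglongrightarrow> l}"

definition smallest_pos_exponent ::
  "('a \<Rightarrow> 'a) \<Rightarrow> ('a \<Rightarrow> 'v \<Rightarrow> 'v::real_normed_vector) \<Rightarrow> 'a measure \<Rightarrow> real" where
  "smallest_pos_exponent f D M = Min {l \<in> lyapunov_exponents f D M. l > 0}"

definition largest_neg_exponent ::
  "('a \<Rightarrow> 'a) \<Rightarrow> ('a \<Rightarrow> 'v \<Rightarrow> 'v::real_normed_vector) \<Rightarrow> 'a measure \<Rightarrow> real" where
  "largest_neg_exponent f D M = Max {l \<in> lyapunov_exponents f D M. l < 0}"

section \<open>Return times\<close>

text \<open>
  For an automorphism of the torus and a ball of positive radius the set of return times is nonempty
  (Lebesgue measure is invariant), so the minimum is never degenerate.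
\<close>

definition return_time :: "('a \<Rightarrow> 'a) \<Rightarrow> 'a set \<Rightarrow> nat" where
  "return_time f E = (LEAST k. k > 0 \<and> (f ^^ k) ` E \<inter> E \<noteq> {})"

section \<open>Products\<close>

text \<open>
  The four-dimensional torus is the product type \<open>2 torus \<times> 2 torus\<close>; the library's product metric
  is Euclidean, so it is again the flat metric. The derivative of a product of two linear
  automorphisms is, at every point, the product of their linear parts.
\<close>

definition product_map :: "int^2^2 \<Rightarrow> int^2^2 \<Rightarrow> 2 torus \<times> 2 torus \<Rightarrow> 2 torus \<times> 2 torus" where
  "product_map M1 M2 = map_prod (toral_map M1) (toral_map M2)"

definition product_deriv ::
  "int^2^2 \<Rightarrow> int^2^2 \<Rightarrow> 2 torus \<times> 2 torus \<Rightarrow> (real^2) \<times> (real^2) \<Rightarrow> (real^2) \<times> (real^2)" where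
  "product_deriv M1 M2 x = map_prod (linear_part M1) (linear_part M2)"

end

theory Submission
  imports Defs "HOL-Real_Asymp.Real_Asymp"
begin

text \<open>
  Each factor \<open>A\<^sub>i\<close> has an eigenvalue \<open>a\<^sub>i\<close> of modulus greater than 1 and one of modulus
  \<open>1 / \<bar>a\<^sub>i\<bar>\<close>, so the exponents are \<open>\<plusminus>ln \<bar>a\<^sub>i\<bar>\<close> and the limit in question is \<open>2 / L\<close> with
  \<open>L = min (ln \<bar>a\<^sub>1\<bar>) (ln \<bar>a\<^sub>2\<bar>)\<close>.

  The upper bound holds at every point. The image of a ball of radius \<open>r\<close> of a factor under \<open>k\<close>
  steps contains a segment of length about \<open>r \<bar>a\<bar> ^ k\<close> in the expanding direction, and its image
  under \<open>l \<ge> k\<close> backward steps contains one of at least this length in the contracting direction.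
  As soon as these lengths exceed a constant, the segments meet in the torus, and
  \<open>n = k + l\<close> is a return time of the ball. All \<open>n \<ge> 2 * k\<close> are thus return times in both
  factors (lemma \<open>ball_returns\<close>), and hence there is a common one near \<open>2 * (- ln r) / L\<close>.

  The lower bound holds almost everywhere and already in a single factor. If \<open>y\<close> and \<open>A\<^sup>n y\<close> both lie
  in the ball of radius \<open>r\<close> around \<open>x\<close>, then \<open>A\<^sup>-\<^sup>i x\<close> and \<open>A\<^sup>n\<^sup>-\<^sup>i x\<close> have a distance of at most a
  constant times \<open>r \<bar>a\<bar> ^ max i (n - i)\<close>. If \<open>r\<close> is much smaller than \<open>\<bar>a\<bar> powr (- n / 2 - n / q)\<close>,
  the orbit of \<open>x\<close> therefore nearly repeats itself with lag \<open>n\<close> during a window of length \<open>n / q\<close>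
  that ends near the time \<open>- n / 2\<close>. Positive entropy forbids this for all large \<open>n\<close>, for almost every \<open>x\<close>
  (lemma \<open>close_windows_rare\<close>); letting \<open>q\<close> tend to infinity gives \<open>2 / L\<close>.

  Why positive entropy forbids it: take a partition \<open>p\<close> of positive entropy. Its label cannot be a
  function of the labels at later times, so the set of points whose label had conditional probability
  at most \<open>1 / 2\<close> given the later labels has positive measure \<open>d\<close> (lemmas
  \<open>predictable_of_not_surprising\<close> and \<open>zero_entropy_of_predictable\<close>). By Birkhoff's theorem almost
  every orbit meets this set in the window with a frequency close to \<open>d\<close>. A gambler who runs through the window in
  the direction of decreasing time and bets each time that the label equals the label \<open>n\<close> steps later
  doubles his capital whenever he wins at such a point, and the expectation of his capital grows
  at most at a small exponential rate (lemma \<open>integral_total_gain_le\<close>). So the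
  labels agree with those \<open>n\<close> steps later at almost all times of the window only with exponentially
  small probability, and the Borel-Cantelli lemma applies. Nearness of points entails equality of
  labels off a set of small measure, since every measurable partition of a metric space is locally
  constant on a set of nearly full measure (lemma \<open>almost_locally_constant\<close>).
\<close>

section \<open>Measure-preserving and ergodic maps\<close>

locale measure_preserving = prob_space M for M :: "'a measure" +
  fixes T :: "'a \<Rightarrow> 'a"
  assumes T_meas [measurable]: "T \<in> measurable M M"
    and T_inv: "distr M M T = M"
begin

lemma funpow_T [measurable]: "(T ^^ n) \<in> measurable M M"
  by (induction n) auto

lemma integral_T:
  fixes f :: "'a \<Rightarrow> real"
  assumes "f \<in> borel_measurable M"
  shows "(\<integral>x. f (T x) \<partial>M) = (\<integral>x. f x \<partial>M)"
proof -
  have "(\<integral>x. f x \<partial>M) = (\<integral>x. f x \<partial>distr M M T)"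
    by (simp add: T_inv)
  also have "\<dots> = (\<integral>x. f (T x) \<partial>M)"
    by (rule integral_distr) (use assms in auto)
  finally show ?thesis by simp
qed

lemma integrable_bounded:
  fixes f :: "'a \<Rightarrow> real"
  assumes "f \<in> borel_measurable M" "\<And>x. \<bar>f x\<bar> \<le> B"
  shows "integrable M f"
  by (rule integrable_const_bound[where B = B]) (use assms in auto)

lemma T_space: "x \<in> space M \<Longrightarrow> T x \<in> space M"
  using measurable_space[OF T_meas] .

text \<open>
  The maximum of the ergodic sums of length at most \<open>N\<close>, the empty sum included. This recursion
  makes the maximal ergodic inequality a one-line computation.
\<close>
fun max_sum :: "('a \<Rightarrow> real) \<Rightarrow> nat \<Rightarrow> 'a \<Rightarrow> real" where
  "max_sum g 0 x = 0"
| "max_sum g (Suc N) x = max 0 (g x + max_sum g N (T x))"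

lemma max_sum_measurable [measurable]:
  assumes [measurable]: "g \<in> borel_measurable M"
  shows "max_sum g N \<in> borel_measurable M"
  by (induction N) (simp_all cong: measurable_cong)

lemma max_sum_nonneg: "max_sum g N x \<ge> 0"
  by (cases N) auto

lemma max_sum_le:
  assumes "\<And>x. \<bar>g x\<bar> \<le> B" shows "max_sum g N x \<le> real N * B"
proof (induction N arbitrary: x)
  case (Suc N)
  have "B \<ge> 0" using assms[of x] by linarith
  then show ?case
    using Suc[of "T x"] assms[of x] max_sum_nonneg[of g N] by (auto simp: algebra_simps)
qed simp

lemma max_sum_mono: "max_sum g N x \<le> max_sum g (Suc N) x"
proof (induction N arbitrary: x)
  case (Suc N)
  have "max 0 (g x + max_sum g N (T x)) \<le> max 0 (g x + max_sum g (Suc N) (T x))"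
    using Suc[of "T x"] by linarith
  then show ?case by (simp only: max_sum.simps(2))
qed simp

lemma sum_le_max_sum: "k \<le> N \<Longrightarrow> (\<Sum>i<k. g ((T ^^ i) x)) \<le> max_sum g N x"
proof (induction N arbitrary: k x)
  case (Suc N)
  show ?case
  proof (cases k)
    case (Suc k')
    have "(\<Sum>i<k. g ((T ^^ i) x)) = g x + (\<Sum>i<k'. g ((T ^^ i) (T x)))"
      unfolding Suc by (subst sum.lessThan_Suc_shift) (simp add: funpow_Suc_right del: funpow.simps)
    also have "\<dots> \<le> g x + max_sum g N (T x)"
      using Suc.IH[of k' "T x"] Suc Suc.prems by simp
    finally show ?thesis by simp
  qed (simp add: max_sum_nonneg del: max_sum.simps)
qed simp

text \<open>
  A form of the maximal ergodic theorem. The difference of \<open>max_sum g (Suc N)\<close> and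
  \<open>max_sum g N \<circ> T\<close> has a nonnegative integral, because \<open>max_sum\<close> increases with \<open>N\<close> and \<open>T\<close> preserves
  the measure. This difference equals \<open>max (- max_sum g N (T x)) (g x)\<close>, which is \<open>g x\<close> for large \<open>N\<close>
  when the sums along the orbit of \<open>T x\<close> are unbounded above.
\<close>
lemma integral_nonneg_of_unbounded_sums:
  assumes g [measurable]: "g \<in> borel_measurable M" and B: "\<And>x. \<bar>g x\<bar> \<le> B"
    and unb: "AE x in M. \<forall>b::nat. \<exists>n. (\<Sum>i<n. g ((T ^^ i) x)) > real b"
  shows "(\<integral>x. g x \<partial>M) \<ge> 0"
proof -
  let ?d = "\<lambda>N x. max_sum g (Suc N) x - max_sum g N (T x)"
  have d: "?d N x = max (- max_sum g N (T x)) (g x)" for N x by simp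
  have int [simp]: "integrable M (max_sum g N)" for N
    by (rule integrable_bounded[of _ "real N * B"])
      (use max_sum_le[of g B N] max_sum_nonneg[of g N] B in \<open>auto simp: abs_of_nonneg\<close>)
  have intT: "integrable M (\<lambda>x. max_sum g N (T x))" for N
    by (rule integrable_bounded[of _ "real N * B"])
      (use max_sum_le[of g B N] max_sum_nonneg[of g N] B in \<open>auto simp: abs_of_nonneg\<close>)
  have nonneg: "(\<integral>x. ?d N x \<partial>M) \<ge> 0" for N
  proof -
    have "(\<integral>x. ?d N x \<partial>M) = (\<integral>x. max_sum g (Suc N) x \<partial>M) - (\<integral>x. max_sum g N (T x) \<partial>M)"
      using int intT by (rule Bochner_Integration.integral_diff)
    also have "\<dots> = (\<integral>x. max_sum g (Suc N) x \<partial>M) - (\<integral>x. max_sum g N x \<partial>M)"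
      by (simp add: integral_T del: max_sum.simps)
    also have "\<dots> \<ge> 0"
      using integral_mono[OF int int, of N "Suc N"] max_sum_mono[of g N] by (simp del: max_sum.simps)
    finally show ?thesis .
  qed
  have unbT: "AE x in M. \<forall>b::nat. \<exists>n. (\<Sum>i<n. g ((T ^^ i) (T x))) > real b"
  proof -
    have "AE x in distr M M T. \<forall>b::nat. \<exists>n. (\<Sum>i<n. g ((T ^^ i) x)) > real b"
      unfolding T_inv by (rule unb)
    then show ?thesis by (subst (asm) AE_distr_iff) auto
  qed
  have "(\<lambda>N. \<integral>x. ?d N x \<partial>M) \<longlonglongrightarrow> (\<integral>x. g x \<partial>M)"
  proof (rule integral_dominated_convergence[where w = "\<lambda>x. B"])
    show "AE x in M. (\<lambda>N. ?d N x) \<longlonglongrightarrow> g x"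
      using unbT
    proof eventually_elim
      case (elim x)
      obtain b :: nat where b: "real b \<ge> B" using real_arch_simple by blast
      from elim obtain n where n: "(\<Sum>i<n. g ((T ^^ i) (T x))) > real b" by blast
      have "?d N x = g x" if "N \<ge> n" for N
        using sum_le_max_sum[OF that, of g "T x"] n b B[of x] unfolding d by auto
      then show ?case
        by (intro tendsto_eventually) (auto simp: eventually_sequentially simp del: max_sum.simps)
    qed
    show "AE x in M. norm (?d N x) \<le> B" for N
    proof (rule AE_I2)
      fix x show "norm (?d N x) \<le> B"
        using B[of x] max_sum_nonneg[of g N "T x"] unfolding d by auto
    qed
  qed (auto simp del: max_sum.simps)
  then show ?thesis
    using nonneg by (meson LIMSEQ_le_const)
qed

end

locale ergodic_map = measure_preserving +
  assumes ergodic: "E \<in> sets M \<Longrightarrow> T -` E \<inter> space M = E \<Longrightarrow> measure M E = 0 \<or> measure M E = 1"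
begin

text \<open>
  The points at which the ergodic sums of \<open>f - c\<close> are unbounded above form a strictly invariant set.
  If it had measure 1, the integral of \<open>f - c\<close> would be nonnegative.
\<close>
lemma birkhoff_upper:
  fixes f :: "'a \<Rightarrow> real"
  assumes f [measurable]: "f \<in> borel_measurable M" and B: "\<And>x. \<bar>f x\<bar> \<le> B"
    and c: "c > (\<integral>x. f x \<partial>M)"
  shows "AE x in M. \<exists>b. \<forall>n. (\<Sum>i<n. f ((T ^^ i) x)) \<le> c * real n + b"
proof -
  let ?g = "\<lambda>x. f x - c"
  let ?P = "\<lambda>x. \<forall>b::nat. \<exists>n. (\<Sum>i<n. ?g ((T ^^ i) x)) > real b"
  define E where "E = {x \<in> space M. ?P x}"
  have E [measurable]: "E \<in> sets M" unfolding E_def by measurable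
  have step: "(\<Sum>i<Suc n. ?g ((T ^^ i) x)) = ?g x + (\<Sum>i<n. ?g ((T ^^ i) (T x)))" for n :: nat and x
    by (subst sum.lessThan_Suc_shift) (simp add: funpow_Suc_right del: funpow.simps)
  have "?P x \<longleftrightarrow> ?P (T x)" for x
  proof
    assume P: "?P x"
    show "?P (T x)"
    proof
      fix b :: nat
      obtain b' :: nat where b': "real b' > real b + \<bar>?g x\<bar>" using reals_Archimedean2 by blast
      obtain n where n: "(\<Sum>i<n. ?g ((T ^^ i) x)) > real b'" using P by blast
      then obtain n' where "n = Suc n'" using b' by (cases n) auto
      with n b' step[of x n'] show "\<exists>n. (\<Sum>i<n. ?g ((T ^^ i) (T x))) > real b"
        by (intro exI[of _ n']) auto
    qed
  next
    assume P: "?P (T x)"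
    show "?P x"
    proof
      fix b :: nat
      obtain b' :: nat where b': "real b' > real b + \<bar>?g x\<bar>" using reals_Archimedean2 by blast
      obtain n where n: "(\<Sum>i<n. ?g ((T ^^ i) (T x))) > real b'" using P by blast
      with b' step[of x n] show "\<exists>n. (\<Sum>i<n. ?g ((T ^^ i) x)) > real b"
        by (intro exI[of _ "Suc n"]) auto
    qed
  qed
  then have "T -` E \<inter> space M = E" using T_space by (auto simp: E_def)
  then have "measure M E = 0 \<or> measure M E = 1" by (rule ergodic[OF E])
  moreover have "measure M E \<noteq> 1"
  proof
    assume "measure M E = 1"
    then have "AE x in M. x \<in> E" by (simp add: prob_eq_1)
    then have "AE x in M. ?P x" by (auto simp: E_def elim: eventually_mono)
    then have "(\<integral>x. ?g x \<partial>M) \<ge> 0"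
    proof (rule integral_nonneg_of_unbounded_sums[rotated 2])
      show "\<bar>?g x\<bar> \<le> B + \<bar>c\<bar>" for x using B[of x] by linarith
    qed auto
    moreover have "integrable M f" by (rule integrable_bounded[OF f B])
    then have "(\<integral>x. ?g x \<partial>M) = (\<integral>x. f x \<partial>M) - c"
      by (simp add: prob_space)
    ultimately show False using c by simp
  qed
  ultimately have "AE x in M. x \<notin> E" by (simp add: prob_eq_0)
  then show ?thesis
  proof (rule AE_mp, intro AE_I2 impI)
    fix x assume "x \<in> space M" "x \<notin> E"
    then obtain b :: nat where b: "\<And>n. (\<Sum>i<n. ?g ((T ^^ i) x)) \<le> real b"
      by (auto simp: E_def not_less)
    have "(\<Sum>i<n. f ((T ^^ i) x)) \<le> c * real n + real b" for n
      using b[of n] by (simp add: sum_subtractf mult.commute)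
    then show "\<exists>b. \<forall>n. (\<Sum>i<n. f ((T ^^ i) x)) \<le> c * real n + b" by blast
  qed
qed

lemma birkhoff:
  fixes f :: "'a \<Rightarrow> real"
  assumes f [measurable]: "f \<in> borel_measurable M" and B: "\<And>x. \<bar>f x\<bar> \<le> B" and e: "e > 0"
  shows "AE x in M. \<exists>b. \<forall>n. \<bar>(\<Sum>i<n. f ((T ^^ i) x)) - (\<integral>x. f x \<partial>M) * real n\<bar> \<le> e * real n + b"
proof -
  let ?I = "\<integral>x. f x \<partial>M"
  have "AE x in M. \<exists>b. \<forall>n. (\<Sum>i<n. f ((T ^^ i) x)) \<le> (?I + e) * real n + b"
    by (rule birkhoff_upper[OF f B]) (use e in auto)
  moreover have "AE x in M. \<exists>b. \<forall>n. (\<Sum>i<n. - f ((T ^^ i) x)) \<le> (- ?I + e) * real n + b"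
    by (rule birkhoff_upper[of "\<lambda>x. - f x" B]) (use e B in auto)
  ultimately show ?thesis
  proof eventually_elim
    case (elim x)
    then obtain b b' where 1: "\<And>n. (\<Sum>i<n. f ((T ^^ i) x)) \<le> (?I + e) * real n + b"
      and 2: "\<And>n. (\<Sum>i<n. - f ((T ^^ i) x)) \<le> (- ?I + e) * real n + b'" by blast
    have "\<bar>(\<Sum>i<n. f ((T ^^ i) x)) - ?I * real n\<bar> \<le> e * real n + max b b'" for n
      using 1[of n] 2[of n] by (auto simp: sum_negf algebra_simps abs_le_iff)
    then show ?case by blast
  qed
qed

text \<open>
  Bounding the error of the ergodic sums by a small multiple of \<open>n\<close>, up to a constant, makes the
  count uniform over all windows of length \<open>n div q\<close> before the time \<open>n\<close>, wherever they start.
\<close>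
lemma visits_in_window:
  assumes D [measurable]: "D \<in> sets M" and q: "q > 0" and e: "e > 0"
  shows "AE x in M. \<forall>\<^sub>F n in sequentially. \<forall>s. s + n div q \<le> n \<longrightarrow>
    \<bar>real (card {i \<in> {s..<s + n div q}. (T ^^ i) x \<in> D}) - measure M D * real (n div q)\<bar>
      \<le> e * real (n div q)"
proof -
  let ?f = "indicator D :: 'a \<Rightarrow> real"
  let ?d = "measure M D"
  \<comment> \<open>The sums up to both ends of the window contribute errors of at most \<open>\<eta> n\<close>, and the window
    has length about \<open>n / q\<close>; half of the tolerance \<open>e n / q\<close> is left for the constant.\<close>
  define \<eta> where "\<eta> = e / (4 * real q)"
  have \<eta>: "\<eta> > 0" using q e by (simp add: \<eta>_def)
  have "AE x in M. \<exists>b. \<forall>n. \<bar>(\<Sum>i<n. ?f ((T ^^ i) x)) - (\<integral>x. ?f x \<partial>M) * real n\<bar> \<le> \<eta> * real n + b"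
    by (rule birkhoff[where B = 1]) (auto simp: \<eta> indicator_def)
  then show ?thesis
  proof (rule AE_mp, intro AE_I2 impI)
    fix x assume x: "x \<in> space M"
      and "\<exists>b. \<forall>n. \<bar>(\<Sum>i<n. ?f ((T ^^ i) x)) - (\<integral>x. ?f x \<partial>M) * real n\<bar> \<le> \<eta> * real n + b"
    then obtain b where b: "\<And>n. \<bar>(\<Sum>i<n. ?f ((T ^^ i) x)) - ?d * real n\<bar> \<le> \<eta> * real n + b"
      by auto
    have "\<forall>\<^sub>F n in sequentially. real n \<ge> 2 * real q * (2 * b + e) / e"
      using filterlim_real_sequentially unfolding filterlim_at_top by blast
    then show "\<forall>\<^sub>F n in sequentially. \<forall>s. s + n div q \<le> n \<longrightarrow>
      \<bar>real (card {i \<in> {s..<s + n div q}. (T ^^ i) x \<in> D}) - ?d * real (n div q)\<bar> \<le> e * real (n div q)"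
    proof eventually_elim
      case (elim n)
      show ?case
      proof (intro allI impI)
        fix s assume s: "s + n div q \<le> n"
        let ?m = "n div q" and ?S = "\<lambda>k. \<Sum>i<k. ?f ((T ^^ i) x)"
        have "real (card {i \<in> {s..<s + ?m}. (T ^^ i) x \<in> D}) = (\<Sum>i\<in>{s..<s + ?m}. ?f ((T ^^ i) x))"
          by (simp add: indicator_def sum.If_cases Int_def)
        also have "\<dots> = ?S (s + ?m) - ?S s"
          by (simp add: sum_diff_nat_ivl lessThan_atLeast0)
        finally have card: "real (card {i \<in> {s..<s + ?m}. (T ^^ i) x \<in> D}) = ?S (s + ?m) - ?S s" .
        have m: "real n / real q \<le> real ?m + 1"
        proof -
          have "real n = real q * real ?m + real (n mod q)"
            by (metis mult_div_mod_eq of_nat_add of_nat_mult)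
          moreover have "real (n mod q) \<le> real q" using q by simp
          ultimately show ?thesis using q by (simp add: field_simps)
        qed
        have "\<eta> * real (s + ?m) \<le> \<eta> * real n" "\<eta> * real s \<le> \<eta> * real n"
          using s \<eta> by (auto intro!: mult_left_mono)
        with b[of "s + ?m"] b[of s] have "\<bar>?S (s + ?m) - ?S s - ?d * real ?m\<bar> \<le> 2 * \<eta> * real n + 2 * b"
          by (auto simp: algebra_simps abs_le_iff)
        also have "\<dots> \<le> e * (real n / real q - 1)"
        proof -
          have "2 * b + e \<le> e * real n / (2 * real q)"
            using elim e q by (simp add: field_simps)
          moreover have "2 * \<eta> * real n = e * real n / (2 * real q)"
            by (simp add: \<eta>_def)
          moreover have "e * (real n / real q - 1) = 2 * (e * real n / (2 * real q)) - e"
            by (simp add: right_diff_distrib)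
          ultimately show ?thesis by linarith
        qed
        also have "\<dots> \<le> e * real ?m"
          using m e by (intro mult_left_mono) auto
        finally show "\<bar>real (card {i \<in> {s..<s + ?m}. (T ^^ i) x \<in> D}) - ?d * real ?m\<bar> \<le> e * real ?m"
          unfolding card .
      qed
    qed
  qed
qed

end

section \<open>Measurable partitions of metric spaces\<close>

text \<open>
  A weak form of Lusin's theorem, which holds for all Borel sets because the sets with this property
  form a sigma-algebra that contains the open sets: from an open set one discards the thin shell
  of points near its complement, and from a countable union the part outside a long finite union.
\<close>
lemma almost_locally_constant_set:
  fixes M :: "'a::metric_space measure"
  assumes M: "prob_space M" and sets_M: "sets M = sets borel" and A: "A \<in> sets borel" and d: "d > 0"
  shows "\<exists>K \<rho>. K \<in> sets M \<and> measure M (- K) < d \<and> \<rho> > 0 \<and>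
    (\<forall>x\<in>K. \<forall>y\<in>K. dist x y < \<rho> \<longrightarrow> (x \<in> A \<longleftrightarrow> y \<in> A))"
proof -
  interpret prob_space M by (rule M)
  have space [simp]: "space M = UNIV" using sets_eq_imp_space_eq[OF sets_M] by simp
  have "A \<in> sigma_sets UNIV {S. open S}" using A by (simp add: borel_def)
  then show ?thesis using d
  proof (induction arbitrary: d rule: sigma_sets.induct)
    case (Basic U)
    then have U: "open U" by simp
    let ?C = "\<lambda>n::nat. {x \<in> U. infdist x (- U) < 1 / real (Suc n)}"
    show ?case
    proof (cases "U = UNIV")
      case True
      then show ?thesis using Basic sets.top[of M] by (intro exI[of _ UNIV] exI[of _ 1]) auto
    next
      case False
      have C: "?C n \<in> sets M" for n
      proof -
        have "open (U \<inter> {x. infdist x (- U) < 1 / real (Suc n)})"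
          by (intro open_Int U open_Collect_less continuous_intros)
        moreover have "U \<inter> {x. infdist x (- U) < 1 / real (Suc n)} = ?C n" by auto
        ultimately show ?thesis by (simp add: sets_M)
      qed
      have "(\<lambda>n. measure M (?C n)) \<longlonglongrightarrow> measure M (\<Inter>n. ?C n)"
      proof (rule finite_Lim_measure_decseq)
        show "range ?C \<subseteq> sets M" using C by auto
        show "decseq ?C"
          by (auto simp: decseq_def elim!: order.strict_trans2 intro!: divide_left_mono)
      qed
      moreover have "(\<Inter>n. ?C n) = {}"
      proof -
        have "x \<notin> (\<Inter>n. ?C n)" for x
        proof
          assume x: "x \<in> (\<Inter>n. ?C n)"
          then have "x \<notin> - U" by auto
          then have "infdist x (- U) > 0"
            using U False infdist_pos_not_in_closed[of "- U" x] by auto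
          then obtain n where "1 / real (Suc n) < infdist x (- U)"
            using nat_approx_posE by (metis)
          with x show False by (auto dest!: spec[of _ n])
        qed
        then show ?thesis by blast
      qed
      ultimately have "(\<lambda>n. measure M (?C n)) \<longlonglongrightarrow> 0" by simp
      then obtain n where n: "measure M (?C n) < d"
        using \<open>d > 0\<close> by (metis (lifting) order_tendstoD(2) eventually_sequentially order_refl)
      show ?thesis
      proof (intro exI[of _ "- ?C n"] exI[of _ "1 / real (Suc n)"] conjI ballI impI)
        show "- ?C n \<in> sets M" using sets.compl_sets[OF C[of n]] by (simp add: Compl_eq_Diff_UNIV)
        fix x y assume xy: "x \<in> - ?C n" "y \<in> - ?C n" and dist: "dist x y < 1 / real (Suc n)"
        have stay: "b \<in> U" if "a \<in> U" "a \<in> - ?C n" "dist a b < 1 / real (Suc n)" for a b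
        proof (rule ccontr)
          assume "b \<notin> U"
          then have "infdist a (- U) \<le> dist a b" by (intro infdist_le) simp
          with that show False by simp
        qed
        have "dist y x < 1 / real (Suc n)" using dist by (simp only: dist_commute)
        then show "x \<in> U \<longleftrightarrow> y \<in> U"
          using stay[of x y] stay[of y x] xy dist by blast
      qed (use n in auto)
    qed
  next
    case Empty
    then show ?case using sets.top[of M] by (intro exI[of _ UNIV] exI[of _ 1]) auto
  next
    case (Compl A)
    from Compl.IH[OF Compl.prems] show ?case by (simp add: Compl_eq_Diff_UNIV[symmetric])
  next
    case (Union A)
    have meas [measurable]: "A i \<in> sets M" for i
      using Union.hyps by (simp add: sets_M borel_def)
    have "(\<lambda>n. measure M ((\<Union>i. A i) - (\<Union>i<n. A i))) \<longlonglongrightarrow> measure M (\<Inter>n. (\<Union>i. A i) - (\<Union>i<n. A i))"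
      by (rule finite_Lim_measure_decseq) (auto simp: decseq_def)
    moreover have "(\<Inter>n. (\<Union>i. A i) - (\<Union>i<n. A i)) = {}" by (auto intro: lessI)
    ultimately have "(\<lambda>n. measure M ((\<Union>i. A i) - (\<Union>i<n. A i))) \<longlonglongrightarrow> 0"
      by (simp only: measure_empty)
    then obtain n where n: "measure M ((\<Union>i. A i) - (\<Union>i<n. A i)) < d / 2"
      using \<open>d > 0\<close> by (metis (lifting) order_tendstoD(2) eventually_sequentially order_refl half_gt_zero)
    have "d / (2 * real (Suc n)) > 0" using \<open>d > 0\<close> by simp
    then have "\<forall>i. \<exists>K \<rho>. K \<in> sets M \<and> measure M (- K) < d / (2 * real (Suc n)) \<and> \<rho> > 0 \<and>
        (\<forall>x\<in>K. \<forall>y\<in>K. dist x y < \<rho> \<longrightarrow> (x \<in> A i \<longleftrightarrow> y \<in> A i))"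
      using Union.IH by blast
    then obtain K \<rho> where K [measurable]: "\<And>i. K i \<in> sets M"
      and mK: "\<And>i. measure M (- K i) < d / (2 * real (Suc n))" and \<rho>: "\<And>i. \<rho> i > 0"
      and const: "\<And>i x y. x \<in> K i \<Longrightarrow> y \<in> K i \<Longrightarrow> dist x y < \<rho> i \<Longrightarrow> x \<in> A i \<longleftrightarrow> y \<in> A i"
      by metis
    let ?R = "(\<Union>i. A i) - (\<Union>i<n. A i)"
    have cK [measurable]: "- K i \<in> sets M" for i
      using sets.compl_sets[OF K[of i]] by (simp add: Compl_eq_Diff_UNIV)
    let ?K = "- (?R \<union> (\<Union>i<n. - K i))"
    have "?R \<union> (\<Union>i<n. - K i) \<in> sets M" by measurable
    then have K': "?K \<in> sets M"
      using sets.compl_sets[of "?R \<union> (\<Union>i<n. - K i)" M] by (simp only: space Compl_eq_Diff_UNIV)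
    have "measure M (- ?K) \<le> measure M ?R + measure M (\<Union>i<n. - K i)"
      unfolding double_compl by (rule measure_Un_le) auto
    also have "measure M (\<Union>i<n. - K i) \<le> (\<Sum>i<n. measure M (- K i))"
      by (rule finite_measure_subadditive_finite) auto
    also have "\<dots> \<le> (\<Sum>i<n. d / (2 * real (Suc n)))"
      by (intro sum_mono less_imp_le mK)
    also have "\<dots> \<le> d / 2" using \<open>d > 0\<close> by (simp add: field_simps)
    finally have mK': "measure M (- ?K) < d" using n by simp
    obtain r where r: "r > 0" "\<And>i. i < n \<Longrightarrow> r \<le> \<rho> i"
    proof
      show "Min (insert 1 (\<rho> ` {..<n})) > 0" using \<rho> by (subst Min_gr_iff) auto
      show "Min (insert 1 (\<rho> ` {..<n})) \<le> \<rho> i" if "i < n" for i using that by (intro Min_le) auto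
    qed
    have "x \<in> (\<Union>i. A i) \<longleftrightarrow> y \<in> (\<Union>i. A i)" if "x \<in> ?K" "y \<in> ?K" "dist x y < r" for x y
    proof -
      have *: "z \<in> (\<Union>i. A i) \<longleftrightarrow> (\<exists>i<n. z \<in> A i)" if "z \<in> ?K" for z
        using that by blast
      moreover have "x \<in> A i \<longleftrightarrow> y \<in> A i" if "i < n" for i
      proof (rule const)
        show "x \<in> K i" "y \<in> K i" using that \<open>x \<in> ?K\<close> \<open>y \<in> ?K\<close> by blast+
        show "dist x y < \<rho> i" using \<open>dist x y < r\<close> r(2)[OF that] by linarith
      qed
      ultimately show ?thesis
        unfolding *[OF \<open>x \<in> ?K\<close>] *[OF \<open>y \<in> ?K\<close>] by blast
    qed
    then show ?case
      by (intro exI[of _ ?K] exI[of _ r] conjI ballI impI K' mK' r(1))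
  qed
qed

lemma almost_locally_constant:
  fixes M :: "'a::metric_space measure" and p :: "'a \<Rightarrow> nat"
  assumes M: "prob_space M" and sets_M: "sets M = sets borel" and p: "simple_function M p" and d: "d > 0"
  obtains K \<rho> where "K \<in> sets M" "measure M (- K) < d" "\<rho> > 0"
    "\<And>x y. x \<in> K \<Longrightarrow> y \<in> K \<Longrightarrow> dist x y < \<rho> \<Longrightarrow> p x = p y"
proof -
  interpret prob_space M by (rule M)
  have space [simp]: "space M = UNIV" using sets_eq_imp_space_eq[OF sets_M] by simp
  have fin: "finite (range p)" using simple_functionD(1)[OF p] by simp
  have A: "p -` {a} \<in> sets borel" for a
    using simple_functionD(2)[OF p, of "{a}"] by (simp add: sets_M)
  let ?k = "real (card (range p))"
  have k: "?k > 0" using fin by (simp add: card_gt_0_iff)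
  then have "d / ?k > 0" using d by simp
  from almost_locally_constant_set[OF M sets_M A this]
  obtain K \<rho> where K [measurable]: "\<And>a. K a \<in> sets M"
      and mK: "\<And>a. measure M (- K a) < d / ?k" and \<rho>: "\<And>a. \<rho> a > 0"
      and const: "\<And>a x y. x \<in> K a \<Longrightarrow> y \<in> K a \<Longrightarrow> dist x y < \<rho> a \<Longrightarrow> x \<in> p -` {a} \<longleftrightarrow> y \<in> p -` {a}"
    by metis
  have cK [measurable]: "- K i \<in> sets M" for i
    using sets.compl_sets[OF K[of i]] by (simp add: Compl_eq_Diff_UNIV)
  let ?K = "\<Inter>a\<in>range p. K a"
  show thesis
  proof (rule that[of ?K "Min (\<rho> ` range p)"])
    show "?K \<in> sets M" using fin by (intro sets.finite_INT) auto
    have "measure M (- ?K) \<le> (\<Sum>a\<in>range p. measure M (- K a))"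
      unfolding Compl_INT by (rule finite_measure_subadditive_finite) (use fin in auto)
    also have "\<dots> < (\<Sum>a\<in>range p. d / ?k)"
      by (intro sum_strict_mono mK fin) auto
    also have "\<dots> = d" using k by simp
    finally show "measure M (- ?K) < d" .
    show "Min (\<rho> ` range p) > 0" using fin \<rho> by (subst Min_gr_iff) auto
    fix x y assume xy: "x \<in> ?K" "y \<in> ?K" "dist x y < Min (\<rho> ` range p)"
    have "Min (\<rho> ` range p) \<le> \<rho> (p x)" using fin by (intro Min_le) auto
    then have "x \<in> p -` {p x} \<longleftrightarrow> y \<in> p -` {p x}" by (intro const) (use xy in auto)
    then show "p x = p y" by simp
  qed
qed

section \<open>Entropy of a partition predictable from its future\<close>

lemma itinerary_0 [simp]: "itinerary f p 0 x = []"
  by (simp add: itinerary_def)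

lemma itinerary_Suc: "itinerary f p (Suc n) x = p x # itinerary f p n (f x)"
  by (simp add: itinerary_def upt_conv_Cons map_Suc_upt[symmetric] comp_def funpow_swap1 del: upt_Suc)

lemma length_itinerary [simp]: "length (itinerary f p n x) = n"
  by (simp add: itinerary_def)

lemma take_itinerary: "k \<le> n \<Longrightarrow> take k (itinerary f p n x) = itinerary f p k x"
  by (simp add: itinerary_def take_map)

lemma itinerary_in_lists: "range p \<subseteq> {..<K} \<Longrightarrow> itinerary f p n x \<in> {w. set w \<subseteq> {..<K::nat} \<and> length w = n}"
  by (auto simp: itinerary_def)

context prob_space
begin

lemma integrable_compose_simple:
  assumes X: "simple_function M X"
  shows "integrable M (\<lambda>x. f (X x) :: real)"
proof (rule integrable_const_bound[where B = "Max (insert 0 ((\<lambda>w. \<bar>f w\<bar>) ` X ` space M))"])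
  show "(\<lambda>x. f (X x)) \<in> borel_measurable M"
    using simple_function_compose1[OF X] by (rule borel_measurable_simple_function)
  show "AE x in M. norm (f (X x)) \<le> Max (insert 0 ((\<lambda>w. \<bar>f w\<bar>) ` X ` space M))"
    using simple_functionD(1)[OF X] by (intro AE_I2 Max_ge) auto
qed

lemma integral_compose_simple:
  assumes X: "simple_function M X"
  shows "(\<integral>x. f (X x) \<partial>M) = (\<Sum>w\<in>X ` space M. f w * measure M (X -` {w} \<inter> space M) :: real)"
proof -
  have fin: "finite (X ` space M)" by (rule simple_functionD(1)[OF X])
  have meas: "X -` {w} \<inter> space M \<in> sets M" for w by (rule simple_functionD(2)[OF X])
  have "(\<integral>x. f (X x) \<partial>M) = (\<integral>x. (\<Sum>w\<in>X ` space M. f w * indicator (X -` {w} \<inter> space M) x) \<partial>M)"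
  proof (rule Bochner_Integration.integral_cong[OF refl])
    fix x assume x: "x \<in> space M"
    have "(\<Sum>w\<in>X ` space M. f w * indicator (X -` {w} \<inter> space M) x)
        = (\<Sum>w\<in>X ` space M. if X x = w then f w else 0)"
      using x by (intro sum.cong) (auto simp: indicator_def)
    then show "f (X x) = (\<Sum>w\<in>X ` space M. f w * indicator (X -` {w} \<inter> space M) x)"
      using fin x by simp
  qed
  also have "\<dots> = (\<Sum>w\<in>X ` space M. f w * measure M (X -` {w} \<inter> space M))"
    using meas by (subst Bochner_Integration.integral_sum) (auto simp: integrable_mult_right emeasure_eq_measure)
  finally show ?thesis .
qed

lemma partition_entropy_eq:
  assumes X: "simple_function M X"
  shows "partition_entropy M X =
    - (\<Sum>w\<in>X ` space M. measure M (X -` {w} \<inter> space M) * ln (measure M (X -` {w} \<inter> space M)))"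
proof -
  interpret information_space M "exp 1" by standard simp
  have "simple_distributed M X (\<lambda>w. measure M (X -` {w} \<inter> space M))"
    by (rule simple_distributedI[OF X]) auto
  from entropy_simple_distributed[OF this] show ?thesis
    by (simp add: partition_entropy_def log_ln[symmetric])
qed

lemma partition_entropy_nonneg:
  assumes X: "simple_function M X"
  shows "partition_entropy M X \<ge> 0"
  unfolding partition_entropy_eq[OF X]
proof -
  have "P * ln P \<le> 0" if "0 \<le> P" "P \<le> 1" for P :: real
    using that by (cases "P = 0") (auto intro: mult_nonneg_nonpos)
  then show "0 \<le> - (\<Sum>w\<in>X ` space M. measure M (X -` {w} \<inter> space M) * ln (measure M (X -` {w} \<inter> space M)))"
    by (simp add: sum_nonpos)
qed

text \<open>
  Gibbs' inequality: no subprobability \<open>Q\<close> codes the values of \<open>X\<close> with an expected code length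
  below the entropy.
\<close>
lemma partition_entropy_le_code_length:
  assumes X: "simple_function M X"
    and pos: "\<And>w. w \<in> X ` space M \<Longrightarrow> Q w > 0" and sum: "(\<Sum>w\<in>X ` space M. Q w) \<le> 1"
  shows "partition_entropy M X \<le> (\<integral>x. - ln (Q (X x)) \<partial>M)"
proof -
  let ?P = "\<lambda>w. measure M (X -` {w} \<inter> space M)"
  have "(\<Sum>w\<in>X ` space M. ?P w) = 1"
    using integral_compose_simple[OF X, of "\<lambda>_. 1"] by (simp add: prob_space)
  moreover have "?P w * ln (Q w) - ?P w * ln (?P w) \<le> Q w - ?P w" if w: "w \<in> X ` space M" for w
  proof (cases "?P w = 0")
    case True
    then show ?thesis using pos[OF w] by simp
  next
    case False
    then have P: "?P w > 0" by (simp add: zero_less_measure_iff)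
    have "ln (Q w / ?P w) \<le> Q w / ?P w - 1"
      using P pos[OF w] by (intro ln_le_minus_one) auto
    then have "ln (Q w) - ln (?P w) \<le> Q w / ?P w - 1"
      using P pos[OF w] by (simp add: ln_div)
    then have "?P w * (ln (Q w) - ln (?P w)) \<le> ?P w * (Q w / ?P w - 1)"
      using P by (intro mult_left_mono) auto
    then show ?thesis using P by (simp add: right_diff_distrib)
  qed
  then have "(\<Sum>w\<in>X ` space M. ?P w * ln (Q w) - ?P w * ln (?P w)) \<le> (\<Sum>w\<in>X ` space M. Q w - ?P w)"
    by (rule sum_mono)
  ultimately show ?thesis
    using sum by (simp add: partition_entropy_eq[OF X] integral_compose_simple[OF X, of "\<lambda>w. ln (Q w)"]
        sum_subtractf sum_negf mult.commute)
qed

end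

context measure_preserving
begin

lemma simple_function_T: "simple_function M X \<Longrightarrow> simple_function M (\<lambda>x. X (T x))"
  unfolding simple_function_def
proof safe
  assume X: "finite (X ` space M)" "\<forall>x\<in>X ` space M. X -` {x} \<inter> space M \<in> events"
  show "finite ((\<lambda>x. X (T x)) ` space M)"
    by (rule finite_subset[OF _ X(1)]) (auto simp: T_space)
  fix x assume x: "x \<in> space M"
  have "(\<lambda>x. X (T x)) -` {X (T x)} \<inter> space M = T -` (X -` {X (T x)} \<inter> space M) \<inter> space M"
    by (auto simp: T_space)
  also have "\<dots> \<in> events" using X(2) x T_space[of x] by (intro measurable_sets[OF T_meas]) auto
  finally show "(\<lambda>x. X (T x)) -` {X (T x)} \<inter> space M \<in> events" .
qed

lemma simple_function_itinerary:
  "simple_function M p \<Longrightarrow> simple_function M (\<lambda>x. itinerary T p n x)"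
proof (induction n)
  case (Suc n)
  show ?case unfolding itinerary_Suc
    by (rule simple_function_compose2[OF Suc.prems simple_function_T[OF Suc.IH[OF Suc.prems]]])
next
  case 0
  have "itinerary T p 0 = (\<lambda>x. [])" by (simp add: itinerary_def fun_eq_iff)
  then show ?case by simp
qed

end

text \<open>
  The weight of a word under a model that generates it from its last letter to its first one, where
  \<open>r a w\<close> is the probability of putting \<open>a\<close> in front of \<open>w\<close>.
\<close>
fun word_prob :: "(nat \<Rightarrow> nat list \<Rightarrow> real) \<Rightarrow> nat list \<Rightarrow> real" where
  "word_prob r [] = 1"
| "word_prob r (a # w) = word_prob r w * r a w"

lemma word_prob_nonneg: "(\<And>a w. r a w \<ge> 0) \<Longrightarrow> word_prob r w \<ge> 0"
  by (induction w) auto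

lemma word_prob_pos: "(\<And>a w. r a w > 0) \<Longrightarrow> word_prob r w > 0"
  by (induction w) auto

lemma sum_word_prob_le:
  assumes r: "\<And>a w. r a w \<ge> 0" "\<And>w. (\<Sum>a<K. r a w) \<le> 1"
  shows "(\<Sum>w\<in>{w. set w \<subseteq> {..<K} \<and> length w = n}. word_prob r w) \<le> 1"
proof (induction n)
  case 0
  have "{w. set w \<subseteq> {..<K} \<and> length w = 0} = {[]}" by auto
  then show ?case by (simp del: length_0_conv)
next
  case (Suc n)
  let ?L = "\<lambda>n. {w. set w \<subseteq> {..<K} \<and> length w = n}"
  have "?L (Suc n) = (\<lambda>(a, w). a # w) ` ({..<K} \<times> ?L n)"
    by (auto simp: length_Suc_conv image_iff)
  then have "(\<Sum>w\<in>?L (Suc n). word_prob r w) = (\<Sum>(a, w)\<in>{..<K} \<times> ?L n. word_prob r w * r a w)"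
    by (simp add: sum.reindex inj_on_def case_prod_unfold)
  also have "\<dots> = (\<Sum>w\<in>?L n. \<Sum>a<K. word_prob r w * r a w)"
    by (subst sum.swap) (simp add: sum.cartesian_product)
  also have "\<dots> = (\<Sum>w\<in>?L n. word_prob r w * (\<Sum>a<K. r a w))"
    by (simp add: sum_distrib_left)
  also have "\<dots> \<le> (\<Sum>w\<in>?L n. word_prob r w * 1)"
    by (intro sum_mono mult_left_mono r word_prob_nonneg)
  finally show ?case using Suc by simp
qed

context measure_preserving
begin

text \<open>
  The code behind this bound: given at least \<open>k\<close> later letters, the letter predicted by \<open>g\<close>
  gets probability \<open>1 - \<delta>\<close> and each other letter \<open>\<delta> / K\<close>; the last \<open>k\<close> letters are coded uniformly. By
  invariance every letter has the same expected cost.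
\<close>
lemma entropy_le_of_predictable:
  assumes p: "simple_function M p" and K: "range p \<subseteq> {..<K}" and \<delta>: "0 < \<delta>" "\<delta> < 1"
    and mis: "measure M {x \<in> space M. p x \<noteq> g (itinerary T p k (T x))} \<le> \<delta>"
  shows "partition_entropy M (itinerary T p n)
    \<le> real k * ln (real K) + real n * (\<delta> * ln (real K / \<delta>) - ln (1 - \<delta>))"
proof -
  have K1: "real K \<ge> 1" using K by (cases K) auto
  define r where "r a w = (if length w < k then 1 / real K
      else if a = g (take k w) then 1 - \<delta> else \<delta> / real K)" for a w
  have r_pos: "r a w > 0" for a w using \<delta> K1 by (auto simp: r_def)
  have r_sum: "(\<Sum>a<K. r a w) \<le> 1" for w
  proof (cases "length w < k")
    case True
    then show ?thesis using K1 by (simp add: r_def)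
  next
    case False
    have "(\<Sum>a<K. r a w) \<le> (\<Sum>a<K. (if a = g (take k w) then 1 - \<delta> else 0) + \<delta> / real K)"
      using False \<delta> K1 by (intro sum_mono) (auto simp: r_def)
    also have "\<dots> \<le> 1" using K1 \<delta> by (simp add: sum.distrib)
    finally show ?thesis .
  qed
  let ?Q = "word_prob r"
  let ?h = "\<delta> * ln (real K / \<delta>) - ln (1 - \<delta>)"
  have h: "?h \<ge> 0"
  proof -
    have "real K / \<delta> \<ge> 1" using K1 \<delta> by simp
    then have "\<delta> * ln (real K / \<delta>) \<ge> 0" using \<delta> by (intro mult_nonneg_nonneg ln_ge_zero) auto
    moreover have "ln (1 - \<delta>) \<le> 0" using \<delta> by simp
    ultimately show ?thesis by linarith
  qed
  have simp_it: "simple_function M (\<lambda>x. itinerary T p n x)" for n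
    by (rule simple_function_itinerary[OF p])
  have code: "(\<integral>x. - ln (?Q (itinerary T p n x)) \<partial>M) \<le> real (min n k) * ln (real K) + real n * ?h" for n
  proof (induction n)
    case (Suc n)
    let ?I = "\<lambda>x. itinerary T p n (T x)"
    have simp_I: "simple_function M ?I" by (rule simple_function_T[OF simp_it])
    have simp_pI: "simple_function M (\<lambda>x. (p x, ?I x))" by (rule simple_function_Pair[OF p simp_I])
    have int1: "integrable M (\<lambda>x. - ln (?Q (?I x)))"
      using integrable_compose_simple[OF simp_I, of "\<lambda>w. - ln (?Q w)"] .
    have int2: "integrable M (\<lambda>x. - ln (r (p x) (?I x)))"
      using integrable_compose_simple[OF simp_pI, of "\<lambda>(a, w). - ln (r a w)"] by simp
    have "(\<integral>x. - ln (?Q (itinerary T p (Suc n) x)) \<partial>M)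
        = (\<integral>x. - ln (?Q (?I x)) + - ln (r (p x) (?I x)) \<partial>M)"
      using word_prob_pos[OF r_pos] r_pos
      by (intro Bochner_Integration.integral_cong) (auto simp: itinerary_Suc ln_mult_pos)
    also have "\<dots> = (\<integral>x. - ln (?Q (?I x)) \<partial>M) + (\<integral>x. - ln (r (p x) (?I x)) \<partial>M)"
      by (rule Bochner_Integration.integral_add[OF int1 int2])
    also have "(\<integral>x. - ln (?Q (?I x)) \<partial>M) = (\<integral>x. - ln (?Q (itinerary T p n x)) \<partial>M)"
    proof (rule integral_T)
      show "(\<lambda>x. - ln (?Q (itinerary T p n x))) \<in> borel_measurable M"
        using integrable_compose_simple[OF simp_it, of "\<lambda>w. - ln (?Q w)"] by (rule borel_measurable_integrable)
    qed
    also note Suc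
    also have "(\<integral>x. - ln (r (p x) (?I x)) \<partial>M) \<le> (if n < k then ln (real K) else ?h)"
    proof (cases "n < k")
      case True
      then have "- ln (r (p x) (?I x)) = ln (real K)" for x
        using K1 by (simp add: r_def ln_div)
      then show ?thesis using True by (simp add: prob_space)
    next
      case False
      let ?mis = "{x \<in> space M. p x \<noteq> g (itinerary T p k (T x))}"
      have simp_pk: "simple_function M (\<lambda>x. (p x, itinerary T p k (T x)))"
        by (rule simple_function_Pair[OF p simple_function_T[OF simp_it]])
      have mis_meas [measurable]: "?mis \<in> sets M"
      proof -
        have "?mis = (\<lambda>x. (p x, itinerary T p k (T x))) -` {(a, w). a \<noteq> g w} \<inter> space M" by auto
        then show ?thesis using simple_functionD(2)[OF simp_pk] by (simp only:)
      qed
      have "(\<integral>x. - ln (r (p x) (?I x)) \<partial>M) \<le> (\<integral>x. - ln (1 - \<delta>) + ln (real K / \<delta>) * indicator ?mis x \<partial>M)"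
      proof (rule integral_mono[OF int2])
        show "integrable M (\<lambda>x. - ln (1 - \<delta>) + ln (real K / \<delta>) * indicator ?mis x)"
          by (intro Bochner_Integration.integrable_add integrable_const integrable_mult_right integrable_real_indicator)
             (auto simp: emeasure_eq_measure)
        fix x assume x: "x \<in> space M"
        have "r (p x) (?I x) = (if p x = g (itinerary T p k (T x)) then 1 - \<delta> else \<delta> / real K)"
          using False by (simp add: r_def take_itinerary)
        moreover have "- ln (\<delta> / real K) = ln (real K / \<delta>)" using \<delta> K1 by (simp add: ln_div)
        ultimately show "- ln (r (p x) (?I x)) \<le> - ln (1 - \<delta>) + ln (real K / \<delta>) * indicator ?mis x"
          using \<delta> x by (auto simp: indicator_def)
      qed
      also have "\<dots> = - ln (1 - \<delta>) + ln (real K / \<delta>) * measure M ?mis"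
        by (subst Bochner_Integration.integral_add) (auto simp: prob_space emeasure_eq_measure intro!: integrable_mult_right)
      also have "\<dots> \<le> - ln (1 - \<delta>) + ln (real K / \<delta>) * \<delta>"
        using mis K1 \<delta> by (intro add_left_mono mult_left_mono) (auto simp: field_simps)
      finally show ?thesis using False by (simp add: mult.commute)
    qed
    finally have "(\<integral>x. - ln (?Q (itinerary T p (Suc n) x)) \<partial>M)
      \<le> real (min n k) * ln (real K) + real n * ?h + (if n < k then ln (real K) else ?h)" by simp
    also have "\<dots> \<le> real (min (Suc n) k) * ln (real K) + real (Suc n) * ?h"
      using h by (auto simp: min_def algebra_simps)
    finally show ?case .
  qed simp
  have "partition_entropy M (itinerary T p n) \<le> (\<integral>x. - ln (?Q (itinerary T p n x)) \<partial>M)"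
  proof (rule partition_entropy_le_code_length)
    show "simple_function M (itinerary T p n)" using simp_it[of n] by simp
    show "?Q w > 0" for w by (rule word_prob_pos[OF r_pos])
    have "(\<Sum>w\<in>itinerary T p n ` space M. ?Q w) \<le> (\<Sum>w\<in>{w. set w \<subseteq> {..<K} \<and> length w = n}. ?Q w)"
    proof (rule sum_mono2)
      show "finite {w. set w \<subseteq> {..<K} \<and> length w = n}" by (rule finite_lists_length_eq) simp
      show "itinerary T p n ` space M \<subseteq> {w. set w \<subseteq> {..<K} \<and> length w = n}"
        using itinerary_in_lists[OF K] by blast
    qed (auto intro: less_imp_le word_prob_pos[OF r_pos])
    also have "\<dots> \<le> 1" by (rule sum_word_prob_le[OF less_imp_le[OF r_pos] r_sum])
    finally show "(\<Sum>w\<in>itinerary T p n ` space M. ?Q w) \<le> 1" .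
  qed
  also note code[of n]
  also have "real (min n k) * ln (real K) + real n * ?h \<le> real k * ln (real K) + real n * ?h"
    using K1 by (intro add_right_mono mult_right_mono) auto
  finally show ?thesis .
qed

lemma zero_entropy_of_predictable:
  assumes p: "simple_function M p" and K: "range p \<subseteq> {..<K::nat}"
    and pred: "\<And>\<delta>. \<delta> > 0 \<Longrightarrow> \<exists>k g. measure M {x \<in> space M. p x \<noteq> g (itinerary T p k (T x))} < \<delta>"
  shows "(\<lambda>n. partition_entropy M (itinerary T p n) / real n) \<longlonglongrightarrow> 0"
proof (rule LIMSEQ_I)
  fix e :: real assume e: "e > 0"
  have K1: "real K > 0" using K by (cases K) auto
  have "((\<lambda>\<delta>. \<delta> * ln (real K / \<delta>) - ln (1 - \<delta>)) \<longlongrightarrow> 0) (at_right 0)"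
    using K1 by real_asymp
  then have "\<forall>\<^sub>F \<delta> in at_right 0. \<delta> * ln (real K / \<delta>) - ln (1 - \<delta>) < e / 2"
    using e by (intro order_tendstoD(2)) auto
  moreover have "\<forall>\<^sub>F \<delta>::real in at_right 0. \<delta> < 1"
    using eventually_at_right_real[of 0 "1::real"] by (auto elim: eventually_mono)
  moreover have "\<forall>\<^sub>F \<delta>::real in at_right 0. \<delta> > 0" by (rule eventually_at_right_less)
  ultimately have "\<forall>\<^sub>F \<delta>::real in at_right 0. \<delta> > 0 \<and> \<delta> < 1 \<and> \<delta> * ln (real K / \<delta>) - ln (1 - \<delta>) < e / 2"
    by eventually_elim auto
  then obtain \<delta> where \<delta>: "0 < \<delta>" "\<delta> < 1" and h: "\<delta> * ln (real K / \<delta>) - ln (1 - \<delta>) < e / 2"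
    using eventually_happens'[OF trivial_limit_at_right_real] by blast
  from pred[OF \<delta>(1)] obtain k g where kg: "measure M {x \<in> space M. p x \<noteq> g (itinerary T p k (T x))} \<le> \<delta>"
    by (metis less_imp_le)
  obtain N :: nat where N: "real N > 2 * real k * ln (real K) / e" using reals_Archimedean2 by blast
  have "norm (partition_entropy M (itinerary T p n) / real n - 0) < e" if n: "n \<ge> max 1 N" for n
  proof -
    have n1: "real n > 0" using n by simp
    have "0 \<le> partition_entropy M (itinerary T p n)"
      using simple_function_itinerary[OF p] by (intro partition_entropy_nonneg) simp
    moreover have "partition_entropy M (itinerary T p n) < real n * e"
    proof -
      have "real n > 2 * real k * ln (real K) / e" using N n by linarith
      then have "real k * ln (real K) < real n * (e / 2)" using e by (simp add: field_simps)
      moreover have "real n * (\<delta> * ln (real K / \<delta>) - ln (1 - \<delta>)) \<le> real n * (e / 2)"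
        using h n1 by (intro mult_left_mono) auto
      ultimately show ?thesis
        using entropy_le_of_predictable[OF p K \<delta> kg, of n] by (simp add: field_simps)
    qed
    ultimately show ?thesis using n1 by (simp add: field_simps)
  qed
  then show "\<exists>N. \<forall>n\<ge>N. norm (partition_entropy M (itinerary T p n) / real n - 0) < e" by blast
qed

end

section \<open>Betting on repetitions\<close>

lemma measurable_eq_nat:
  fixes f g :: "'b \<Rightarrow> nat"
  assumes f: "f \<in> measurable N (count_space UNIV)" and g: "g \<in> measurable N (count_space UNIV)"
  shows "{x \<in> space N. f x = g x} \<in> sets N"
proof -
  have "{x \<in> space N. f x = g x} = (\<Union>a. (f -` {a} \<inter> space N) \<inter> (g -` {a} \<inter> space N))"
    by auto
  also have "\<dots> \<in> sets N"
    by (intro sets.countable_UN image_subsetI sets.Int measurable_sets[OF f] measurable_sets[OF g]) auto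
  finally show ?thesis .
qed

context measure_preserving
begin

lemma integral_funpow:
  fixes f :: "'a \<Rightarrow> real"
  assumes [measurable]: "f \<in> borel_measurable M"
  shows "(\<integral>x. f ((T ^^ n) x) \<partial>M) = (\<integral>x. f x \<partial>M)"
proof (induction n)
  case (Suc n)
  have "(\<integral>x. f ((T ^^ Suc n) x) \<partial>M) = (\<integral>x. f ((T ^^ n) (T x)) \<partial>M)"
    by (simp add: funpow_swap1)
  also have "\<dots> = (\<integral>x. f ((T ^^ n) x) \<partial>M)" by (rule integral_T) measurable
  finally show ?case using Suc by simp
qed simp

definition future :: "('a \<Rightarrow> nat) \<Rightarrow> 'a measure" where
  "future p = sigma (space M) {(\<lambda>x. p ((T ^^ j) x)) -` A \<inter> space M | j A. j \<ge> 1}"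

lemma space_future [simp]: "space (future p) = space M"
  by (simp add: future_def space_measure_of_conv)

lemma sets_future:
  "sets (future p) = sigma_sets (space M) {(\<lambda>x. p ((T ^^ j) x)) -` A \<inter> space M | j A. j \<ge> 1}"
  unfolding future_def by (rule sets_measure_of) auto

context
  fixes p :: "'a \<Rightarrow> nat" and K :: nat
  assumes p: "simple_function M p" and K: "range p \<subseteq> {..<K}"
begin

lemma p_meas [measurable]: "p \<in> measurable M (count_space UNIV)"
  using measurable_simple_function[OF p] .

lemma subalgebra_future: "subalgebra M (future p)"
proof -
  have "{(\<lambda>x. p ((T ^^ j) x)) -` A \<inter> space M | j A. j \<ge> 1} \<subseteq> sets M"
    by (auto intro!: measurable_sets[of _ M "count_space UNIV"])
  then show ?thesis
    unfolding subalgebra_def sets_future by (auto dest: sets.sigma_sets_subset)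
qed

interpretation future: finite_measure_subalgebra M "future p"
  by standard (rule subalgebra_future)

lemma p_funpow_meas_future: "j \<ge> 1 \<Longrightarrow> (\<lambda>x. p ((T ^^ j) x)) \<in> measurable (future p) (count_space UNIV)"
  by (rule measurableI) (auto simp: sets_future intro!: sigma_sets.Basic)

lemma T_meas_future: "T \<in> measurable (future p) (future p)"
proof -
  have "T \<in> measurable (future p) (sigma (space M) {(\<lambda>x. p ((T ^^ j) x)) -` A \<inter> space M | j A. j \<ge> 1})"
  proof (rule measurable_measure_of)
    fix B assume "B \<in> {(\<lambda>x. p ((T ^^ j) x)) -` A \<inter> space M | j A. j \<ge> 1}"
    then obtain j A where B: "B = (\<lambda>x. p ((T ^^ j) x)) -` A \<inter> space M" "j \<ge> 1" by auto
    have "T -` B \<inter> space (future p) = (\<lambda>x. p ((T ^^ Suc j) x)) -` A \<inter> space M"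
      using T_space by (auto simp: B funpow_swap1)
    then show "T -` B \<inter> space (future p) \<in> sets (future p)"
      using measurable_sets[OF p_funpow_meas_future[of "Suc j"], of A] by simp
  qed (auto simp: T_space)
  then show ?thesis by (simp add: future_def)
qed

definition forecast :: "nat \<Rightarrow> 'a \<Rightarrow> real" where
  "forecast a = real_cond_exp M (future p) (indicator {x \<in> space M. p x = a})"

lemma forecast_meas_future: "forecast a \<in> borel_measurable (future p)"
  by (simp add: forecast_def)

lemma forecast_meas [measurable]: "forecast a \<in> borel_measurable M"
  by (simp add: forecast_def)

lemma integrable_indicator_p: "integrable M (indicator {x \<in> space M. p x = a} :: 'a \<Rightarrow> real)"
  by (rule integrable_real_indicator) (auto simp: emeasure_eq_measure)

lemma forecast_nonneg: "AE x in M. forecast a x \<ge> 0"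
  unfolding forecast_def by (rule future.real_cond_exp_pos) auto

lemma sum_forecast: "AE x in M. (\<Sum>a<K. forecast a x) = 1"
proof -
  have "AE x in M. real_cond_exp M (future p) (\<lambda>x. \<Sum>a<K. indicator {x \<in> space M. p x = a} x) x
      = (\<Sum>a<K. forecast a x)"
    unfolding forecast_def by (rule future.real_cond_exp_sum) (rule integrable_indicator_p)
  moreover have "AE x in M. real_cond_exp M (future p) (\<lambda>x. \<Sum>a<K. indicator {x \<in> space M. p x = a} x) x
      = real_cond_exp M (future p) (\<lambda>x. 1) x"
  proof (rule future.real_cond_exp_cong)
    show "AE x in M. (\<Sum>a<K. indicator {x \<in> space M. p x = a} x) = (1::real)"
    proof (rule AE_I2)
      fix x assume "x \<in> space M"
      then have "(\<Sum>a<K. indicator {x \<in> space M. p x = a} x) = (\<Sum>a<K. if p x = a then 1 else 0 :: real)"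
        by (intro sum.cong) (auto simp: indicator_def)
      also have "\<dots> = 1" using K by auto
      finally show "(\<Sum>a<K. indicator {x \<in> space M. p x = a} x) = (1::real)" .
    qed
  qed auto
  moreover have "AE x in M. real_cond_exp M (future p) (\<lambda>x. 1) x = 1"
    by (rule future.real_cond_exp_F_meas) auto
  ultimately show ?thesis by eventually_elim simp
qed

definition surprising :: "'a set" where
  "surprising = {x \<in> space M. forecast (p x) x \<le> 1 / 2}"

lemma surprising_meas [measurable]: "surprising \<in> sets M"
proof -
  have "(\<lambda>x. forecast (p x) x) \<in> borel_measurable M"
    by (rule measurable_compose_countable[OF forecast_meas p_meas])
  then show ?thesis unfolding surprising_def by measurable
qed

text \<open>
  The events that are approximated by events depending on finitely many later labels form a
  sigma-algebra containing the generators of \<^term>\<open>future p\<close>.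
\<close>
lemma future_set_approximable:
  assumes "B \<in> sets (future p)" "d > 0"
  shows "\<exists>k C. measure M {x \<in> space M. (x \<in> B) \<noteq> (itinerary T p k (T x) \<in> C)} < d"
proof -
  have it: "simple_function M (\<lambda>x. itinerary T p k (T x))" for k
    by (rule simple_function_T[OF simple_function_itinerary[OF p]])
  have itm [measurable]: "{x \<in> space M. itinerary T p k (T x) \<in> C} \<in> sets M" for k C
    using simple_functionD(2)[OF it[of k], of C] by (simp add: Int_def vimage_def conj_commute)
  have "B \<in> sigma_sets (space M) {(\<lambda>x. p ((T ^^ j) x)) -` A \<inter> space M | j A. j \<ge> 1}"
    using assms(1) by (simp add: sets_future)
  then show ?thesis using assms(2)
  proof (induction arbitrary: d rule: sigma_sets.induct)
    case (Basic B)
    then obtain j A where B: "B = (\<lambda>x. p ((T ^^ j) x)) -` A \<inter> space M" "j \<ge> 1" by auto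
    then obtain i where i: "j = Suc i" by (cases j) auto
    have "itinerary T p j (T x) ! i = p ((T ^^ j) x)" for x
      by (simp add: itinerary_def i funpow_swap1 del: upt_Suc)
    then have "{x \<in> space M. (x \<in> B) \<noteq> (itinerary T p j (T x) \<in> {w. w ! i \<in> A})} = {}"
      by (auto simp: B)
    then have "measure M {x \<in> space M. (x \<in> B) \<noteq> (itinerary T p j (T x) \<in> {w. w ! i \<in> A})} < d"
      using Basic.prems by (simp only: measure_empty)
    then show ?case by (intro exI[of _ j] exI[of _ "{w. w ! i \<in> A}"])
  next
    case Empty
    have "{x \<in> space M. (x \<in> {}) \<noteq> (itinerary T p 0 (T x) \<in> {})} = {}" by auto
    then have "measure M {x \<in> space M. (x \<in> {}) \<noteq> (itinerary T p 0 (T x) \<in> {})} < d"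
      using Empty by (simp only: measure_empty)
    then show ?case by (intro exI[of _ 0] exI[of _ "{}"])
  next
    case (Compl B)
    then obtain k C where kC: "measure M {x \<in> space M. (x \<in> B) \<noteq> (itinerary T p k (T x) \<in> C)} < d" by blast
    have "{x \<in> space M. (x \<in> space M - B) \<noteq> (itinerary T p k (T x) \<in> - C)}
        = {x \<in> space M. (x \<in> B) \<noteq> (itinerary T p k (T x) \<in> C)}" by auto
    then have "measure M {x \<in> space M. (x \<in> space M - B) \<noteq> (itinerary T p k (T x) \<in> - C)} < d"
      using kC by (simp only:)
    then show ?case by (intro exI[of _ k] exI[of _ "- C"])
  next
    case (Union B)
    have Bf: "B i \<in> sets (future p)" for i using Union.hyps by (simp add: sets_future)
    then have [measurable]: "B i \<in> sets M" for i using subalgebra_future by (auto simp: subalgebra_def)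
    have "(\<lambda>n. measure M ((\<Union>i. B i) - (\<Union>i<n. B i))) \<longlonglongrightarrow> measure M (\<Inter>n. (\<Union>i. B i) - (\<Union>i<n. B i))"
      by (rule finite_Lim_measure_decseq) (auto simp: decseq_def)
    moreover have "(\<Inter>n. (\<Union>i. B i) - (\<Union>i<n. B i)) = {}" by (auto intro: lessI)
    ultimately have "(\<lambda>n. measure M ((\<Union>i. B i) - (\<Union>i<n. B i))) \<longlonglongrightarrow> 0"
      by (simp only: measure_empty)
    then obtain n where n: "measure M ((\<Union>i. B i) - (\<Union>i<n. B i)) < d / 2"
      using \<open>d > 0\<close> by (metis (lifting) order_tendstoD(2) eventually_sequentially order_refl half_gt_zero)
    have "d / (2 * real (Suc n)) > 0" using \<open>d > 0\<close> by simp
    then have "\<forall>i. \<exists>k C. measure M {x \<in> space M. (x \<in> B i) \<noteq> (itinerary T p k (T x) \<in> C)} < d / (2 * real (Suc n))"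
      using Union.IH by blast
    from choice[OF this] obtain k
      where "\<forall>i. \<exists>C. measure M {x \<in> space M. (x \<in> B i) \<noteq> (itinerary T p (k i) (T x) \<in> C)} < d / (2 * real (Suc n))" ..
    from choice[OF this] obtain C
      where kC: "\<And>i. measure M {x \<in> space M. (x \<in> B i) \<noteq> (itinerary T p (k i) (T x) \<in> C i)} < d / (2 * real (Suc n))"
      by auto
    define k' where "k' = (\<Sum>i<n. k i)"
    have k': "k i \<le> k'" if "i < n" for i unfolding k'_def using that by (intro member_le_sum) auto
    define C' where "C' = {w. \<exists>i<n. take (k i) w \<in> C i}"
    let ?E = "\<lambda>i. {x \<in> space M. (x \<in> B i) \<noteq> (itinerary T p (k i) (T x) \<in> C i)}"
    have E [measurable]: "?E i \<in> sets M" for i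
    proof -
      have "?E i = (B i - {x \<in> space M. itinerary T p (k i) (T x) \<in> C i}) \<union>
          ({x \<in> space M. itinerary T p (k i) (T x) \<in> C i} - B i)"
        using sets.sets_into_space[of "B i" M] by auto
      then show ?thesis by simp
    qed
    let ?R = "(\<Union>i. B i) - (\<Union>i<n. B i)"
    have "{x \<in> space M. (x \<in> (\<Union>i. B i)) \<noteq> (itinerary T p k' (T x) \<in> C')} \<subseteq> ?R \<union> (\<Union>i<n. ?E i)"
      using k' by (auto simp: C'_def take_itinerary)
    then have "measure M {x \<in> space M. (x \<in> (\<Union>i. B i)) \<noteq> (itinerary T p k' (T x) \<in> C')} \<le> measure M (?R \<union> (\<Union>i<n. ?E i))"
      by (rule finite_measure_mono) measurable
    also have "\<dots> \<le> measure M ?R + measure M (\<Union>i<n. ?E i)"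
      by (rule measure_Un_le) measurable
    also have "measure M (\<Union>i<n. ?E i) \<le> (\<Sum>i<n. measure M (?E i))"
      by (rule finite_measure_subadditive_finite) auto
    also have "\<dots> \<le> (\<Sum>i<n. d / (2 * real (Suc n)))"
      by (intro sum_mono less_imp_le kC)
    also have "\<dots> \<le> d / 2" using \<open>d > 0\<close> by (simp add: field_simps)
    finally show ?case using n by (intro exI[of _ k'] exI[of _ C']) simp
  qed
qed

text \<open>
  If the forecast of the actual label is almost surely above \<open>1 / 2\<close>, then no other label has such a
  forecast, since the forecasts sum to 1. So the label is almost surely a function of the later ones.
\<close>
lemma predictable_of_not_surprising:
  assumes D: "measure M surprising = 0" and d: "d > 0"
  shows "\<exists>k g. measure M {x \<in> space M. p x \<noteq> g (itinerary T p k (T x))} < d"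
proof -
  define B where "B a = {x \<in> space M. forecast a x > 1 / 2}" for a
  have B: "B a \<in> sets (future p)" for a
    using measurable_sets[OF forecast_meas_future, of "{1/2<..}" a] by (simp add: B_def Int_def vimage_def conj_commute)
  have BM [measurable]: "B a \<in> sets M" for a unfolding B_def by measurable
  have notD: "AE x in M. x \<notin> surprising" using D by (simp add: prob_eq_0)
  have "AE x in M. \<forall>a. forecast a x \<ge> 0" by (simp add: AE_all_countable forecast_nonneg)
  with sum_forecast notD have good: "AE x in M. \<forall>a<K. x \<in> B a \<longleftrightarrow> p x = a"
  proof (rule AE_mp[OF AE_conjI, OF AE_conjI], intro AE_I2 impI)
    fix x assume x: "x \<in> space M" and
      *: "((\<Sum>a<K. forecast a x) = 1 \<and> x \<notin> surprising) \<and> (\<forall>a. forecast a x \<ge> 0)"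
    have "x \<in> B (p x)" using * x by (auto simp: B_def surprising_def)
    moreover have "a = p x" if a: "a < K" "x \<in> B a" for a
    proof (rule ccontr)
      assume ne: "a \<noteq> p x"
      have "(\<Sum>b\<in>{a, p x}. forecast b x) \<le> (\<Sum>b<K. forecast b x)"
        using * a K by (intro sum_mono2) auto
      with ne a \<open>x \<in> B (p x)\<close> * show False by (simp add: B_def)
    qed
    ultimately show "\<forall>a<K. x \<in> B a \<longleftrightarrow> p x = a" by blast
  qed
  have K1: "real K > 0" using K by (cases K) auto
  then have "d / real K > 0" using d by simp
  with future_set_approximable[OF B] have "\<forall>a. \<exists>k C. measure M {x \<in> space M. (x \<in> B a) \<noteq> (itinerary T p k (T x) \<in> C)} < d / real K"
    by blast
  from choice[OF this] obtain k where "\<forall>a. \<exists>C. measure M {x \<in> space M. (x \<in> B a) \<noteq> (itinerary T p (k a) (T x) \<in> C)} < d / real K" ..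
  from choice[OF this] obtain C
    where kC: "\<And>a. measure M {x \<in> space M. (x \<in> B a) \<noteq> (itinerary T p (k a) (T x) \<in> C a)} < d / real K"
    by auto
  define k' where "k' = (\<Sum>i<K. k i)"
  have k': "k i \<le> k'" if "i < K" for i unfolding k'_def using that by (intro member_le_sum) auto
  define g where "g w = (LEAST a. a < K \<and> take (k a) w \<in> C a)" for w
  let ?E = "\<lambda>a. {x \<in> space M. (x \<in> B a) \<noteq> (itinerary T p (k a) (T x) \<in> C a)}"
  have itm [measurable]: "{x \<in> space M. itinerary T p k (T x) \<in> C} \<in> sets M" for k C
    using simple_functionD(2)[OF simple_function_T[OF simple_function_itinerary[OF p]], of k C]
    by (simp add: Int_def vimage_def conj_commute)
  have E [measurable]: "?E i \<in> sets M" for i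
  proof -
    have "?E i = (B i - {x \<in> space M. itinerary T p (k i) (T x) \<in> C i}) \<union>
        ({x \<in> space M. itinerary T p (k i) (T x) \<in> C i} - B i)"
      using sets.sets_into_space[of "B i" M] by auto
    then show ?thesis by simp
  qed
  have mism: "{x \<in> space M. p x \<noteq> g (itinerary T p k' (T x))} \<in> sets M"
    using simple_functionD(2)[OF simple_function_Pair[OF p simple_function_T[OF simple_function_itinerary[OF p]]],
        of k' "{(a, w). a \<noteq> g w}"]
    by (simp add: Int_def vimage_def conj_commute)
  have "measure M {x \<in> space M. p x \<noteq> g (itinerary T p k' (T x))} \<le> measure M (\<Union>a<K. ?E a)"
  proof (rule finite_measure_mono_AE)
    show "AE x in M. x \<in> {x \<in> space M. p x \<noteq> g (itinerary T p k' (T x))} \<longrightarrow> x \<in> (\<Union>a<K. ?E a)"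
      using good
    proof eventually_elim
      case (elim x)
      show ?case
      proof (rule impI, rule ccontr)
        assume x: "x \<in> {x \<in> space M. p x \<noteq> g (itinerary T p k' (T x))}" and "x \<notin> (\<Union>a<K. ?E a)"
        then have "take (k a) (itinerary T p k' (T x)) \<in> C a \<longleftrightarrow> p x = a" if "a < K" for a
          using that elim k'[OF that] by (auto simp: take_itinerary)
        then have "g (itinerary T p k' (T x)) = (LEAST a. a < K \<and> p x = a)"
          unfolding g_def by (intro arg_cong[where f = Least]) auto
        also have "\<dots> = p x" using K by (intro Least_equality) auto
        finally show False using x by simp
      qed
    qed
  qed measurable
  also have "\<dots> \<le> (\<Sum>a<K. measure M (?E a))"
    by (rule finite_measure_subadditive_finite) auto
  also have "\<dots> < (\<Sum>a<K. d / real K)"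
    using K1 by (intro sum_strict_mono kC) auto
  also have "\<dots> = d" using K1 by simp
  finally show ?thesis by blast
qed

text \<open>
  The factor by which one round changes the capital of a gambler who bets that the label equals the one
  \<open>n\<close> steps later. A correct bet pays double where the forecast of the label was at most \<open>1 / 2\<close>, which
  is fair at best. A wrong bet reduces the payoff by the factor \<open>\<theta>\<close> instead of losing everything, so
  that the capital survives a few errors.
\<close>
definition gain :: "real \<Rightarrow> nat \<Rightarrow> 'a \<Rightarrow> real" where
  "gain \<theta> n x = (if x \<in> surprising then 2 else 1) * (if p x = p ((T ^^ n) x) then 1 else \<theta>)"

lemma gain_meas [measurable]: "gain \<theta> n \<in> borel_measurable M"
proof -
  have [measurable]: "{x \<in> space M. p x = p ((T ^^ n) x)} \<in> sets M"
    by (rule measurable_eq_nat) measurable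
  have "(\<lambda>x. (if x \<in> surprising then 2 else 1) *
      (if x \<in> {x \<in> space M. p x = p ((T ^^ n) x)} then 1 else \<theta>)) \<in> borel_measurable M"
    by measurable
  then show ?thesis
    by (rule measurable_cong[THEN iffD1, rotated]) (auto simp: gain_def)
qed

lemma gain_T_meas_future:
  assumes n: "n \<ge> 1"
  shows "(\<lambda>x. gain \<theta> n (T x)) \<in> borel_measurable (future p)"
proof -
  have 1: "(\<lambda>x. p (T x)) \<in> measurable (future p) (count_space UNIV)"
    using p_funpow_meas_future[of 1] by simp
  have 2: "(\<lambda>x. p ((T ^^ n) (T x))) \<in> measurable (future p) (count_space UNIV)"
    using p_funpow_meas_future[of "Suc n"] by (simp add: funpow_swap1)
  have "(\<lambda>x. forecast a (T x)) \<in> borel_measurable (future p)" for a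
    by (rule measurable_compose[OF T_meas_future forecast_meas_future])
  then have [measurable]: "(\<lambda>x. forecast (p (T x)) (T x)) \<in> borel_measurable (future p)"
    by (rule measurable_compose_countable[OF _ 1])
  have [measurable]: "{x \<in> space M. p (T x) = p ((T ^^ n) (T x))} \<in> sets (future p)"
    using measurable_eq_nat[OF 1 2] by simp
  have "(\<lambda>x. (if forecast (p (T x)) (T x) \<le> 1 / 2 then 2 else 1) *
      (if x \<in> {x \<in> space M. p (T x) = p ((T ^^ n) (T x))} then 1 else \<theta>)) \<in> borel_measurable (future p)"
    by measurable
  then show ?thesis
    by (rule measurable_cong[THEN iffD1, rotated]) (auto simp: gain_def surprising_def T_space)
qed

text \<open>
  Conditionally on the future, a label \<open>a\<close> contributes its forecast times the payoff factor 1 or 2,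
  which is at most 1, times \<open>\<theta>\<close> unless \<open>a\<close> is the label that was bet on. The sum over all labels is
  at most \<open>1 + \<theta> * K\<close>.
\<close>
lemma integral_gain_le:
  assumes n: "n \<ge> 1" and \<theta>: "0 < \<theta>" "\<theta> \<le> 1"
    and Y: "Y \<in> borel_measurable (future p)" "\<And>x. 0 \<le> Y x" "\<And>x. Y x \<le> B"
  shows "(\<integral>x. gain \<theta> n x * Y x \<partial>M) \<le> (1 + \<theta> * real K) * (\<integral>x. Y x \<partial>M)"
proof -
  let ?w = "\<lambda>a x. (if forecast a x \<le> 1 / 2 then 2 else 1 :: real)"
  let ?t = "\<lambda>a x. (if a = p ((T ^^ n) x) then 1 else \<theta>)"
  let ?i = "\<lambda>a. indicator {x \<in> space M. p x = a} :: 'a \<Rightarrow> real"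
  note [measurable] = forecast_meas_future p_funpow_meas_future[OF n] Y(1)
  have YM [measurable]: "Y \<in> borel_measurable M"
    by (rule measurable_from_subalg[OF subalgebra_future Y(1)])
  let ?f = "\<lambda>a x. Y x * ?w a x * ?t a x"
  have f_meas [measurable]: "?f a \<in> borel_measurable (future p)" for a by measurable
  have f_measM [measurable]: "?f a \<in> borel_measurable M" for a
    by (rule measurable_from_subalg[OF subalgebra_future f_meas])
  have f_bound: "\<bar>?f a x\<bar> \<le> B * 2" for a x
  proof -
    have "?f a x \<le> B * 2 * 1" using Y(2,3)[of x] \<theta> by (intro mult_mono) auto
    moreover have "?f a x \<ge> 0" using Y(2)[of x] \<theta> by auto
    ultimately show ?thesis by simp
  qed
  have int: "integrable M (\<lambda>x. ?f a x * ?i a x)" for a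
  proof (rule integrable_bounded)
    show "\<bar>?f a x * ?i a x\<bar> \<le> B * 2" for x
    proof (cases "p x = a \<and> x \<in> space M")
      case True
      then have "?f a x * ?i a x = ?f a x" by simp
      then show ?thesis by (simp only: f_bound)
    next
      case False
      have "0 \<le> \<bar>?f a x\<bar>" by simp
      also have "\<bar>?f a x\<bar> \<le> B * 2" by (rule f_bound)
      finally show ?thesis using False by (auto simp: indicator_def)
    qed
  qed measurable
  have i_meas: "?i a \<in> borel_measurable M" for a by measurable
  have cond: "integrable M (\<lambda>x. ?f a x * forecast a x)"
    "(\<integral>x. ?f a x * forecast a x \<partial>M) = (\<integral>x. ?f a x * ?i a x \<partial>M)" for a
    using future.real_cond_exp_intg[where f = "?f a" and g = "?i a", OF int f_meas i_meas, folded forecast_def]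
    by this+
  have "(\<integral>x. gain \<theta> n x * Y x \<partial>M) = (\<integral>x. (\<Sum>a<K. ?f a x * ?i a x) \<partial>M)"
  proof (rule Bochner_Integration.integral_cong[OF refl])
    fix x assume x: "x \<in> space M"
    have "(\<Sum>a<K. ?f a x * ?i a x) = (\<Sum>a<K. if p x = a then ?f a x else 0)"
      using x by (intro sum.cong) (auto simp: indicator_def)
    also have "\<dots> = ?f (p x) x" using K by auto
    finally show "gain \<theta> n x * Y x = (\<Sum>a<K. ?f a x * ?i a x)"
      using x by (simp add: gain_def surprising_def)
  qed
  also have "\<dots> = (\<Sum>a<K. \<integral>x. ?f a x * ?i a x \<partial>M)"
    by (rule Bochner_Integration.integral_sum[OF int])
  also have "\<dots> = (\<Sum>a<K. \<integral>x. ?f a x * forecast a x \<partial>M)"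
    by (simp only: cond(2))
  also have "\<dots> = (\<integral>x. (\<Sum>a<K. ?f a x * forecast a x) \<partial>M)"
    by (rule Bochner_Integration.integral_sum[symmetric]) (rule cond(1))
  also have "\<dots> \<le> (\<integral>x. (1 + \<theta> * real K) * Y x \<partial>M)"
  proof (rule integral_mono_AE)
    show "integrable M (\<lambda>x. \<Sum>a<K. ?f a x * forecast a x)"
      by (rule Bochner_Integration.integrable_sum) (rule cond(1))
    show "integrable M (\<lambda>x. (1 + \<theta> * real K) * Y x)"
      by (intro integrable_mult_right integrable_bounded[of _ B]) (use Y in auto)
    have "AE x in M. \<forall>a. forecast a x \<ge> 0" by (simp add: AE_all_countable forecast_nonneg)
    then show "AE x in M. (\<Sum>a<K. ?f a x * forecast a x) \<le> (1 + \<theta> * real K) * Y x"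
      using sum_forecast
    proof eventually_elim
      case (elim x)
      have "?f a x * forecast a x \<le> Y x * ((if a = p ((T ^^ n) x) then 1 else 0) + \<theta>)" if a: "a < K" for a
      proof -
        have "forecast a x \<le> (\<Sum>a<K. forecast a x)"
          using elim a by (intro member_le_sum) auto
        then have "?w a x * forecast a x \<le> 1" using elim by auto
        moreover have "?w a x * forecast a x \<ge> 0" using elim by auto
        moreover have "?t a x \<le> (if a = p ((T ^^ n) x) then 1 else 0) + \<theta>" "?t a x \<ge> 0" using \<theta> by auto
        ultimately have "(?w a x * forecast a x) * ?t a x \<le> 1 * ((if a = p ((T ^^ n) x) then 1 else 0) + \<theta>)"
          by (intro mult_mono) auto
        then have "Y x * ((?w a x * forecast a x) * ?t a x) \<le> Y x * (1 * ((if a = p ((T ^^ n) x) then 1 else 0) + \<theta>))"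
          by (rule mult_left_mono) (rule Y)
        then show ?thesis by (simp only: mult_ac mult_1)
      qed
      then have "(\<Sum>a<K. ?f a x * forecast a x) \<le> (\<Sum>a<K. Y x * ((if a = p ((T ^^ n) x) then 1 else 0) + \<theta>))"
        by (intro sum_mono) auto
      also have "\<dots> = Y x * ((\<Sum>a<K. if a = p ((T ^^ n) x) then 1 else 0) + real K * \<theta>)"
        by (simp add: sum_distrib_left[symmetric] sum.distrib)
      also have "(\<Sum>a<K. if a = p ((T ^^ n) x) then 1 else 0) = (1::real)" using K by auto
      finally show ?case by (simp add: mult.commute)
    qed
  qed
  finally show ?thesis by simp
qed

definition total_gain :: "real \<Rightarrow> nat \<Rightarrow> nat \<Rightarrow> 'a \<Rightarrow> real" where
  "total_gain \<theta> n m x = (\<Prod>j<m. gain \<theta> n ((T ^^ j) x))"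

lemma total_gain_meas [measurable]: "total_gain \<theta> n m \<in> borel_measurable M"
  unfolding total_gain_def[abs_def] by measurable

lemma total_gain_Suc: "total_gain \<theta> n (Suc m) x = gain \<theta> n x * total_gain \<theta> n m (T x)"
  unfolding total_gain_def by (subst prod.lessThan_Suc_shift) (simp add: funpow_swap1)

lemma total_gain_bounds:
  assumes "0 < \<theta>" "\<theta> \<le> 1"
  shows "0 \<le> total_gain \<theta> n m x" "total_gain \<theta> n m x \<le> 2 ^ m"
proof -
  have g: "0 \<le> gain \<theta> n x" "gain \<theta> n x \<le> 2" for x using assms by (auto simp: gain_def)
  show "0 \<le> total_gain \<theta> n m x" unfolding total_gain_def by (intro prod_nonneg) (auto simp: g)
  have "total_gain \<theta> n m x \<le> (\<Prod>j<m. 2)" unfolding total_gain_def by (intro prod_mono) (auto simp: g)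
  then show "total_gain \<theta> n m x \<le> 2 ^ m" by simp
qed

text \<open>
  The capital before the round at time 0 has been won at later times, so it is measurable with respect to
  the future, and the bound for a single round can be iterated.
\<close>
lemma integral_total_gain_le:
  assumes n: "n \<ge> 1" and \<theta>: "0 < \<theta>" "\<theta> \<le> 1"
  shows "(\<integral>x. total_gain \<theta> n m x \<partial>M) \<le> (1 + \<theta> * real K) ^ m"
proof (induction m)
  case 0
  then show ?case by (simp add: total_gain_def prob_space)
next
  case (Suc m)
  have "(\<lambda>x. total_gain \<theta> n m (T x)) \<in> borel_measurable (future p)" for m
  proof (induction m)
    case (Suc m)
    show ?case unfolding total_gain_Suc
      using gain_T_meas_future[OF n] measurable_compose[OF T_meas_future Suc.IH]
      by (rule borel_measurable_times)
  qed (simp add: total_gain_def)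
  then have "(\<integral>x. total_gain \<theta> n (Suc m) x \<partial>M) \<le> (1 + \<theta> * real K) * (\<integral>x. total_gain \<theta> n m (T x) \<partial>M)"
    unfolding total_gain_Suc
    by (rule integral_gain_le[OF n \<theta>]) (use total_gain_bounds[OF \<theta>] in auto)
  also have "(\<integral>x. total_gain \<theta> n m (T x) \<partial>M) = (\<integral>x. total_gain \<theta> n m x \<partial>M)"
    by (rule integral_T) measurable
  also have "(1 + \<theta> * real K) * \<dots> \<le> (1 + \<theta> * real K) * (1 + \<theta> * real K) ^ m"
    using Suc \<theta> by (intro mult_left_mono) auto
  finally show ?case by simp
qed

lemma total_gain_eq:
  assumes "x \<in> space M"
  shows "total_gain \<theta> n m x = 2 ^ card {j \<in> {..<m}. (T ^^ j) x \<in> surprising}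
    * \<theta> ^ card {j \<in> {..<m}. p ((T ^^ j) x) \<noteq> p ((T ^^ (j + n)) x)}"
proof -
  have a: "(T ^^ n) ((T ^^ j) x) = (T ^^ (j + n)) x" for j by (metis add.commute comp_apply funpow_add)
  have "total_gain \<theta> n m x = (\<Prod>j<m. if (T ^^ j) x \<in> surprising then 2 else 1)
      * (\<Prod>j<m. if p ((T ^^ j) x) \<noteq> p ((T ^^ (j + n)) x) then \<theta> else 1)"
    unfolding total_gain_def gain_def a prod.distrib by (intro arg_cong2[where f = times] prod.cong) auto
  then show ?thesis by (simp add: prod.If_cases Int_def)
qed

end

end

section \<open>Repetitions in a window proportional to the lag\<close>

text \<open>
  The distances compare the orbit of \<open>x\<close> at the times \<open>- i\<close> and \<open>n - i\<close>, where \<open>S\<close> plays the part of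
  the inverse of \<open>T\<close>. If all of them are small, then, seen from the point
  \<open>(S ^^ (n div 2 + n div q)) x\<close>, the labels repeat with lag \<open>n\<close> at most of the first \<open>n div q\<close> times,
  and the gambler's capital there is exponentially larger than its mean.
\<close>
lemma close_windows_rare:
  fixes M :: "'a::metric_space measure"
  assumes T: "ergodic_map M T" and S: "ergodic_map M S" and sets_M: "sets M = sets borel"
    and inv: "\<And>x. T (S x) = x"
    and p: "simple_function M p" and K: "range p \<subseteq> {..<K::nat}"
    and entropy: "\<not> (\<lambda>n. partition_entropy M (itinerary T p n) / real n) \<longlonglongrightarrow> 0"
    and q: "q \<ge> 3"
  obtains \<rho> where "\<rho> > 0"
    "AE x in M. \<forall>\<^sub>F n in sequentially. \<exists>i. n div 2 < i \<and> i \<le> n div 2 + n div q \<and>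
      dist ((S ^^ i) x) ((T ^^ (n - i)) x) \<ge> \<rho>"
proof -
  interpret T: ergodic_map M T by (rule T)
  interpret S: ergodic_map M S by (rule S)
  have space [simp]: "space M = UNIV" using sets_eq_imp_space_eq[OF sets_M] by simp
  have K1: "real K \<ge> 1" using K by (cases K) auto
  let ?D = "T.surprising p"
  let ?d = "measure M ?D"
  have D [measurable]: "?D \<in> sets M" by (rule T.surprising_meas[OF p K])
  have d: "?d > 0"
    using T.zero_entropy_of_predictable[OF p K T.predictable_of_not_surprising[OF p K]] entropy
    by (metis zero_less_measure_iff)
  have d1: "?d \<le> 1" by simp
  \<comment> \<open>A window of length \<open>m\<close> contains at least \<open>2 c m\<close> surprising times, which yield the factor
    \<open>2 powr (2 c m)\<close>. The parameter \<open>\<theta>\<close> is chosen such that the mean capital is at most \<open>2 powr (c m / 2)\<close>,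
    and \<open>\<delta>\<close> such that \<open>\<delta> m\<close> errors cost at most the factor \<open>2 powr (- c m / 2)\<close>.\<close>
  define c where "c = ?d / 4"
  have c: "0 < c" "c \<le> 1 / 4" using d d1 by (auto simp: c_def)
  define \<theta> where "\<theta> = (2 powr (c / 2) - 1) / real K"
  have powr_c: "2 powr (c / 2) < (2::real) powr 1" "2 powr (c / 2) > (2::real) powr 0"
    using c by (intro powr_less_mono; simp)+
  have \<theta>: "0 < \<theta>" "\<theta> < 1"
    using powr_c K1 by (auto simp: \<theta>_def field_simps)
  have \<theta>K: "1 + \<theta> * real K = 2 powr (c / 2)" using K1 by (simp add: \<theta>_def)
  define \<delta> where "\<delta> = (c / 2) * ln 2 / (- ln \<theta>)"
  have ln\<theta>: "ln \<theta> < 0" using \<theta> by simp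
  have \<delta>: "\<delta> > 0" unfolding \<delta>_def using c ln\<theta> by (intro divide_pos_pos mult_pos_pos) auto
  have "ln \<theta> * \<delta> = - (c / 2) * ln 2" using ln\<theta> by (simp add: \<delta>_def field_simps)
  then have \<theta>\<delta>: "\<theta> powr \<delta> = 2 powr (- c / 2)" using \<theta> by (simp add: powr_def mult.commute)
  \<comment> \<open>An error forces one of the two points involved out of \<open>G\<close>, so errors occur with frequency at most
    \<open>2 * (\<delta> / 4 + \<delta> / 4)\<close>, the second \<open>\<delta> / 4\<close> being the tolerance in Birkhoff's theorem.\<close>
  obtain G \<rho> where G [measurable]: "G \<in> sets M" and mG: "measure M (- G) < \<delta> / 4" and \<rho>: "\<rho> > 0"
    and const: "\<And>x y. x \<in> G \<Longrightarrow> y \<in> G \<Longrightarrow> dist x y < \<rho> \<Longrightarrow> p x = p y"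
    using almost_locally_constant[OF T.prob_space_axioms sets_M p, of "\<delta> / 4"] \<delta> by auto
  have cG [measurable]: "- G \<in> sets M" using sets.compl_sets[OF G] by (simp add: Compl_eq_Diff_UNIV)
  define h where "h n = n div 2" for n :: nat
  define m where "m n = n div q" for n :: nat
  define V where "V n x = T.total_gain p \<theta> n (m n) ((S ^^ (h n + m n)) x)" for n x
  have gain_meas [measurable]: "T.total_gain p \<theta> n j \<in> borel_measurable M" for n j
    by (rule T.total_gain_meas[OF p K])
  have V_meas [measurable]: "V n \<in> borel_measurable M" for n unfolding V_def by measurable
  define A where "A n = {x \<in> space M. V n x \<ge> 2 powr (3 / 2 * c * real (m n))}" for n
  have A_meas: "A n \<in> sets M" for n unfolding A_def by measurable
  have A_le: "measure M (A n) \<le> 2 powr (- c * real (m n))" if n: "n \<ge> 1" for n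
  proof -
    have int: "integrable M (V n)"
      by (rule T.integrable_bounded[of _ "2 ^ m n"])
        (use T.total_gain_bounds[OF p K \<theta>(1) less_imp_le[OF \<theta>(2)]] in \<open>auto simp: V_def abs_of_nonneg\<close>)
    have "measure M (A n) \<le> (\<integral>x. V n x \<partial>M) / 2 powr (3 / 2 * c * real (m n))"
      unfolding A_def
      by (rule integral_Markov_inequality_measure[OF int, of "{}"])
        (use T.total_gain_bounds[OF p K \<theta>(1) less_imp_le[OF \<theta>(2)]] in \<open>auto simp: V_def\<close>)
    also have "(\<integral>x. V n x \<partial>M) = (\<integral>x. T.total_gain p \<theta> n (m n) x \<partial>M)"
      unfolding V_def by (rule S.integral_funpow) measurable
    also have "\<dots> \<le> (1 + \<theta> * real K) ^ m n"
      by (rule T.integral_total_gain_le[OF p K n \<theta>(1) less_imp_le[OF \<theta>(2)]])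
    also have "\<dots> = 2 powr (c / 2 * real (m n))"
      unfolding \<theta>K by (simp add: powr_realpow[symmetric] powr_powr)
    finally show ?thesis by (simp add: divide_right_mono powr_diff[symmetric] field_simps)
  qed
  have "summable (\<lambda>n. measure M (A n))"
  proof (rule summable_comparison_test'[where N = 1])
    show "summable (\<lambda>n. 2 powr c * (2 powr (- c / real q)) ^ n)"
    proof (intro summable_mult summable_geometric)
      have "2 powr (- c / real q) < (2::real) powr 0" using c q by (intro powr_less_mono) auto
      then show "norm (2 powr (- c / real q) :: real) < 1" by simp
    qed
    fix n :: nat assume n: "n \<ge> 1"
    have "real n / real q \<le> real (m n) + 1"
    proof -
      have "real n = real q * real (m n) + real (n mod q)"
        unfolding m_def by (metis mult_div_mod_eq of_nat_add of_nat_mult)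
      moreover have "real (n mod q) \<le> real q" using q by simp
      ultimately show ?thesis using q by (simp add: field_simps)
    qed
    then have "c * (real n / real q) \<le> c * (real (m n) + 1)" using c by (intro mult_left_mono) auto
    then have "2 powr (- c * real (m n)) \<le> (2::real) powr (c + (- c / real q) * real n)"
      by (intro powr_mono) (auto simp: algebra_simps)
    also have "\<dots> = 2 powr c * (2 powr (- c / real q)) ^ n"
      unfolding powr_add by (simp add: powr_realpow[symmetric] powr_powr)
    finally show "norm (measure M (A n)) \<le> 2 powr c * (2 powr (- c / real q)) ^ n"
      using A_le[OF n] by simp
  qed
  then have rare: "AE x in M. \<forall>\<^sub>F n in sequentially. x \<in> space M - A n"
    by (intro borel_cantelli_AE1 A_meas) (auto simp: T.emeasure_eq_measure)
  have q0: "q > 0" using q by simp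
  have "c > 0" "\<delta> / 4 > 0" "?d / 2 > 0" using c \<delta> d by auto
  note visits = S.visits_in_window[OF D q0 \<open>?d / 2 > 0\<close>] S.visits_in_window[OF cG q0 \<open>\<delta> / 4 > 0\<close>]
    T.visits_in_window[OF cG q0 \<open>\<delta> / 4 > 0\<close>]
  have "AE x in M. \<forall>\<^sub>F n in sequentially. \<exists>i. n div 2 < i \<and> i \<le> n div 2 + n div q \<and>
      dist ((S ^^ i) x) ((T ^^ (n - i)) x) \<ge> \<rho>"
    using rare visits
  proof eventually_elim
    case (elim x)
    show ?case
      using elim eventually_ge_at_top[of 6]
    proof eventually_elim
      case (elim n)
      let ?S = "\<lambda>D s. card {i \<in> {s..<s + m n}. (S ^^ i) x \<in> D}"
      let ?T = "\<lambda>D s. card {i \<in> {s..<s + m n}. (T ^^ i) x \<in> D}"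
      have hm: "h n + 1 + m n \<le> n"
      proof -
        have "m n \<le> n div 3" unfolding m_def using q by (intro div_le_mono2) auto
        then show ?thesis using elim(5) unfolding h_def by linarith
      qed
      show ?case
      proof (rule ccontr)
        assume "\<not> ?case"
        then have close: "dist ((S ^^ i) x) ((T ^^ (n - i)) x) < \<rho>" if "h n < i" "i \<le> h n + m n" for i
          using that by (auto simp: h_def m_def not_le)
        define y where "y = (S ^^ (h n + m n)) x"
        have Ty: "(T ^^ j) y = (if j \<le> h n + m n then (S ^^ (h n + m n - j)) x else (T ^^ (j - (h n + m n))) x)" for j
        proof -
          have TS: "(T ^^ k) ((S ^^ k) z) = z" for k z
            by (induction k arbitrary: z) (simp_all add: funpow_swap1 inv)
          show ?thesis
          proof (cases "j \<le> h n + m n")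
            case True
            then have "y = (S ^^ j) ((S ^^ (h n + m n - j)) x)"
              unfolding y_def by (metis comp_apply funpow_add le_add_diff_inverse)
            then show ?thesis using True TS by simp
          next
            case False
            then have "(T ^^ j) y = (T ^^ (j - (h n + m n))) ((T ^^ (h n + m n)) y)"
              by (metis comp_apply funpow_add le_add_diff_inverse2 linear)
            then show ?thesis using False TS unfolding y_def by simp
          qed
        qed
        have TyS: "(T ^^ j) y = (S ^^ (h n + m n - j)) x" if "j < m n" for j
          using that by (simp add: Ty)
        have TyT: "(T ^^ (j + n)) y = (T ^^ (j + (n - h n - m n))) x" for j
        proof -
          have "\<not> j + n \<le> h n + m n" "j + n - (h n + m n) = j + (n - h n - m n)" using hm by linarith+
          then show ?thesis using Ty[of "j + n"] by (simp only: if_False)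
        qed
        define N where "N = card {j \<in> {..<m n}. (T ^^ j) y \<in> ?D}"
        define B where "B = card {j \<in> {..<m n}. p ((T ^^ j) y) \<noteq> p ((T ^^ (j + n)) y)}"
        have "N = ?S ?D (h n + 1)"
          unfolding N_def
          by (rule bij_betw_same_card[where f = "\<lambda>j. h n + m n - j"],
              rule bij_betw_byWitness[where f' = "\<lambda>i. h n + m n - i"]) (auto simp: TyS)
        moreover have "\<bar>real (?S ?D (h n + 1)) - ?d * real (m n)\<bar> \<le> ?d / 2 * real (m n)"
          using elim(2)[unfolded m_def[symmetric], rule_format, of "h n + 1"] hm by blast
        then have "real (?S ?D (h n + 1)) \<ge> ?d * real (m n) - ?d / 2 * real (m n)"
          by linarith
        ultimately have N: "real N \<ge> 2 * c * real (m n)" by (simp add: c_def field_simps)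
        have "{j \<in> {..<m n}. p ((T ^^ j) y) \<noteq> p ((T ^^ (j + n)) y)}
            \<subseteq> {j \<in> {..<m n}. (T ^^ j) y \<in> - G} \<union> {j \<in> {..<m n}. (T ^^ (j + n)) y \<in> - G}"
        proof safe
          fix j assume j: "j < m n" and ne: "p ((T ^^ j) y) \<noteq> p ((T ^^ (j + n)) y)"
            and in_G: "(T ^^ (j + n)) y \<in> G" "(T ^^ j) y \<in> G"
          have "n - (h n + m n - j) = j + (n - h n - m n)" using j hm by linarith
          then have "dist ((T ^^ j) y) ((T ^^ (j + n)) y) < \<rho>"
            using close[of "h n + m n - j"] j by (simp add: TyS TyT)
          with ne const in_G show False by blast
        qed
        then have "B \<le> card ({j \<in> {..<m n}. (T ^^ j) y \<in> - G} \<union> {j \<in> {..<m n}. (T ^^ (j + n)) y \<in> - G})"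
          unfolding B_def by (intro card_mono) auto
        also have "\<dots> \<le> card {j \<in> {..<m n}. (T ^^ j) y \<in> - G} + card {j \<in> {..<m n}. (T ^^ (j + n)) y \<in> - G}"
          by (rule card_Un_le)
        also have "card {j \<in> {..<m n}. (T ^^ j) y \<in> - G} = ?S (- G) (h n + 1)"
          by (rule bij_betw_same_card[where f = "\<lambda>j. h n + m n - j"],
              rule bij_betw_byWitness[where f' = "\<lambda>i. h n + m n - i"]) (auto simp: TyS)
        also have "card {j \<in> {..<m n}. (T ^^ (j + n)) y \<in> - G} = ?T (- G) (n - h n - m n)"
          by (rule bij_betw_same_card[where f = "\<lambda>j. j + (n - h n - m n)"],
              rule bij_betw_byWitness[where f' = "\<lambda>i. i - (n - h n - m n)"]) (auto simp: TyT)
        finally have "real B \<le> real (?S (- G) (h n + 1)) + real (?T (- G) (n - h n - m n))" by linarith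
        also have "real (?S (- G) (h n + 1)) \<le> measure M (- G) * real (m n) + \<delta> / 4 * real (m n)"
          using elim(3)[unfolded m_def[symmetric], rule_format, of "h n + 1"] hm by linarith
        also have "real (?T (- G) (n - h n - m n)) \<le> measure M (- G) * real (m n) + \<delta> / 4 * real (m n)"
        proof -
          have "n - h n - m n + m n \<le> n" using hm by linarith
          then show ?thesis
            using elim(4)[unfolded m_def[symmetric], rule_format, of "n - h n - m n"] by linarith
        qed
        also have "measure M (- G) * real (m n) \<le> \<delta> / 4 * real (m n)"
          using mG by (intro mult_right_mono) auto
        finally have B: "real B \<le> \<delta> * real (m n)" by (simp add: field_simps)
        have "2 powr (3 / 2 * c * real (m n)) = 2 powr (2 * c * real (m n)) * (\<theta> powr \<delta>) powr real (m n)"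
          unfolding \<theta>\<delta> by (simp add: powr_powr powr_add[symmetric] algebra_simps)
        also have "\<dots> = 2 powr (2 * c * real (m n)) * \<theta> powr (\<delta> * real (m n))"
          by (simp add: powr_powr)
        also have "\<dots> \<le> 2 powr real N * \<theta> powr real B"
          using N B \<theta> by (intro mult_mono powr_mono powr_mono') auto
        also have "\<dots> = V n x"
        proof -
          have "y \<in> space M" by simp
          from T.total_gain_eq[OF p K this, of \<theta> n "m n"] have "V n x = 2 ^ N * \<theta> ^ B"
            unfolding V_def y_def[symmetric] N_def B_def .
          then show ?thesis using \<theta> by (simp add: powr_realpow)
        qed
        finally have "x \<in> A n" by (simp add: A_def)
        with elim(1) show False by simp
      qed
    qed
  qed
  with \<rho> show thesis by (rule that)
qed

section \<open>Hyperbolic automorphisms of the two-dimensional torus\<close>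

lemma linear_part_nth:
  fixes M :: "int^2^2"
  shows "linear_part M v $ 1 = of_int (M $ 1 $ 1) * v $ 1 + of_int (M $ 1 $ 2) * v $ 2"
    "linear_part M v $ 2 = of_int (M $ 2 $ 1) * v $ 1 + of_int (M $ 2 $ 2) * v $ 2"
  by (simp_all add: linear_part_def matrix_vector_mult_def map_matrix_def sum_2)

lemma linear_linear_part: "linear (linear_part M)"
  unfolding linear_part_def by (rule matrix_vector_mul_linear)

lemma linear_part_mult: "linear_part M (linear_part N v) = linear_part (M ** N) v"
proof -
  have "map_matrix of_int (M ** N) = (map_matrix of_int M ** map_matrix of_int N :: real^'a^'a)"
    by (simp add: vec_eq_iff map_matrix_def matrix_matrix_mult_def)
  then show ?thesis by (simp add: linear_part_def matrix_vector_mul_assoc)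
qed

lemma linear_part_1 [simp]: "linear_part (mat 1) v = v"
proof -
  have "map_matrix of_int (mat 1) = (mat 1 :: real^'a^'a)"
    by (auto simp: vec_eq_iff map_matrix_def mat_def)
  then show ?thesis by (simp add: linear_part_def)
qed

lemma toral_map_funpow: "(toral_map L ^^ k) (abs_torus v) = abs_torus ((linear_part L ^^ k) v)"
  by (induction k) (simp_all add: toral_map.abs_eq)

lemma linear_funpow: "linear (linear_part L ^^ k)"
proof (induction k)
  case 0
  have "linear_part L ^^ 0 = id" by (rule funpow.simps(1))
  then show ?case using linear_id by (simp only:)
next
  case (Suc k)
  then show ?case unfolding funpow.simps by (rule linear_compose) (rule linear_linear_part)
qed

lemma dist_toral_map_le:
  assumes L: "\<And>v. norm ((linear_part L ^^ k) v) \<le> c * norm v" and c: "c > 0"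
  shows "dist ((toral_map L ^^ k) x) ((toral_map L ^^ k) y) \<le> c * dist x y"
proof (rule field_le_epsilon)
  fix e :: real assume e: "e > 0"
  obtain v where v: "x = abs_torus v" by (rule abs_torus_cases)
  have "dist (abs_torus v) y < dist x y + e / c" using e c v by simp
  then obtain w where w: "abs_torus w = y" "dist v w < dist x y + e / c"
    by (rule dist_torus_lessD)
  have "dist ((toral_map L ^^ k) x) ((toral_map L ^^ k) y) \<le> norm ((linear_part L ^^ k) v - (linear_part L ^^ k) w)"
    unfolding v w(1)[symmetric] toral_map_funpow dist_norm[symmetric] by (rule dist_torus_le)
  also have "\<dots> = norm ((linear_part L ^^ k) (v - w))"
    by (simp add: linear_diff[OF linear_funpow])
  also have "\<dots> \<le> c * dist v w" using L[of "v - w"] by (simp add: dist_norm)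
  also have "\<dots> \<le> c * (dist x y + e / c)" using w c by (intro mult_left_mono) auto
  also have "\<dots> = c * dist x y + e" using c by (simp add: field_simps)
  finally show "dist ((toral_map L ^^ k) x) ((toral_map L ^^ k) y) \<le> c * dist x y + e" .
qed

lemma mod_int_vec_bounded:
  fixes d :: "real^2"
  obtains d' where "int_vec (d - d')" "norm d' \<le> 2"
proof
  let ?d' = "\<chi> i. frac (d $ i)"
  show "int_vec (d - ?d')" by (simp add: int_vec_def frac_def)
  have "norm ?d' \<le> (\<Sum>i\<in>UNIV. \<bar>?d' $ i\<bar>)" by (rule norm_le_l1_cart)
  also have "\<dots> \<le> (\<Sum>i\<in>(UNIV :: 2 set). 1)"
    by (intro sum_mono) (simp add: abs_of_nonneg frac_lt_1 less_imp_le)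
  finally show "norm ?d' \<le> 2" by simp
qed

text \<open>
  An integer matrix \<open>M\<close> with inverse \<open>N\<close>, an expanding eigenvector \<open>eu\<close> with eigenvalue \<open>a\<close>, a
  contracting eigenvector \<open>es\<close> with eigenvalue \<open>b\<close>, and the coordinates \<open>lu\<close>, \<open>ls\<close> with respect to this
  basis.
\<close>
locale hyperbolic_splitting =
  fixes M N :: "int^2^2" and a b :: real and lu ls :: "real^2 \<Rightarrow> real" and eu es :: "real^2"
  assumes MN: "M ** N = mat 1" and NM: "N ** M = mat 1"
    and lin_lu: "linear lu" and lin_ls: "linear ls"
    and decomp: "lu v *\<^sub>R eu + ls v *\<^sub>R es = v"
    and lu_M: "lu (linear_part M v) = a * lu v" and ls_M: "ls (linear_part M v) = b * ls v"
    and lu_eu: "lu eu = 1" and ls_eu: "ls eu = 0" and lu_es: "lu es = 0" and ls_es: "ls es = 1"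
    and a_gt: "\<bar>a\<bar> > 1" and ab: "\<bar>a\<bar> * \<bar>b\<bar> = 1"

text \<open>
  The determinant is \<open>\<plusminus>1\<close>. If the lower left entry vanished, the upper left one would be an
  eigenvalue of modulus 1, and if the characteristic polynomial had a discriminant \<open>\<le> 0\<close>, its roots
  would have modulus 1.
\<close>
lemma hyperbolic_eigenvalues:
  fixes M :: "int^2^2"
  assumes hyp: "hyperbolic_automorphism M"
  shows "M $ 2 $ 1 \<noteq> 0"
    "\<exists>a b :: real. a + b = of_int (M $ 1 $ 1 + M $ 2 $ 2) \<and>
      a * b = of_int (M $ 1 $ 1 * M $ 2 $ 2 - M $ 1 $ 2 * M $ 2 $ 1) \<and> \<bar>a\<bar> > 1 \<and> \<bar>a\<bar> * \<bar>b\<bar> = 1"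
proof -
  define A B C D where "A = M $ 1 $ 1" and "B = M $ 1 $ 2" and "C = M $ 2 $ 1" and "D = M $ 2 $ 2"
  note abcd = A_def B_def C_def D_def
  obtain N where "M ** N = mat 1" using hyp by (auto simp: hyperbolic_automorphism_def invertible_def)
  then have "det M * det N = 1" by (metis det_I det_mul)
  then have "\<bar>det M\<bar> = 1" by (metis abs_mult abs_one dvd_triv_left zdvd1_eq abs_abs)
  then have det: "\<bar>A * D - B * C\<bar> = 1" by (simp add: det_2 abcd)
  have no_unit: "cmod z \<noteq> 1" if "v \<noteq> 0" "map_matrix of_int M *v v = z *s v" for z and v :: "complex^2"
    using hyp that by (auto simp: hyperbolic_automorphism_def)
  show C: "M $ 2 $ 1 \<noteq> 0"
  proof
    assume 0: "M $ 2 $ 1 = 0"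
    let ?v = "vector [1, 0] :: complex^2"
    have "?v \<noteq> 0" by (auto simp: vec_eq_iff forall_2)
    moreover have "map_matrix of_int M *v ?v = of_int A *s ?v"
      using 0 by (simp add: vec_eq_iff forall_2 matrix_vector_mult_def map_matrix_def sum_2 abcd)
    ultimately have "cmod (of_int A) \<noteq> 1" by (rule no_unit)
    then have "\<bar>A\<bar> \<noteq> 1" by (simp add: norm_of_int) 
    moreover have "\<bar>A\<bar> * \<bar>D\<bar> = 1" using det 0 by (simp add: C_def abs_mult)
    ultimately show False using zmult_eq_1_iff[of "\<bar>A\<bar>" "\<bar>D\<bar>"] by auto
  qed
  have root: "cmod z \<noteq> 1" if z: "z\<^sup>2 - of_int (A + D) * z + of_int (A * D - B * C) = 0" for z
  proof (rule no_unit)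
    let ?v = "vector [z - of_int D, of_int C] :: complex^2"
    show "?v \<noteq> 0" using C by (auto simp: vec_eq_iff forall_2 abcd)
    have "of_int A * (z - of_int D) + of_int B * of_int C = z * (z - of_int D)"
      using z by (simp add: algebra_simps power2_eq_square)
    then show "map_matrix of_int M *v ?v = z *s ?v"
      by (simp add: vec_eq_iff forall_2 matrix_vector_mult_def map_matrix_def sum_2 abcd algebra_simps)
  qed
  define t d where "t = real_of_int (A + D)" and "d = real_of_int (A * D - B * C)"
  have d: "\<bar>d\<bar> = 1" unfolding d_def using det by linarith
  have "t\<^sup>2 - 4 * d > 0"
  proof (rule ccontr)
    assume neg: "\<not> t\<^sup>2 - 4 * d > 0"
    then have "4 * d \<ge> t\<^sup>2" by simp
    then have "d \<ge> 0" using zero_le_power2[of t] by linarith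
    then have d1: "d = 1" using d by simp
    have "(sqrt (4 * d - t\<^sup>2))\<^sup>2 = 4 * d - t\<^sup>2" using neg by simp
    then obtain s where s: "s * s = 4 * d - t * t" unfolding power2_eq_square by blast
    let ?z = "Complex (t / 2) (s / 2)"
    have "?z\<^sup>2 - of_real t * ?z + of_real d = 0"
      using s by (simp add: complex_eq_iff power2_eq_square algebra_simps)
    moreover have "of_real t = (of_int (A + D) :: complex)" "of_real d = (of_int (A * D - B * C) :: complex)"
      unfolding t_def d_def by (rule of_real_of_int_eq)+
    ultimately have "cmod ?z \<noteq> 1" by (intro root) simp
    moreover have "(cmod ?z)\<^sup>2 = d"
      unfolding cmod_power2 complex.sel using s by (simp add: power_divide power2_eq_square field_simps)
    ultimately show False using d1 norm_ge_zero[of ?z] by (auto simp: power2_eq_1_iff)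
  qed
  then have D0: "t\<^sup>2 - 4 * d > 0" .
  define x y where "x = (t + sqrt (t\<^sup>2 - 4 * d)) / 2" and "y = (t - sqrt (t\<^sup>2 - 4 * d)) / 2"
  have sum: "x + y = t" by (simp add: x_def y_def field_simps)
  have prod: "x * y = d"
    using D0 by (simp add: x_def y_def field_simps power2_eq_square[symmetric])
  have abs1: "\<bar>z\<bar> \<noteq> 1" if z: "z\<^sup>2 - t * z + d = 0" for z
  proof -
    have "(of_real z :: complex)\<^sup>2 - of_real t * of_real z + of_real d = 0"
      using z by (metis of_real_0 of_real_add of_real_diff of_real_mult of_real_power)
    then have "cmod (of_real z) \<noteq> 1" by (intro root) (simp add: t_def d_def)
    then show ?thesis by simp
  qed
  have "\<bar>x\<bar> \<noteq> 1" by (rule abs1) (simp add: sum[symmetric] prod[symmetric] power2_eq_square algebra_simps)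
  have xy: "\<bar>x\<bar> * \<bar>y\<bar> = 1" using prod d by (simp add: abs_mult[symmetric])
  show "\<exists>a b :: real. a + b = of_int (M $ 1 $ 1 + M $ 2 $ 2) \<and>
      a * b = of_int (M $ 1 $ 1 * M $ 2 $ 2 - M $ 1 $ 2 * M $ 2 $ 1) \<and> \<bar>a\<bar> > 1 \<and> \<bar>a\<bar> * \<bar>b\<bar> = 1"
    (is "\<exists>a b. ?P a b")
  proof (cases "\<bar>x\<bar> > 1")
    case True
    with sum prod xy show ?thesis
      by (intro exI[of _ x] exI[of _ y]) (simp add: t_def d_def abcd)
  next
    case False
    with \<open>\<bar>x\<bar> \<noteq> 1\<close> have "\<bar>x\<bar> < 1" by simp
    have "\<bar>y\<bar> > 1"
    proof (rule ccontr)
      assume "\<not> \<bar>y\<bar> > 1"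
      then have "\<bar>x\<bar> * \<bar>y\<bar> \<le> \<bar>x\<bar> * 1" by (intro mult_left_mono) auto
      with xy \<open>\<bar>x\<bar> < 1\<close> show False by simp
    qed
    with sum prod xy show ?thesis
      by (intro exI[of _ y] exI[of _ x]) (simp add: t_def d_def abcd mult.commute add.commute)
  qed
qed

text \<open>
  For a nonzero lower left entry \<open>C\<close>, the vectors \<open>(a - D, C)\<close> and \<open>(b - D, C)\<close> are eigenvectors; \<open>lu\<close>
  and \<open>ls\<close> are the coordinates obtained by Cramer's rule.
\<close>
lemma hyperbolic_splitting_exists:
  fixes M :: "int^2^2"
  assumes hyp: "hyperbolic_automorphism M"
  obtains N a b lu ls eu es where "hyperbolic_splitting M N a b lu ls eu es"
proof -
  define A B C D where "A = real_of_int (M $ 1 $ 1)" and "B = real_of_int (M $ 1 $ 2)"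
    and "C = real_of_int (M $ 2 $ 1)" and "D = real_of_int (M $ 2 $ 2)"
  note abcd = A_def B_def C_def D_def
  obtain N where N: "M ** N = mat 1" "N ** M = mat 1"
    using hyp by (auto simp: hyperbolic_automorphism_def invertible_def)
  have C: "C \<noteq> 0" using hyperbolic_eigenvalues(1)[OF hyp] by (simp add: abcd)
  from hyperbolic_eigenvalues(2)[OF hyp] obtain a b where
    sum: "a + b = A + D" and prod: "a * b = A * D - B * C" and a: "\<bar>a\<bar> > 1" and ab: "\<bar>a\<bar> * \<bar>b\<bar> = 1"
    by (auto simp: abcd)
  have ne: "a - b \<noteq> 0"
  proof
    assume "a - b = 0"
    with ab have "\<bar>a\<bar> * \<bar>a\<bar> = 1" by simp
    moreover have "\<bar>a\<bar> * \<bar>a\<bar> > 1 * 1" using a by (intro mult_strict_mono) auto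
    ultimately show False by simp
  qed
  have A: "A = a + b - D" using sum by simp
  have B: "B = (A * D - a * b) / C" using prod C by (simp add: field_simps)
  define lu where "lu v = (C * v $ 1 + (D - b) * v $ 2) / (C * (a - b))" for v :: "real^2"
  define ls where "ls v = (C * v $ 1 + (D - a) * v $ 2) / (C * (b - a))" for v :: "real^2"
  define eu es where "eu = (vector [a - D, C] :: real^2)" and "es = (vector [b - D, C] :: real^2)"
  have ne': "C * (a - b) \<noteq> 0" "C * (b - a) \<noteq> 0" using C ne by auto
  have ls_alt: "ls v = - ((C * v $ 1 + (D - a) * v $ 2) / (C * (a - b)))" for v
  proof -
    have "C * (b - a) = - (C * (a - b))" by (simp add: algebra_simps)
    then show ?thesis by (simp only: ls_def minus_divide_right)
  qed
  have M1: "linear_part M v $ 1 = A * v $ 1 + B * v $ 2"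
    and M2: "linear_part M v $ 2 = C * v $ 1 + D * v $ 2" for v
    by (simp_all add: linear_part_nth abcd)
  have BC: "B * C = A * D - a * b" using prod by simp
  have "hyperbolic_splitting M N a b lu ls eu es"
  proof (rule hyperbolic_splitting.intro)
    show "linear lu" unfolding lu_def
      by (rule linearI) (simp_all add: algebra_simps add_divide_distrib diff_divide_distrib)
    show "linear ls" unfolding ls_def
      by (rule linearI) (simp_all add: algebra_simps add_divide_distrib diff_divide_distrib)
    show "lu v *\<^sub>R eu + ls v *\<^sub>R es = v" for v
    proof -
      have "(lu v *\<^sub>R eu + ls v *\<^sub>R es) $ 2 = v $ 2"
      proof -
        have "lu v + ls v = (C * v $ 1 + (D - b) * v $ 2 - (C * v $ 1 + (D - a) * v $ 2)) / (C * (a - b))"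
          unfolding lu_def ls_alt diff_divide_distrib by simp
        also have "\<dots> = ((a - b) * v $ 2) / (C * (a - b))" by (simp add: algebra_simps)
        also have "\<dots> = v $ 2 / C" using ne by simp
        finally have "lu v + ls v = v $ 2 / C" .
        then have "(lu v + ls v) * C = v $ 2" using C by simp
        then show ?thesis by (simp add: eu_def es_def distrib_right)
      qed
      moreover have "(lu v *\<^sub>R eu + ls v *\<^sub>R es) $ 1 = v $ 1"
      proof -
        have "lu v * (a - D) + ls v * (b - D)
            = ((C * v $ 1 + (D - b) * v $ 2) * (a - D) - (C * v $ 1 + (D - a) * v $ 2) * (b - D)) / (C * (a - b))"
          unfolding lu_def ls_alt diff_divide_distrib by simp
        also have "\<dots> = (C * (a - b)) * v $ 1 / (C * (a - b))" by (simp add: algebra_simps)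
        also have "\<dots> = v $ 1" using ne' by simp
        finally have "lu v * (a - D) + ls v * (b - D) = v $ 1" .
        then show ?thesis by (simp add: eu_def es_def)
      qed
      ultimately show ?thesis by (simp add: vec_eq_iff forall_2)
    qed
    show "lu (linear_part M v) = a * lu v" for v
    proof -
      have "C * (A * v $ 1 + B * v $ 2) + (D - b) * (C * v $ 1 + D * v $ 2)
          = C * (A + D - b) * v $ 1 + (B * C + (D - b) * D) * v $ 2"
        by (simp add: algebra_simps)
      also have "\<dots> = a * (C * v $ 1 + (D - b) * v $ 2)"
        unfolding BC A by (simp add: algebra_simps)
      finally show ?thesis by (simp add: lu_def M1 M2)
    qed
    show "ls (linear_part M v) = b * ls v" for v
    proof -
      have "C * (A * v $ 1 + B * v $ 2) + (D - a) * (C * v $ 1 + D * v $ 2)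
          = C * (A + D - a) * v $ 1 + (B * C + (D - a) * D) * v $ 2"
        by (simp add: algebra_simps)
      also have "\<dots> = b * (C * v $ 1 + (D - a) * v $ 2)"
        unfolding BC A by (simp add: algebra_simps)
      finally show ?thesis by (simp add: ls_def M1 M2)
    qed
    show "lu eu = 1" "ls eu = 0" "lu es = 0" "ls es = 1"
      using ne' by (simp_all add: lu_def ls_def eu_def es_def algebra_simps)
  qed (use N a ab in auto)
  then show thesis by (rule that)
qed

context hyperbolic_splitting
begin

lemma a_nonzero: "a \<noteq> 0" using a_gt by auto
lemma b_nonzero: "b \<noteq> 0" using ab by auto
lemma abs_b: "\<bar>b\<bar> = 1 / \<bar>a\<bar>" using ab a_nonzero by (simp add: field_simps)

lemma lu_N: "lu (linear_part N v) = lu v / a"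
  using lu_M[of "linear_part N v"] a_nonzero by (simp add: linear_part_mult MN field_simps)

lemma ls_N: "ls (linear_part N v) = ls v / b"
  using ls_M[of "linear_part N v"] b_nonzero by (simp add: linear_part_mult MN field_simps)

lemma power_M: "(linear_part M ^^ k) v = (a ^ k * lu v) *\<^sub>R eu + (b ^ k * ls v) *\<^sub>R es"
proof -
  have "lu ((linear_part M ^^ k) v) = a ^ k * lu v" "ls ((linear_part M ^^ k) v) = b ^ k * ls v"
    by (induction k) (simp_all add: lu_M ls_M)
  then show ?thesis by (metis decomp)
qed

lemma power_N: "(linear_part N ^^ k) v = (lu v / a ^ k) *\<^sub>R eu + (ls v / b ^ k) *\<^sub>R es"
proof -
  have "lu ((linear_part N ^^ k) v) = lu v / a ^ k" "ls ((linear_part N ^^ k) v) = ls v / b ^ k"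
    by (induction k) (simp_all add: lu_N ls_N)
  then show ?thesis by (metis decomp)
qed

lemma toral_map_inverse: "toral_map M (toral_map N x) = x" "toral_map N (toral_map M x) = x"
  by (cases x rule: abs_torus_cases; simp add: toral_map.abs_eq linear_part_mult MN NM)+

lemma expansion_bound:
  obtains C where "C \<ge> 1"
    "\<And>k v. norm ((linear_part M ^^ k) v) \<le> C * \<bar>a\<bar> ^ k * norm v"
    "\<And>k v. norm ((linear_part N ^^ k) v) \<le> C * \<bar>a\<bar> ^ k * norm v"
proof -
  obtain cu where cu: "cu > 0" "\<And>v. norm (lu v) \<le> norm v * cu"
    using lin_lu bounded_linear.pos_bounded linear_conv_bounded_linear by blast
  obtain cs where cs: "cs > 0" "\<And>v. norm (ls v) \<le> norm v * cs"
    using lin_ls bounded_linear.pos_bounded linear_conv_bounded_linear by blast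
  let ?C = "1 + cu * norm eu + cs * norm es"
  have main: "norm ((s * lu v) *\<^sub>R eu + (t * ls v) *\<^sub>R es) \<le> ?C * \<bar>a\<bar> ^ k * norm v"
    if s: "\<bar>s\<bar> \<le> \<bar>a\<bar> ^ k" and t: "\<bar>t\<bar> \<le> \<bar>a\<bar> ^ k" for s t k v
  proof -
    have "norm ((s * lu v) *\<^sub>R eu + (t * ls v) *\<^sub>R es) \<le> norm ((s * lu v) *\<^sub>R eu) + norm ((t * ls v) *\<^sub>R es)"
      by (rule norm_triangle_ineq)
    also have "\<dots> = \<bar>s\<bar> * \<bar>lu v\<bar> * norm eu + \<bar>t\<bar> * \<bar>ls v\<bar> * norm es" by (simp add: abs_mult)
    also have "\<dots> \<le> \<bar>a\<bar> ^ k * (norm v * cu) * norm eu + \<bar>a\<bar> ^ k * (norm v * cs) * norm es"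
      using cu(2)[of v] cs(2)[of v] cu(1) cs(1) s t by (intro add_mono mult_mono) auto
    also have "\<dots> \<le> ?C * \<bar>a\<bar> ^ k * norm v"
      by (simp add: algebra_simps)
    finally show ?thesis .
  qed
  have big: "1 \<le> \<bar>a\<bar> ^ k" for k using a_gt by (simp add: one_le_power)
  have small: "\<bar>1 / \<bar>a\<bar> ^ k\<bar> \<le> \<bar>a\<bar> ^ k" for k
  proof -
    have "\<bar>1 / x\<bar> \<le> x" if "1 \<le> x" for x :: real
    proof -
      have "0 \<le> 1 / x" "1 / x \<le> 1" using that by simp_all
      then show ?thesis using that by linarith
    qed
    then show ?thesis using big[of k] by blast
  qed
  show thesis
  proof (rule that[of ?C])
    show "?C \<ge> 1" using cu(1) cs(1) by simp
    show "norm ((linear_part M ^^ k) v) \<le> ?C * \<bar>a\<bar> ^ k * norm v" for k v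
    proof -
      have "\<bar>b ^ k\<bar> = 1 / \<bar>a\<bar> ^ k" by (simp add: power_abs abs_b power_one_over)
      then have "\<bar>b ^ k\<bar> \<le> \<bar>a\<bar> ^ k" using small[of k] by simp
      then show ?thesis unfolding power_M by (intro main) (simp_all add: power_abs)
    qed
    have "norm ((1 / a ^ k * lu v) *\<^sub>R eu + (1 / b ^ k * ls v) *\<^sub>R es) \<le> ?C * \<bar>a\<bar> ^ k * norm v" for k v
    proof (rule main)
      show "\<bar>1 / a ^ k\<bar> \<le> \<bar>a\<bar> ^ k" using small[of k] by (simp add: power_abs)
      show "\<bar>1 / b ^ k\<bar> \<le> \<bar>a\<bar> ^ k" by (simp add: power_abs abs_b power_one_over)
    qed
    then show "norm ((linear_part N ^^ k) v) \<le> ?C * \<bar>a\<bar> ^ k * norm v" for k v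
      unfolding power_N by simp
  qed
qed

lemma dist_expansion:
  obtains C where "C \<ge> 1"
    "\<And>k x y. dist ((toral_map M ^^ k) x) ((toral_map M ^^ k) y) \<le> C * \<bar>a\<bar> ^ k * dist x y"
    "\<And>k x y. dist ((toral_map N ^^ k) x) ((toral_map N ^^ k) y) \<le> C * \<bar>a\<bar> ^ k * dist x y"
proof -
  obtain C where C: "C \<ge> 1" and 1: "\<And>k v. norm ((linear_part M ^^ k) v) \<le> C * \<bar>a\<bar> ^ k * norm v"
    and 2: "\<And>k v. norm ((linear_part N ^^ k) v) \<le> C * \<bar>a\<bar> ^ k * norm v"
    using expansion_bound by blast
  have pos: "C * \<bar>a\<bar> ^ k > 0" for k using C a_nonzero by (intro mult_pos_pos) auto
  show thesis by (rule that[OF C]) (rule dist_toral_map_le[OF 1 pos] dist_toral_map_le[OF 2 pos])+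
qed

text \<open>
  It suffices to find a small multiple \<open>s\<close> of \<open>eu\<close> and a small multiple \<open>t\<close> of \<open>es\<close> such that, for a
  lift \<open>v\<close> of \<open>x\<close>, the points \<open>M\<^sup>k (v + s)\<close> and \<open>N\<^sup>l (v + t)\<close> with \<open>n = k + l\<close> coincide modulo integer
  vectors: \<open>v + s\<close> then returns to \<open>v + t\<close> at time \<open>n\<close>. The difference of \<open>M\<^sup>k v\<close> and \<open>N\<^sup>l v\<close> is congruent
  to a vector of norm at most 2, whose two components are moved to the two sides.
\<close>
lemma ball_returns:
  obtains R where "R > 0"
    "\<And>x k n r. R < \<bar>a\<bar> ^ k * r \<Longrightarrow> 2 * k \<le> n \<Longrightarrow> \<exists>y. dist x y < r \<and> dist x ((toral_map M ^^ n) y) < r"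
proof -
  obtain cu where cu: "cu > 0" "\<And>v. norm (lu v) \<le> norm v * cu"
    using lin_lu bounded_linear.pos_bounded linear_conv_bounded_linear by blast
  obtain cs where cs: "cs > 0" "\<And>v. norm (ls v) \<le> norm v * cs"
    using lin_ls bounded_linear.pos_bounded linear_conv_bounded_linear by blast
  let ?R = "1 + 2 * cu * norm eu + 2 * cs * norm es"
  show thesis
  proof (rule that[of ?R])
    show "?R > 0" using cu(1) cs(1) by (simp add: add_pos_nonneg)
    fix x :: "2 torus" and k n r assume r: "?R < \<bar>a\<bar> ^ k * r" and n: "2 * k \<le> n"
    obtain v where v: "x = abs_torus v" by (rule abs_torus_cases)
    define l where "l = n - k"
    have kl: "k \<le> l" "n = l + k" using n by (auto simp: l_def)
    obtain d where d: "int_vec ((linear_part M ^^ k) v - (linear_part N ^^ l) v - d)" "norm d \<le> 2"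
      by (rule mod_int_vec_bounded)
    define s where "s = (- (lu d / a ^ k)) *\<^sub>R eu"
    define t where "t = (b ^ l * ls d) *\<^sub>R es"
    have Ms: "(linear_part M ^^ k) s = - (lu d) *\<^sub>R eu"
      using a_nonzero by (simp add: power_M s_def linear_scale[OF lin_lu] linear_scale[OF lin_ls] lu_eu ls_eu linear_neg[OF lin_lu] linear_neg[OF lin_ls])
    have Nt: "(linear_part N ^^ l) t = ls d *\<^sub>R es"
      using b_nonzero by (simp add: power_N t_def linear_scale[OF lin_lu] linear_scale[OF lin_ls] lu_es ls_es)
    have ak: "\<bar>a\<bar> ^ k > 0" using a_nonzero by simp
    have "norm s = \<bar>lu d\<bar> * norm eu / \<bar>a\<bar> ^ k" by (simp add: s_def power_abs)
    also have "\<dots> \<le> (2 * cu) * norm eu / \<bar>a\<bar> ^ k"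
      using cu(2)[of d] cu(1) d(2) ak by (intro divide_right_mono mult_right_mono) (auto intro: order_trans mult_right_mono)
    also have "\<dots> < r"
    proof -
      have "2 * cu * norm eu < \<bar>a\<bar> ^ k * r" using r cs(1) by (smt (verit) mult_nonneg_nonneg norm_ge_zero)
      then show ?thesis using ak by (simp add: divide_less_eq mult.commute)
    qed
    finally have s: "norm s < r" .
    have "norm t = \<bar>ls d\<bar> * norm es / \<bar>a\<bar> ^ l" by (simp add: t_def abs_mult power_abs abs_b power_one_over)
    also have "\<dots> \<le> \<bar>ls d\<bar> * norm es / \<bar>a\<bar> ^ k"
      using a_gt kl ak by (intro divide_left_mono mult_nonneg_nonneg power_increasing) auto
    also have "\<dots> \<le> (2 * cs) * norm es / \<bar>a\<bar> ^ k"
      using cs(2)[of d] cs(1) d(2) ak by (intro divide_right_mono mult_right_mono) (auto intro: order_trans mult_right_mono)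
    also have "\<dots> < r"
    proof -
      have "2 * cs * norm es < \<bar>a\<bar> ^ k * r" using r cu(1) by (smt (verit) mult_nonneg_nonneg norm_ge_zero)
      then show ?thesis using ak by (simp add: divide_less_eq mult.commute)
    qed
    finally have t: "norm t < r" .
    have "(linear_part M ^^ k) (v + s) - (linear_part N ^^ l) (v + t)
        = (linear_part M ^^ k) v - (linear_part N ^^ l) v - (lu d *\<^sub>R eu + ls d *\<^sub>R es)"
      by (simp add: linear_add[OF linear_funpow] Ms Nt)
    also have "\<dots> = (linear_part M ^^ k) v - (linear_part N ^^ l) v - d" by (simp only: decomp)
    finally have "(toral_map M ^^ k) (abs_torus (v + s)) = (toral_map N ^^ l) (abs_torus (v + t))"
      unfolding toral_map_funpow abs_torus_eq_iff using d(1) by simp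
    then have "(toral_map M ^^ n) (abs_torus (v + s)) = (toral_map M ^^ l) ((toral_map N ^^ l) (abs_torus (v + t)))"
      by (simp add: kl(2) funpow_add)
    also have "\<dots> = abs_torus (v + t)"
    proof -
      have "(toral_map M ^^ l) ((toral_map N ^^ l) z) = z" for z
        by (induction l arbitrary: z) (simp_all add: funpow_swap1 toral_map_inverse)
      then show ?thesis .
    qed
    finally have "(toral_map M ^^ n) (abs_torus (v + s)) = abs_torus (v + t)" .
    moreover have "dist x (abs_torus (v + s)) < r"
      using dist_torus_le[of v "v + s"] s by (simp add: v dist_norm)
    moreover have "dist x (abs_torus (v + t)) < r"
      using dist_torus_le[of v "v + t"] t by (simp add: v dist_norm)
    ultimately show "\<exists>y. dist x y < r \<and> dist x ((toral_map M ^^ n) y) < r" by metis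
  qed
qed

end

section \<open>Return times in one factor\<close>

lemma ergodic_map_inverse:
  assumes T: "ergodic_map M T" and S: "S \<in> measurable M M" and space: "space M = UNIV"
    and TS: "\<And>x. T (S x) = x" and ST: "\<And>x. S (T x) = x"
  shows "ergodic_map M S"
proof -
  interpret T: ergodic_map M T by (rule T)
  have distr: "distr M M S = M"
  proof (rule measure_eqI)
    fix A assume "A \<in> sets (distr M M S)"
    then have A: "A \<in> sets M" by simp
    have SA: "S -` A \<in> sets M" using measurable_sets[OF S A] by (simp add: space)
    have "emeasure (distr M M S) A = emeasure M (S -` A)"
      using A S by (simp add: emeasure_distr space)
    also have "\<dots> = emeasure (distr M M T) (S -` A)" by (simp add: T.T_inv)
    also have "\<dots> = emeasure M (T -` (S -` A))" using SA by (simp add: emeasure_distr space)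
    also have "T -` (S -` A) = A" by (auto simp: ST)
    finally show "emeasure (distr M M S) A = emeasure M A" .
  qed simp
  show ?thesis
  proof
    fix E assume E: "E \<in> sets M" "S -` E \<inter> space M = E"
    have "T -` E = T -` (S -` E)" using E(2) by (simp add: space)
    then have "T -` E \<inter> space M = E" by (auto simp: ST space)
    then show "measure M E = 0 \<or> measure M E = 1" by (rule T.ergodic[OF E(1)])
  qed (use S distr in auto)
qed

text \<open>
  If a ball around \<open>x\<close> returns at time \<open>n\<close>, then all distances between \<open>S\<^sup>i x\<close> and \<open>T\<^sup>n\<^sup>-\<^sup>i x\<close> with \<open>i\<close> in
  the window following \<open>n div 2\<close> are at most a constant times \<open>r * \<Lambda> powr (n / 2 + n / q)\<close>. For large \<open>n\<close>
  one of them is at least \<open>\<rho>\<close>, which bounds \<open>r\<close> from below. The finitely many remaining \<open>n\<close> are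
  absorbed by the constant \<open>c\<close>, because \<open>x\<close> is not periodic: a period would make all
  these distances vanish for arbitrarily large \<open>n\<close>.
\<close>
lemma return_time_lower_bound:
  fixes M :: "'a::metric_space measure"
  assumes T: "ergodic_map M T" and S: "ergodic_map M S" and sets_M: "sets M = sets borel"
    and TS: "\<And>x. T (S x) = x" and ST: "\<And>x. S (T x) = x"
    and \<Lambda>: "\<Lambda> > 1" and C: "C \<ge> 1"
    and exp_T: "\<And>k x y. dist ((T ^^ k) x) ((T ^^ k) y) \<le> C * \<Lambda> ^ k * dist x y"
    and exp_S: "\<And>k x y. dist ((S ^^ k) x) ((S ^^ k) y) \<le> C * \<Lambda> ^ k * dist x y"
    and entropy: "ks_entropy T M > 0" and q: "q \<ge> 3"
  shows "AE x in M. \<exists>c. \<forall>n\<ge>1. \<forall>r>0. \<forall>y. dist x y < r \<longrightarrow> dist x ((T ^^ n) y) < r \<longrightarrow>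
    - ln r \<le> c + real n * (1 / 2 + 1 / real q) * ln \<Lambda>"
proof -
  have space [simp]: "space M = UNIV" using sets_eq_imp_space_eq[OF sets_M] by simp
  from entropy obtain p :: "'a \<Rightarrow> nat" where p: "simple_function M p"
    and ent: "entropy_wrt_partition T M p > 0"
    unfolding ks_entropy_def less_SUP_iff by auto
  have ent': "\<not> (\<lambda>n. partition_entropy M (itinerary T p n) / real n) \<longlonglongrightarrow> 0"
    using ent unfolding entropy_wrt_partition_def by (auto dest: limI)
  have "finite (range p)" using simple_functionD(1)[OF p] by simp
  then obtain K where K: "range p \<subseteq> {..<K}" by (rule finite_nat_iff_bounded[THEN iffD1, THEN exE])
  obtain \<rho> where \<rho>: "\<rho> > 0" and far: "AE x in M. \<forall>\<^sub>F n in sequentially. \<exists>i. n div 2 < i \<and>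
      i \<le> n div 2 + n div q \<and> dist ((S ^^ i) x) ((T ^^ (n - i)) x) \<ge> \<rho>"
    by (rule close_windows_rare[OF T S sets_M TS p K ent' q])
  have ST_pow: "(S ^^ i) ((T ^^ n) y) = (T ^^ (n - i)) y" if "i \<le> n" for i n y
  proof -
    have "(S ^^ i) ((T ^^ i) z) = z" for z
      by (induction i arbitrary: z) (simp_all add: funpow_swap1 ST)
    moreover have "(T ^^ n) y = (T ^^ i) ((T ^^ (n - i)) y)"
      using that by (metis comp_apply funpow_add le_add_diff_inverse)
    ultimately show ?thesis by simp
  qed
  from far show ?thesis
  proof eventually_elim
    case (elim x)
    then obtain N where N: "\<And>n. n \<ge> N \<Longrightarrow> \<exists>i. n div 2 < i \<and>
      i \<le> n div 2 + n div q \<and> dist ((S ^^ i) x) ((T ^^ (n - i)) x) \<ge> \<rho>"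
      unfolding eventually_sequentially by blast
    have in_range: "i \<le> n" if "i \<le> n div 2 + n div q" for i n
    proof -
      have "n div q \<le> n div 3" using q by (intro div_le_mono2) auto
      then show ?thesis using that by linarith
    qed
    have nonper: "(T ^^ n) x \<noteq> x" if n: "n \<ge> 1" for n
    proof
      assume per: "(T ^^ n) x = x"
      have per': "(T ^^ (n * j)) x = x" for j
        by (induction j) (simp_all add: funpow_add per)
      have "n * N \<ge> N" using n by simp
      from N[OF this] obtain i where i: "i \<le> n * N div 2 + n * N div q"
        and far: "dist ((S ^^ i) x) ((T ^^ (n * N - i)) x) \<ge> \<rho>" by blast
      have "(S ^^ i) x = (T ^^ (n * N - i)) x"
        using ST_pow[OF in_range[OF i], of x] by (simp add: per')
      with far \<rho> show False by simp
    qed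
    define s where "s n = dist x ((T ^^ n) x) / (1 + C * \<Lambda> ^ n)" for n
    have pos: "C * \<Lambda> ^ n > 0" for n using C \<Lambda> by simp
    define c where "c = \<bar>ln (2 * C / \<rho>)\<bar> + (\<Sum>n<N. \<bar>ln (s n)\<bar>)"
    show ?case
    proof (intro exI[of _ c] allI impI)
      fix n :: nat and r :: real and y
      assume n: "n \<ge> 1" and r: "r > 0" and y: "dist x y < r" and Ty: "dist x ((T ^^ n) y) < r"
      have extra: "0 \<le> real n * (1 / 2 + 1 / real q) * ln \<Lambda>" using \<Lambda> by simp
      show "- ln r \<le> c + real n * (1 / 2 + 1 / real q) * ln \<Lambda>"
      proof (cases "n < N")
        case True
        have "dist x ((T ^^ n) x) \<le> dist x ((T ^^ n) y) + dist ((T ^^ n) y) ((T ^^ n) x)"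
          by (rule dist_triangle)
        also have "dist ((T ^^ n) y) ((T ^^ n) x) \<le> C * \<Lambda> ^ n * r"
          using exp_T[of n y x] y pos[of n] by (smt (verit) dist_commute mult_left_mono)
        finally have "dist x ((T ^^ n) x) \<le> (1 + C * \<Lambda> ^ n) * r"
          using Ty by (simp add: algebra_simps)
        then have "s n \<le> r" using pos[of n] by (simp add: s_def divide_le_eq mult.commute)
        moreover have "s n > 0" unfolding s_def using nonper[OF n] pos[of n]
          by (intro divide_pos_pos) (auto simp: add_pos_pos)
        ultimately have "ln (s n) \<le> ln r" using r by simp
        then have "- ln r \<le> \<bar>ln (s n)\<bar>" by linarith
        also have "\<dots> \<le> (\<Sum>n<N. \<bar>ln (s n)\<bar>)" using True by (intro member_le_sum) auto
        finally show ?thesis unfolding c_def using extra by linarith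
      next
        case False
        then obtain i where i: "n div 2 < i" "i \<le> n div 2 + n div q"
          and far: "dist ((S ^^ i) x) ((T ^^ (n - i)) x) \<ge> \<rho>" using N[of n] by auto
        define e where "e = real n * (1 / 2 + 1 / real q)"
        have e1: "real i \<le> e"
        proof -
          have "real i \<le> real (n div 2) + real (n div q)" using i(2) by linarith
          also have "\<dots> \<le> real n / 2 + real n / real q"
            using of_nat_div_le_of_nat[of n 2, where ?'a = real] of_nat_div_le_of_nat[of n q, where ?'a = real]
            by simp
          finally show ?thesis by (simp add: e_def algebra_simps)
        qed
        have e2: "real (n - i) \<le> e"
        proof -
          have "2 * (n - i) \<le> n" using i(1) by linarith
          then have "real (n - i) \<le> real n / 2" by linarith
          moreover have "e = real n / 2 + real n / real q" "0 \<le> real n / real q" by (simp_all add: e_def algebra_simps)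
          ultimately show ?thesis by linarith
        qed
        have grow: "C * \<Lambda> ^ k * d \<le> C * \<Lambda> powr e * r" if "real k \<le> e" "d < r" "0 \<le> d" for k d
        proof -
          have "\<Lambda> ^ k = \<Lambda> powr real k" using \<Lambda> by (simp add: powr_realpow)
          also have "\<dots> \<le> \<Lambda> powr e" using \<Lambda> that by (intro powr_mono) auto
          finally show ?thesis using C that \<Lambda> by (intro mult_mono) auto
        qed
        have "dist ((S ^^ i) x) ((T ^^ (n - i)) x)
            \<le> dist ((S ^^ i) x) ((S ^^ i) ((T ^^ n) y)) + dist ((T ^^ (n - i)) y) ((T ^^ (n - i)) x)"
          unfolding ST_pow[OF in_range[OF i(2)]] by (rule dist_triangle)
        also have "dist ((S ^^ i) x) ((S ^^ i) ((T ^^ n) y)) \<le> C * \<Lambda> ^ i * dist x ((T ^^ n) y)" by (rule exp_S)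
        also have "\<dots> \<le> C * \<Lambda> powr e * r" by (rule grow[OF e1 Ty]) simp
        also have "dist ((T ^^ (n - i)) y) ((T ^^ (n - i)) x) \<le> C * \<Lambda> ^ (n - i) * dist x y"
          using exp_T[of "n - i" y x] by (simp add: dist_commute)
        also have "\<dots> \<le> C * \<Lambda> powr e * r" by (rule grow[OF e2 y]) simp
        finally have "\<rho> \<le> C * \<Lambda> powr e * r + C * \<Lambda> powr e * r" using far by linarith
        then have "\<rho> \<le> 2 * C * \<Lambda> powr e * r" by (simp add: mult_ac)
        then have "1 \<le> (2 * C / \<rho>) * \<Lambda> powr e * r" using \<rho> by (simp add: field_simps)
        then have "0 \<le> ln ((2 * C / \<rho>) * \<Lambda> powr e * r)" by simp
        also have "\<dots> = ln (2 * C / \<rho>) + e * ln \<Lambda> + ln r"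
        proof -
          have "ln (u * \<Lambda> powr e * r) = ln u + e * ln \<Lambda> + ln r" if "u > 0" for u
            using that \<Lambda> r by (simp add: ln_mult_pos ln_powr)
          moreover have "2 * C / \<rho> > 0" using C \<rho> by simp
          ultimately show ?thesis by blast
        qed
        finally have "- ln r \<le> \<bar>ln (2 * C / \<rho>)\<bar> + e * ln \<Lambda>" by linarith
        moreover have "0 \<le> (\<Sum>n<N. \<bar>ln (s n)\<bar>)" by (rule sum_nonneg) simp
        ultimately show ?thesis unfolding c_def e_def by linarith
      qed
    qed
  qed
qed

lemma (in hyperbolic_splitting) toral_return_time_lower_bound:
  assumes erg: "ergodic_prob (toral_map M) \<mu>" and sets: "sets \<mu> = sets borel"
    and entropy: "ks_entropy (toral_map M) \<mu> > 0" and q: "q \<ge> 3"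
  shows "AE x in \<mu>. \<exists>c. \<forall>n\<ge>1. \<forall>r>0. \<forall>y. dist x y < r \<longrightarrow> dist x ((toral_map M ^^ n) y) < r \<longrightarrow>
    - ln r \<le> c + real n * (1 / 2 + 1 / real q) * ln \<bar>a\<bar>"
proof -
  obtain C where C: "C \<ge> 1"
    and 1: "\<And>k x y. dist ((toral_map M ^^ k) x) ((toral_map M ^^ k) y) \<le> C * \<bar>a\<bar> ^ k * dist x y"
    and 2: "\<And>k x y. dist ((toral_map N ^^ k) x) ((toral_map N ^^ k) y) \<le> C * \<bar>a\<bar> ^ k * dist x y"
    using dist_expansion by blast
  have space: "space \<mu> = UNIV" using sets_eq_imp_space_eq[OF sets] by simp
  interpret prob_space \<mu> using erg by (simp add: ergodic_prob_def)
  have T: "ergodic_map \<mu> (toral_map M)"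
    using erg by unfold_locales (auto simp: ergodic_prob_def invariant_measure_def)
  have "(C * \<bar>a\<bar>)-lipschitz_on UNIV (toral_map N)"
    using 2[of 1] C by (intro lipschitz_onI) auto
  then have "continuous_on UNIV (toral_map N)" by (rule lipschitz_on_continuous_on)
  then have "toral_map N \<in> borel_measurable borel" by (rule borel_measurable_continuous_onI)
  then have "toral_map N \<in> measurable \<mu> \<mu>" using measurable_cong_sets[OF sets sets] by simp
  then have S: "ergodic_map \<mu> (toral_map N)"
    by (rule ergodic_map_inverse[OF T _ space]) (rule toral_map_inverse)+
  show ?thesis
    by (rule return_time_lower_bound[OF T S sets toral_map_inverse a_gt C 1 2 entropy q])
qed

section \<open>Lyapunov exponents of the product\<close>

lemma tendsto_ln_over_n:
  fixes f :: "nat \<Rightarrow> real"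
  assumes c: "c > 0" and lower: "\<And>n. c * exp (real n * g) \<le> f n" and upper: "\<And>n. f n \<le> C * exp (real n * g)"
  shows "(\<lambda>n. ln (f n) / real n) \<longlonglongrightarrow> g"
proof (rule tendsto_sandwich)
  have f: "f n > 0" for n using lower[of n] c by (smt (verit) exp_gt_zero mult_pos_pos)
  have C: "C > 0" using upper[of 0] f[of 0] by simp
  show "\<forall>\<^sub>F n in sequentially. ln c / real n + g \<le> ln (f n) / real n"
    using eventually_gt_at_top[of 0]
  proof eventually_elim
    case (elim n)
    have "ln (c * exp (real n * g)) \<le> ln (f n)" using lower[of n] c f[of n] by simp
    then have "ln c + real n * g \<le> ln (f n)" using c by (simp add: ln_mult_pos)
    then have "(ln c + real n * g) / real n \<le> ln (f n) / real n" by (rule divide_right_mono) simp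
    then show ?case using elim by (simp add: add_divide_distrib)
  qed
  show "\<forall>\<^sub>F n in sequentially. ln (f n) / real n \<le> ln C / real n + g"
    using eventually_gt_at_top[of 0]
  proof eventually_elim
    case (elim n)
    have "ln (f n) \<le> ln (C * exp (real n * g))" using upper[of n] C f[of n] by simp
    then have "ln (f n) \<le> ln C + real n * g" using C by (simp add: ln_mult_pos)
    then have "ln (f n) / real n \<le> (ln C + real n * g) / real n" by (rule divide_right_mono) simp
    then show ?case using elim by (simp add: add_divide_distrib)
  qed
  have "(\<lambda>n. ln k / real n + g) \<longlonglongrightarrow> 0 + g" for k
    by (intro tendsto_add lim_const_over_n tendsto_const)
  then show "(\<lambda>n. ln c / real n + g) \<longlonglongrightarrow> g" "(\<lambda>n. ln C / real n + g) \<longlonglongrightarrow> g" by simp_all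
qed

lemma (in hyperbolic_splitting) growth:
  assumes v: "v \<noteq> 0" and g: "g = (if lu v = 0 then - ln \<bar>a\<bar> else ln \<bar>a\<bar>)"
  obtains c C where "c > 0" "\<And>n. c * exp (real n * g) \<le> norm ((linear_part M ^^ n) v)"
    "\<And>n. norm ((linear_part M ^^ n) v) \<le> C * exp (real n * g)"
proof -
  have a_exp: "\<bar>a\<bar> ^ n = exp (real n * ln \<bar>a\<bar>)" for n
    using a_nonzero by (simp add: exp_of_nat_mult)
  show thesis
  proof (cases "lu v = 0")
    case True
    have "norm ((linear_part M ^^ n) v) = norm v * exp (real n * g)" for n
    proof -
      have "(linear_part M ^^ n) v = b ^ n *\<^sub>R v"
        using power_M[of n v] decomp[of v] True by (metis add_0 scaleR_scaleR mult_zero_right scaleR_zero_left)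
      then have "norm ((linear_part M ^^ n) v) = norm v / \<bar>a\<bar> ^ n"
        by (simp add: power_abs abs_b power_one_over)
      then show ?thesis using True by (simp add: g a_exp exp_minus divide_inverse)
    qed
    then show thesis using v by (intro that[of "norm v" "norm v"]) auto
  next
    case False
    obtain cu where cu: "cu > 0" "\<And>v. norm (lu v) \<le> norm v * cu"
      using lin_lu bounded_linear.pos_bounded linear_conv_bounded_linear by blast
    obtain C where "C \<ge> 1" and C: "\<And>k v. norm ((linear_part M ^^ k) v) \<le> C * \<bar>a\<bar> ^ k * norm v"
      and "\<And>k v. norm ((linear_part N ^^ k) v) \<le> C * \<bar>a\<bar> ^ k * norm v"
      using expansion_bound by blast
    have "lu ((linear_part M ^^ n) v) = a ^ n * lu v" for n
      by (induction n) (simp_all add: lu_M)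
    then have "\<bar>lu v\<bar> * \<bar>a\<bar> ^ n \<le> norm ((linear_part M ^^ n) v) * cu" for n
      using cu(2)[of "(linear_part M ^^ n) v"] by (simp add: abs_mult power_abs mult.commute)
    then have "\<bar>lu v\<bar> / cu * exp (real n * g) \<le> norm ((linear_part M ^^ n) v)" for n
      using cu(1) False by (simp add: g a_exp field_simps)
    moreover have "norm ((linear_part M ^^ n) v) \<le> (C * norm v) * exp (real n * g)" for n
      using C[of n v] False by (simp add: g a_exp mult_ac)
    moreover have "\<bar>lu v\<bar> / cu > 0" using False cu(1) by simp
    ultimately show thesis by (rule that[rotated])
  qed
qed

lemma deriv_cocycle_product:
  "deriv_cocycle f (product_deriv M1 M2) n x v = ((linear_part M1 ^^ n) (fst v), (linear_part M2 ^^ n) (snd v))"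
  by (induction n) (simp_all add: product_deriv_def)

locale product_splitting =
  s1: hyperbolic_splitting M1 N1 a1 b1 lu1 ls1 eu1 es1 +
  s2: hyperbolic_splitting M2 N2 a2 b2 lu2 ls2 eu2 es2
  for M1 N1 a1 b1 lu1 ls1 eu1 es1 M2 N2 a2 b2 lu2 ls2 eu2 es2
begin

lemma growth_rate:
  assumes v: "v \<noteq> 0"
    and g1: "g1 = (if lu1 (fst v) = 0 then - ln \<bar>a1\<bar> else ln \<bar>a1\<bar>)"
    and g2: "g2 = (if lu2 (snd v) = 0 then - ln \<bar>a2\<bar> else ln \<bar>a2\<bar>)"
    and g: "g = (if fst v = 0 then g2 else if snd v = 0 then g1 else max g1 g2)"
  shows "(\<lambda>n. ln (norm (deriv_cocycle f (product_deriv M1 M2) n x v)) / real n) \<longlonglongrightarrow> g"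
proof -
  let ?f1 = "\<lambda>n. norm ((linear_part M1 ^^ n) (fst v))" and ?f2 = "\<lambda>n. norm ((linear_part M2 ^^ n) (snd v))"
  let ?f = "\<lambda>n. norm ((linear_part M1 ^^ n) (fst v), (linear_part M2 ^^ n) (snd v))"
  have zero: "(linear_part L ^^ n) 0 = 0" for L :: "int^2^2" and n
    by (rule linear_0[OF linear_funpow])
  have ge: "?f1 n \<le> ?f n" "?f2 n \<le> ?f n" for n
    using norm_fst_le norm_snd_le by auto
  have le: "?f n \<le> ?f1 n + ?f2 n" for n by (rule norm_Pair_le)
  have "(\<lambda>n. ln (?f n) / real n) \<longlonglongrightarrow> g"
  proof (cases "fst v = 0")
    case True
    then have "snd v \<noteq> 0" using v by (simp add: prod_eq_iff)
    then obtain c C where "c > 0" "\<And>n. c * exp (real n * g2) \<le> ?f2 n" "\<And>n. ?f2 n \<le> C * exp (real n * g2)"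
      using s2.growth g2 by metis
    then show ?thesis using True tendsto_ln_over_n[of c g2 ?f C] by (simp add: g zero)
  next
    case f: False
    then obtain c1 C1 where 1: "c1 > 0" "\<And>n. c1 * exp (real n * g1) \<le> ?f1 n" "\<And>n. ?f1 n \<le> C1 * exp (real n * g1)"
      using s1.growth g1 by metis
    show ?thesis
    proof (cases "snd v = 0")
      case True
      then show ?thesis using f tendsto_ln_over_n[OF 1] by (simp add: g zero)
    next
      case False
      then obtain c2 C2 where 2: "c2 > 0" "\<And>n. c2 * exp (real n * g2) \<le> ?f2 n" "\<And>n. ?f2 n \<le> C2 * exp (real n * g2)"
        using s2.growth g2 by metis
      have C: "C1 \<ge> 0" "C2 \<ge> 0"
        using 1(3)[of 0] 2(3)[of 0] by (auto intro: order_trans[OF norm_ge_zero])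
      have gg: "g = max g1 g2" using f False by (simp add: g)
      show ?thesis
      proof (rule tendsto_ln_over_n)
        show "min c1 c2 > 0" using 1 2 by simp
        fix n
        have "exp (real n * g1) \<le> exp (real n * g)" "exp (real n * g2) \<le> exp (real n * g)"
          by (simp_all add: gg mult_left_mono)
        then have "C1 * exp (real n * g1) \<le> C1 * exp (real n * g)" "C2 * exp (real n * g2) \<le> C2 * exp (real n * g)"
          using C by (simp_all add: mult_left_mono)
        then show "?f n \<le> (C1 + C2) * exp (real n * g)"
          using le[of n] 1(3)[of n] 2(3)[of n] by (simp add: distrib_right)
        have "min c1 c2 * exp (real n * g1) \<le> c1 * exp (real n * g1)" "min c1 c2 * exp (real n * g2) \<le> c2 * exp (real n * g2)"
          by (simp_all add: mult_right_mono)
        then have "min c1 c2 * exp (real n * g1) \<le> ?f n" "min c1 c2 * exp (real n * g2) \<le> ?f n"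
          using ge[of n] 1(2)[of n] 2(2)[of n] by linarith+
        then show "min c1 c2 * exp (real n * g) \<le> ?f n"
          unfolding gg by (cases "g1 \<le> g2") (simp_all add: max_def)
      qed
    qed
  qed
  then show ?thesis by (simp add: deriv_cocycle_product)
qed

lemma lyapunov_exponents_product:
  assumes "prob_space \<mu>"
  shows "lyapunov_exponents f (product_deriv M1 M2) \<mu> = {ln \<bar>a1\<bar>, - ln \<bar>a1\<bar>, ln \<bar>a2\<bar>, - ln \<bar>a2\<bar>}"
proof -
  interpret prob_space \<mu> by fact
  let ?rate = "\<lambda>x v l. (\<lambda>n. ln (norm (deriv_cocycle f (product_deriv M1 M2) n x v)) / real n) \<longlonglongrightarrow> l"
  have ne: "eu1 \<noteq> 0" "es1 \<noteq> 0" "eu2 \<noteq> 0" "es2 \<noteq> 0"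
    using s1.lu_eu s1.ls_es s2.lu_eu s2.ls_es linear_0[OF s1.lin_lu] linear_0[OF s1.lin_ls]
      linear_0[OF s2.lin_lu] linear_0[OF s2.lin_ls] by auto
  have "(\<exists>v. v \<noteq> 0 \<and> ?rate x v l) \<longleftrightarrow> l \<in> {ln \<bar>a1\<bar>, - ln \<bar>a1\<bar>, ln \<bar>a2\<bar>, - ln \<bar>a2\<bar>}" for x l
  proof
    assume "\<exists>v. v \<noteq> 0 \<and> ?rate x v l"
    then obtain v where v: "v \<noteq> 0" "?rate x v l" by blast
    define g1 where "g1 = (if lu1 (fst v) = 0 then - ln \<bar>a1\<bar> else ln \<bar>a1\<bar>)"
    define g2 where "g2 = (if lu2 (snd v) = 0 then - ln \<bar>a2\<bar> else ln \<bar>a2\<bar>)"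
    have "l = (if fst v = 0 then g2 else if snd v = 0 then g1 else max g1 g2)"
      by (rule LIMSEQ_unique[OF v(2) growth_rate[OF v(1) g1_def g2_def refl]])
    then have "l = g1 \<or> l = g2" by (simp add: max_def split: if_splits)
    then show "l \<in> {ln \<bar>a1\<bar>, - ln \<bar>a1\<bar>, ln \<bar>a2\<bar>, - ln \<bar>a2\<bar>}"
      unfolding g1_def g2_def by (auto split: if_splits)
  next
    assume "l \<in> {ln \<bar>a1\<bar>, - ln \<bar>a1\<bar>, ln \<bar>a2\<bar>, - ln \<bar>a2\<bar>}"
    moreover have "?rate x (eu1, 0) (ln \<bar>a1\<bar>)" "?rate x (es1, 0) (- ln \<bar>a1\<bar>)"
      "?rate x (0, eu2) (ln \<bar>a2\<bar>)" "?rate x (0, es2) (- ln \<bar>a2\<bar>)"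
      by (rule growth_rate[OF _ refl refl]; simp add: ne s1.lu_eu s1.lu_es s2.lu_eu s2.lu_es zero_prod_def)+
    ultimately show "\<exists>v. v \<noteq> 0 \<and> ?rate x v l"
      using ne by (auto simp: zero_prod_def intro!: exI[of _ "(eu1, 0)"] exI[of _ "(es1, 0)"] exI[of _ "(0, eu2)"] exI[of _ "(0, es2)"])
  qed
  then show ?thesis unfolding lyapunov_exponents_def by auto
qed

lemma extreme_exponents:
  assumes "prob_space \<mu>"
  shows "smallest_pos_exponent f (product_deriv M1 M2) \<mu> = min (ln \<bar>a1\<bar>) (ln \<bar>a2\<bar>)"
    "largest_neg_exponent f (product_deriv M1 M2) \<mu> = - min (ln \<bar>a1\<bar>) (ln \<bar>a2\<bar>)"
proof -
  have pos: "ln \<bar>a1\<bar> > 0" "ln \<bar>a2\<bar> > 0" using s1.a_gt s2.a_gt by simp_all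
  have "{l \<in> {ln \<bar>a1\<bar>, - ln \<bar>a1\<bar>, ln \<bar>a2\<bar>, - ln \<bar>a2\<bar>}. l > 0} = {ln \<bar>a1\<bar>, ln \<bar>a2\<bar>}"
    "{l \<in> {ln \<bar>a1\<bar>, - ln \<bar>a1\<bar>, ln \<bar>a2\<bar>, - ln \<bar>a2\<bar>}. l < 0} = {- ln \<bar>a1\<bar>, - ln \<bar>a2\<bar>}"
    using pos by auto
  moreover have "Min {x, y} = min x y" "Max {- x, - y} = - min x y" for x y :: real
    by (auto simp: max_def min_def)
  ultimately show "smallest_pos_exponent f (product_deriv M1 M2) \<mu> = min (ln \<bar>a1\<bar>) (ln \<bar>a2\<bar>)"
    "largest_neg_exponent f (product_deriv M1 M2) \<mu> = - min (ln \<bar>a1\<bar>) (ln \<bar>a2\<bar>)"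
    unfolding smallest_pos_exponent_def largest_neg_exponent_def lyapunov_exponents_product[OF assms]
    by (simp_all only:)
qed

end

section \<open>Return times in the product\<close>

lemma distr_pair_snd:
  assumes "prob_space M" "prob_space N"
  shows "distr (M \<Otimes>\<^sub>M N) N snd = N"
proof -
  interpret M: prob_space M by fact
  interpret N: prob_space N by fact
  show ?thesis
  proof (rule measure_eqI)
    fix A assume "A \<in> sets (distr (M \<Otimes>\<^sub>M N) N snd)"
    then have A: "A \<in> sets N" by simp
    have "snd -` A \<inter> space (M \<Otimes>\<^sub>M N) = space M \<times> A"
      using sets.sets_into_space[OF A] by (auto simp: space_pair_measure)
    then show "emeasure (distr (M \<Otimes>\<^sub>M N) N snd) A = emeasure N A"
      using A by (simp add: emeasure_distr N.emeasure_pair_measure_Times M.emeasure_space_1)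
  qed simp
qed

lemma invariant_measure_product:
  assumes "prob_space M" "prob_space N" "invariant_measure f M" "invariant_measure g N"
  shows "invariant_measure (map_prod f g) (M \<Otimes>\<^sub>M N)"
proof -
  interpret N: prob_space N by fact
  have f: "f \<in> measurable M M" "distr M M f = M" and g: "g \<in> measurable N N" "distr N N g = N"
    using assms by (auto simp: invariant_measure_def)
  have "distr M M f \<Otimes>\<^sub>M distr N N g = distr (M \<Otimes>\<^sub>M N) (M \<Otimes>\<^sub>M N) (\<lambda>(x, y). (f x, g y))"
    by (rule pair_measure_distr[OF f(1) g(1)]) (simp add: g(2) N.sigma_finite_measure_axioms)
  moreover have "(\<lambda>(x, y). (f x, g y)) = map_prod f g" by (auto simp: fun_eq_iff)
  ultimately have "distr (M \<Otimes>\<^sub>M N) (M \<Otimes>\<^sub>M N) (map_prod f g) = M \<Otimes>\<^sub>M N" by (simp add: f g)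
  moreover have "map_prod f g \<in> measurable (M \<Otimes>\<^sub>M N) (M \<Otimes>\<^sub>M N)"
    using f(1) g(1) by (auto simp: map_prod_def case_prod_unfold intro!: measurable_Pair)
  ultimately show ?thesis by (simp add: invariant_measure_def)
qed

lemma funpow_map_prod:
  fixes f :: "'a \<Rightarrow> 'a" and g :: "'b \<Rightarrow> 'b"
  shows "(map_prod f g ^^ n) z = ((f ^^ n) (fst z), (g ^^ n) (snd z))"
  by (induction n) simp_all

text \<open>
  The slope of the lower bound is only approximated, at the price of a constant depending on \<open>q\<close>. For
  fixed \<open>q\<close> this constant is negligible against \<open>- ln r\<close>, so \<open>q\<close> can tend to infinity after \<open>r\<close> has
  tended to 0.
\<close>
lemma tendsto_of_linear_bounds:
  fixes f :: "real \<Rightarrow> real"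
  assumes L: "L > 0"
    and lower: "\<And>q::nat. q \<ge> 3 \<Longrightarrow> \<exists>c. \<forall>r. 0 < r \<longrightarrow> r < 1 \<longrightarrow> - ln r \<le> c + f r * (1 / 2 + 1 / real q) * L"
    and upper: "\<And>r. 0 < r \<Longrightarrow> r < 1 \<Longrightarrow> f r \<le> 2 * (- ln r) / L + C"
  shows "((\<lambda>r. f r / (- ln r)) \<longlongrightarrow> 2 / L) (at_right 0)"
proof (rule order_tendstoI)
  have ev: "\<forall>\<^sub>F r::real in at_right 0. 0 < r \<and> r < 1"
    using eventually_at_right_real[of 0 "1::real"] by (auto elim: eventually_mono)
  have vanish: "((\<lambda>r. c / (- ln r)) \<longlongrightarrow> 0) (at_right (0::real))" for c :: real
    by real_asymp
  {
    fix x assume x: "2 / L < x"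
    have "((\<lambda>r. 2 / L + C / (- ln r)) \<longlongrightarrow> 2 / L + 0) (at_right 0)"
      by (intro tendsto_add tendsto_const vanish)
    then have "\<forall>\<^sub>F r in at_right 0. 2 / L + C / (- ln r) < x"
      using x by (intro order_tendstoD(2)) auto
    with ev show "\<forall>\<^sub>F r in at_right 0. f r / (- ln r) < x"
    proof eventually_elim
      case (elim r)
      then have pos: "- ln r > 0" by simp
      have "f r / (- ln r) \<le> (2 * (- ln r) / L + C) / (- ln r)"
        using elim upper[of r] pos by (intro divide_right_mono) auto
      also have "\<dots> = 2 / L + C / (- ln r)"
        unfolding add_divide_distrib using pos L by (simp add: field_simps)
      finally show ?case using elim by linarith
    qed
  }
  {
    fix x assume x: "x < 2 / L"
    have "(\<lambda>q. 1 / ((1 / 2 + 1 / real q) * L)) \<longlonglongrightarrow> 1 / ((1 / 2 + 0) * L)"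
      using L by (intro tendsto_intros lim_1_over_n) auto
    then have "(\<lambda>q. 1 / ((1 / 2 + 1 / real q) * L)) \<longlonglongrightarrow> 2 / L" by simp
    then have "\<forall>\<^sub>F q in sequentially. x < 1 / ((1 / 2 + 1 / real q) * L)"
      using x by (rule order_tendstoD(1))
    then obtain q where q: "q \<ge> 3" and xq: "x < 1 / ((1 / 2 + 1 / real q) * L)"
      unfolding eventually_sequentially by (metis max.cobounded1 max.cobounded2)
    define B where "B = (1 / 2 + 1 / real q) * L"
    have B: "B > 0" using L by (simp add: B_def add_pos_nonneg)
    obtain c where c: "\<And>r. 0 < r \<Longrightarrow> r < 1 \<Longrightarrow> - ln r \<le> c + f r * (1 / 2 + 1 / real q) * L"
      using lower[OF q] by blast
    have "((\<lambda>r. (1 - c / (- ln r)) / B) \<longlongrightarrow> (1 - 0) / B) (at_right 0)"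
      using B by (intro tendsto_intros vanish) auto
    then have "\<forall>\<^sub>F r in at_right 0. x < (1 - c / (- ln r)) / B"
      using xq by (intro order_tendstoD(1)) (auto simp: B_def)
    with ev show "\<forall>\<^sub>F r in at_right 0. x < f r / (- ln r)"
    proof eventually_elim
      case (elim r)
      then have pos: "- ln r > 0" by simp
      have "- ln r - c \<le> f r * B" using c[of r] elim by (simp add: B_def mult.assoc)
      then have "(- ln r - c) / (- ln r) \<le> f r * B / (- ln r)" using pos by (intro divide_right_mono) auto
      then have "1 - c / (- ln r) \<le> f r / (- ln r) * B"
        unfolding diff_divide_distrib using pos by simp
      then have "(1 - c / (- ln r)) / B \<le> f r / (- ln r)" using B by (simp only: pos_divide_le_eq)
      then show ?case using elim by linarith
    qed
  }
qed

context product_splitting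
begin

abbreviation A where "A \<equiv> product_map M1 M2"

abbreviation L where "L \<equiv> min (ln \<bar>a1\<bar>) (ln \<bar>a2\<bar>)"

lemma L_pos: "L > 0" using s1.a_gt s2.a_gt by simp

text \<open>
  With \<open>k\<close> the least number for which \<open>exp (k * L) * (r / 2)\<close> exceeds the constant \<open>R\<close> of both
  factors, the time \<open>2 * k\<close> is a return time of a ball of radius \<open>r / 2\<close> in either factor.
\<close>
lemma return_upper:
  obtains C where "\<And>x r. 0 < r \<Longrightarrow> r < 1 \<Longrightarrow>
    \<exists>k>0. (A ^^ k) ` ball x r \<inter> ball x r \<noteq> {} \<and> real k \<le> 2 * (- ln r) / L + C"
proof -
  obtain R1 where R1: "R1 > 0" "\<And>x k n r. R1 < \<bar>a1\<bar> ^ k * r \<Longrightarrow> 2 * k \<le> n \<Longrightarrow>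
      \<exists>y. dist x y < r \<and> dist x ((toral_map M1 ^^ n) y) < r" using s1.ball_returns by blast
  obtain R2 where R2: "R2 > 0" "\<And>x k n r. R2 < \<bar>a2\<bar> ^ k * r \<Longrightarrow> 2 * k \<le> n \<Longrightarrow>
      \<exists>y. dist x y < r \<and> dist x ((toral_map M2 ^^ n) y) < r" using s2.ball_returns by blast
  define R where "R = max 1 (max R1 R2)"
  have R: "R \<ge> 1" "R1 \<le> R" "R2 \<le> R" by (auto simp: R_def)
  show thesis
  proof (rule that)
    fix x :: "2 torus \<times> 2 torus" and r :: real assume r: "0 < r" "r < 1"
    define t where "t = (ln (2 * R) - ln r) / L"
    have t: "t \<ge> 0" using R r L_pos by (simp add: t_def)
    define k where "k = nat \<lfloor>t\<rfloor> + 1"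
    have k: "t < real k" "real k \<le> t + 1" using t by (simp_all add: k_def) linarith+
    have big: "R < l ^ k * (r / 2)" if l: "L \<le> ln l" "l > 1" for l
    proof -
      have "u = u / v * v" if "v > 0" for u v :: real using that by simp
      then have "ln (2 * R) - ln r = t * L" unfolding t_def using L_pos by blast
      also have "\<dots> < real k * L" using k L_pos by simp
      also have "\<dots> \<le> real k * ln l" using l by (intro mult_left_mono) auto
      finally have "ln (2 * R / r) < ln (l ^ k)" using R r l by (simp add: ln_div ln_realpow)
      then have "2 * R / r < l ^ k" using R r l by simp
      then show ?thesis using r by (simp add: field_simps)
    qed
    have "R1 < \<bar>a1\<bar> ^ k * (r / 2)" using big[of "\<bar>a1\<bar>"] s1.a_gt R by fastforce
    from R1(2)[OF this, of "2 * k"] obtain y1 where y1: "dist (fst x) y1 < r / 2"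
      "dist (fst x) ((toral_map M1 ^^ (2 * k)) y1) < r / 2" by blast
    have "R2 < \<bar>a2\<bar> ^ k * (r / 2)" using big[of "\<bar>a2\<bar>"] s2.a_gt R by fastforce
    from R2(2)[OF this, of "2 * k"] obtain y2 where y2: "dist (snd x) y2 < r / 2"
      "dist (snd x) ((toral_map M2 ^^ (2 * k)) y2) < r / 2" by blast
    have near: "dist x z < r" if "dist (fst x) (fst z) < r / 2" "dist (snd x) (snd z) < r / 2" for z
    proof -
      have "dist x z \<le> dist (fst x) (fst z) + dist (snd x) (snd z)"
        unfolding dist_prod_def by (rule sqrt_sum_squares_le_sum) auto
      then show ?thesis using that by linarith
    qed
    have "(y1, y2) \<in> ball x r" using near[of "(y1, y2)"] y1 y2 by simp
    moreover have "(A ^^ (2 * k)) (y1, y2) \<in> ball x r"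
      using near[of "(A ^^ (2 * k)) (y1, y2)"] y1 y2 by (simp add: product_map_def funpow_map_prod)
    ultimately have "(A ^^ (2 * k)) ` ball x r \<inter> ball x r \<noteq> {}" by blast
    moreover have "real (2 * k) \<le> 2 * (- ln r) / L + (2 * ln (2 * R) / L + 2)"
    proof -
      have "real (2 * k) \<le> 2 * (t + 1)" using k by simp
      also have "\<dots> = 2 * (- ln r) / L + (2 * ln (2 * R) / L + 2)"
        using L_pos by (simp add: t_def diff_divide_distrib)
      finally show ?thesis .
    qed
    ultimately show "\<exists>k>0. (A ^^ k) ` ball x r \<inter> ball x r \<noteq> {} \<and> real k \<le> 2 * (- ln r) / L + (2 * ln (2 * R) / L + 2)"
      by (intro exI[of _ "2 * k"]) (simp add: k_def)
  qed
qed

text \<open>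
  A return of a ball of the product is a return in both factors, so the lower bound of the factor with
  the smaller exponent applies.
\<close>
lemma return_time_limit:
  assumes low1: "\<And>q::nat. q \<ge> 3 \<Longrightarrow> \<exists>c. \<forall>n\<ge>1. \<forall>r>0. \<forall>y. dist (fst x) y < r \<longrightarrow> dist (fst x) ((toral_map M1 ^^ n) y) < r \<longrightarrow>
      - ln r \<le> c + real n * (1 / 2 + 1 / real q) * ln \<bar>a1\<bar>"
    and low2: "\<And>q::nat. q \<ge> 3 \<Longrightarrow> \<exists>c. \<forall>n\<ge>1. \<forall>r>0. \<forall>y. dist (snd x) y < r \<longrightarrow> dist (snd x) ((toral_map M2 ^^ n) y) < r \<longrightarrow>
      - ln r \<le> c + real n * (1 / 2 + 1 / real q) * ln \<bar>a2\<bar>"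
  shows "((\<lambda>r. real (return_time A (ball x r)) / (- ln r)) \<longlongrightarrow> 2 / L) (at_right 0)"
proof -
  obtain C where C: "\<And>x r. 0 < r \<Longrightarrow> r < 1 \<Longrightarrow>
    \<exists>k>0. (A ^^ k) ` ball x r \<inter> ball x r \<noteq> {} \<and> real k \<le> 2 * (- ln r) / L + C"
    using return_upper by blast
  show ?thesis
  proof (rule tendsto_of_linear_bounds[OF L_pos])
    fix r :: real assume r: "0 < r" "r < 1"
    from C[OF this, of x] obtain k where k: "k > 0" "(A ^^ k) ` ball x r \<inter> ball x r \<noteq> {}"
      and le: "real k \<le> 2 * (- ln r) / L + C" by blast
    have "return_time A (ball x r) \<le> k" unfolding return_time_def using k by (intro Least_le) auto
    then show "real (return_time A (ball x r)) \<le> 2 * (- ln r) / L + C" using le by linarith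
  next
    fix q :: nat assume q: "q \<ge> 3"
    obtain c1 where c1: "\<And>n r y. n \<ge> 1 \<Longrightarrow> r > 0 \<Longrightarrow> dist (fst x) y < r \<Longrightarrow> dist (fst x) ((toral_map M1 ^^ n) y) < r \<Longrightarrow>
      - ln r \<le> c1 + real n * (1 / 2 + 1 / real q) * ln \<bar>a1\<bar>" using low1[OF q] by blast
    obtain c2 where c2: "\<And>n r y. n \<ge> 1 \<Longrightarrow> r > 0 \<Longrightarrow> dist (snd x) y < r \<Longrightarrow> dist (snd x) ((toral_map M2 ^^ n) y) < r \<Longrightarrow>
      - ln r \<le> c2 + real n * (1 / 2 + 1 / real q) * ln \<bar>a2\<bar>" using low2[OF q] by blast
    have "- ln r \<le> max c1 c2 + real (return_time A (ball x r)) * (1 / 2 + 1 / real q) * L"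
      if r: "0 < r" "r < 1" for r
    proof -
      define n where "n = return_time A (ball x r)"
      from C[OF r, of x] have "\<exists>k. k > 0 \<and> (A ^^ k) ` ball x r \<inter> ball x r \<noteq> {}" by blast
      then have "n > 0 \<and> (A ^^ n) ` ball x r \<inter> ball x r \<noteq> {}"
        unfolding n_def return_time_def by (rule LeastI_ex)
      then obtain y where n: "n \<ge> 1" and y: "dist x y < r" "dist x ((A ^^ n) y) < r" by auto
      have A: "(A ^^ n) y = ((toral_map M1 ^^ n) (fst y), (toral_map M2 ^^ n) (snd y))"
        by (simp add: product_map_def funpow_map_prod)
      have "dist (fst x) (fst y) < r" "dist (fst x) ((toral_map M1 ^^ n) (fst y)) < r"
        using y dist_fst_le[of x y] dist_fst_le[of x "(A ^^ n) y"] by (auto simp: A)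
      from c1[OF n r(1) this] have 1: "- ln r \<le> c1 + real n * (1 / 2 + 1 / real q) * ln \<bar>a1\<bar>" .
      have "dist (snd x) (snd y) < r" "dist (snd x) ((toral_map M2 ^^ n) (snd y)) < r"
        using y dist_snd_le[of x y] dist_snd_le[of x "(A ^^ n) y"] by (auto simp: A)
      from c2[OF n r(1) this] have 2: "- ln r \<le> c2 + real n * (1 / 2 + 1 / real q) * ln \<bar>a2\<bar>" .
      from 1 2 show ?thesis unfolding n_def[symmetric] by (cases "ln \<bar>a1\<bar> \<le> ln \<bar>a2\<bar>") (auto simp: min_def)
    qed
    then show "\<exists>c. \<forall>r. 0 < r \<longrightarrow> r < 1 \<longrightarrow> - ln r \<le> c + real (return_time A (ball x r)) * (1 / 2 + 1 / real q) * L"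
      by blast
  qed
qed

end

theorem proposition4p1:
  fixes M1 M2 :: "int^2^2" and \<mu>1 \<mu>2 :: "2 torus measure"
  assumes "hyperbolic_automorphism M1" and "hyperbolic_automorphism M2"
    and "sets \<mu>1 = sets borel" and "sets \<mu>2 = sets borel"
    and "ergodic_prob (toral_map M1) \<mu>1" and "ergodic_prob (toral_map M2) \<mu>2"
    and "ks_entropy (toral_map M1) \<mu>1 > 0" and "ks_entropy (toral_map M2) \<mu>2 > 0"
  shows "let A = product_map M1 M2; D = product_deriv M1 M2; \<mu> = \<mu>1 \<Otimes>\<^sub>M \<mu>2 in
    prob_space \<mu> \<and> invariant_measure A \<mu> \<and>
    (AE x in \<mu>. ((\<lambda>r. real (return_time A (ball x r)) / (- ln r)) \<longlongrightarrow>
        1 / smallest_pos_exponent A D \<mu> - 1 / largest_neg_exponent A D \<mu>) (at_right 0))"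
proof -
  obtain N1 a1 b1 lu1 ls1 eu1 es1 where h1: "hyperbolic_splitting M1 N1 a1 b1 lu1 ls1 eu1 es1"
    using hyperbolic_splitting_exists[OF assms(1)] .
  obtain N2 a2 b2 lu2 ls2 eu2 es2 where h2: "hyperbolic_splitting M2 N2 a2 b2 lu2 ls2 eu2 es2"
    using hyperbolic_splitting_exists[OF assms(2)] .
  interpret s: product_splitting M1 N1 a1 b1 lu1 ls1 eu1 es1 M2 N2 a2 b2 lu2 ls2 eu2 es2
    using h1 h2 by (rule product_splitting.intro)
  have p1: "prob_space \<mu>1" and i1: "invariant_measure (toral_map M1) \<mu>1"
    and p2: "prob_space \<mu>2" and i2: "invariant_measure (toral_map M2) \<mu>2"
    using assms by (auto simp: ergodic_prob_def)
  interpret pair_prob_space \<mu>1 \<mu>2 by (intro pair_prob_space.intro pair_sigma_finite.intro p1 p2 prob_space_imp_sigma_finite)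
  let ?\<mu> = "\<mu>1 \<Otimes>\<^sub>M \<mu>2"
  have prob: "prob_space ?\<mu>" by (rule P.prob_space_axioms)
  have inv: "invariant_measure s.A ?\<mu>"
    unfolding product_map_def by (rule invariant_measure_product[OF p1 p2 i1 i2])
  have "AE x in \<mu>1. \<forall>q\<ge>3. \<exists>c. \<forall>n\<ge>1. \<forall>r>0. \<forall>y. dist x y < r \<longrightarrow> dist x ((toral_map M1 ^^ n) y) < r \<longrightarrow>
      - ln r \<le> c + real n * (1 / 2 + 1 / real q) * ln \<bar>a1\<bar>"
    using s.s1.toral_return_time_lower_bound[OF assms(5,3,7)] by (simp add: AE_all_countable)
  then have "AE x in distr ?\<mu> \<mu>1 fst. \<forall>q\<ge>3. \<exists>c. \<forall>n\<ge>1. \<forall>r>0. \<forall>y. dist x y < r \<longrightarrow> dist x ((toral_map M1 ^^ n) y) < r \<longrightarrow>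
      - ln r \<le> c + real n * (1 / 2 + 1 / real q) * ln \<bar>a1\<bar>"
    by (simp only: M2.distr_pair_fst)
  from AE_distrD[OF measurable_fst this]
  have low1: "AE x in ?\<mu>. \<forall>q\<ge>3. \<exists>c. \<forall>n\<ge>1. \<forall>r>0. \<forall>y. dist (fst x) y < r \<longrightarrow> dist (fst x) ((toral_map M1 ^^ n) y) < r \<longrightarrow>
      - ln r \<le> c + real n * (1 / 2 + 1 / real q) * ln \<bar>a1\<bar>" .
  have "AE x in \<mu>2. \<forall>q\<ge>3. \<exists>c. \<forall>n\<ge>1. \<forall>r>0. \<forall>y. dist x y < r \<longrightarrow> dist x ((toral_map M2 ^^ n) y) < r \<longrightarrow>
      - ln r \<le> c + real n * (1 / 2 + 1 / real q) * ln \<bar>a2\<bar>"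
    using s.s2.toral_return_time_lower_bound[OF assms(6,4,8)] by (simp add: AE_all_countable)
  then have "AE x in distr ?\<mu> \<mu>2 snd. \<forall>q\<ge>3. \<exists>c. \<forall>n\<ge>1. \<forall>r>0. \<forall>y. dist x y < r \<longrightarrow> dist x ((toral_map M2 ^^ n) y) < r \<longrightarrow>
      - ln r \<le> c + real n * (1 / 2 + 1 / real q) * ln \<bar>a2\<bar>"
    by (simp only: distr_pair_snd[OF p1 p2])
  from AE_distrD[OF measurable_snd this]
  have low2: "AE x in ?\<mu>. \<forall>q\<ge>3. \<exists>c. \<forall>n\<ge>1. \<forall>r>0. \<forall>y. dist (snd x) y < r \<longrightarrow> dist (snd x) ((toral_map M2 ^^ n) y) < r \<longrightarrow>
      - ln r \<le> c + real n * (1 / 2 + 1 / real q) * ln \<bar>a2\<bar>" .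
  from low1 low2 have lim: "AE x in ?\<mu>. ((\<lambda>r. real (return_time s.A (ball x r)) / (- ln r)) \<longlongrightarrow> 2 / s.L) (at_right 0)"
  proof eventually_elim
    case (elim x)
    then show ?case by (intro s.return_time_limit) blast+
  qed
  have "1 / smallest_pos_exponent s.A (product_deriv M1 M2) ?\<mu> - 1 / largest_neg_exponent s.A (product_deriv M1 M2) ?\<mu> = 2 / s.L"
    unfolding s.extreme_exponents[OF prob] by simp
  with prob inv lim show ?thesis by (simp only: Let_def simp_thms)
qed

end
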